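(* Fix $z\in(0,1/4)$. Let $w$ be a CGF for $\mathscr{G}X$ and $\tilde w$ a CGF for $\mathscr{G}Y$. Then for $x\in\mathbb{C}\setminus[x_3,x_4]$, $$z\big[Q(x,0,z)-Q(0,0,z)\big]=xY_0(x)+\frac1\pi\int_{x_1}^{x_2}\frac{t[-d(t)]^{1/2}}{2a(t)}\left[\frac{\partial_tw(t)}{w(t)-w(x)}-\frac{\partial_tw(t)}{w(t)-w(0)}\right]dt;$$ for $y\in\mathbb{C}\setminus[y_3,y_4]$, $$z\big[(y+1)Q(0,y,z)-Q(0,0,z)\big]=X_0(y)y+\frac1\pi\int_{y_1}^{y_2}\frac{t[-\tilde d(t)]^{1/2}}{2\tilde a(t)}\left[\frac{\partial_t\tilde w(t)}{\tilde w(t)-\tilde w(y)}-\frac{\partial_t\tilde w(t)}{\tilde w(t)-\tilde w(0)}\right]dt;$$ and $$zQ(0,0,z)=-\frac1\pi\int_{y_1}^{y_2}\frac{t[-\tilde d(t)]^{1/2}}{2\tilde a(t)}\left[\frac{\partial_t\tilde w(t)}{\tilde w(t)-\tilde w(-1)}-\frac{\partial_t\tilde w(t)}{\tilde w(t)-\tilde w(0)}\right]dt.$$ Here $Q(\cdot,0,z)$ and $Q(0,\cdot,z)$ denote the holomorphic continuations of these functions to $\mathbb{C}\setminus[x_3,x_4]$ and $\mathbb{C}\setminus[y_3,y_4]$.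
   Context: Gessel's walks are lattice walks in $\mathbb{Z}_+^2$ starting at $(0,0)$, with unit steps $(-1,0)$, $(1,1)$, $(1,0)$, $(-1,-1)$, never leaving $\mathbb{Z}_+^2$; $q(i,j,k)$ is the number of such walks of length $k$ ending at $(i,j)$ and $Q(x,y,z)=\sum q(i,j,k)x^iy^jz^k$. Fix $z\in(0,1/4)$; $\tilde a(y)=zy(y+1)$, $\tilde b(y)=-y$, $\tilde c(y)=z(y+1)$, $a(x)=zx^2$, $b(x)=zx^2-x+z$, $c(x)=z$, $\tilde d=\tilde b^2-4\tilde a\tilde c$, $d=b^2-4ac$. Roots: $y_1=0$, $y_2=[1-8z^2-(1-16z^2)^{1/2}]/(8z^2)$, $y_3=[1-8z^2+(1-16z^2)^{1/2}]/(8z^2)$, $y_4=\infty$; $x_1=[1+2z-(1+4z)^{1/2}]/(2z)$, $x_2=[1-2z-(1-4z)^{1/2}]/(2z)$, $x_3=[1-2z+(1-4z)^{1/2}]/(2z)$, $x_4=[1+2z+(1+4z)^{1/2}]/(2z)$; $\tilde d\le0$ on $[y_1,y_2]$ and $d\le 0$ on $[x_1,x_2]$. $X_0,X_1$ are the branches $(-\tilde b\pm\tilde d^{1/2})/(2\tilde a)$, meromorphic on $\mathbb{C}\setminus([y_1,y_2]\cup[y_3,y_4])$ with $|X_0|\le|X_1|$; $Y_0,Y_1$ are the branches $(-b\pm d^{1/2})/(2a)$, meromorphic on $\mathbb{C}\setminus([x_1,x_2]\cup[x_3,x_4])$ with $|Y_0|\le|Y_1|$. It is known that $zQ(x,0,z)$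 and $z(y+1)Q(0,y,z)$ extend holomorphically from the unit disc to $\mathbb{C}\setminus[x_3,x_4]$ and $\mathbb{C}\setminus[y_3,y_4]$. Curves: $X([y_1,y_2])=\{X_0^\pm(y):y\in[y_1,y_2]\}$ with $X_0^\pm(y)=(-\tilde b(y)\mp i(-\tilde d(y))^{1/2})/(2\tilde a(y))$, and $Y([x_1,x_2])=\{Y_0^\pm(x):x\in[x_1,x_2]\}$ with $Y_0^\pm(x)=(-b(x)\mp i(-d(x))^{1/2})/(2a(x))$; $\mathscr GX$ is the component of $\mathbb{C}\setminus X([y_1,y_2])$ containing $x_1$, and $\mathscr GY$ the component of $\mathbb{C}\setminus Y([x_1,x_2])$ containing $y_1$. A conformal gluing function (CGF) for an open simply connected set $\mathscr C\subset\mathbb{C}\cup\{\infty\}$, symmetric with respect to the real axis and different from $\emptyset,\mathbb{C},\mathbb{C}\cup\{\infty\}$, is a function $w$ meromorphic in $\mathscr C$ which maps $\mathscr C$ conformally onto the complex plane cut along some arc and satisfies $w(t)=w(\bar t)$ for all $t$ on the boundary of $\mathscr C$.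
   Formalization: The first two formulas are stated off [x_1,x_2] and [y_1,y_2], where Y_0, X_0 are undefined and the integrals diverge (there they hold by continuity); w and w̃ are taken as already continued meromorphically to C∖[x_3,x_4] and C∖[y_3,y_4], so that w(x), w̃(y) make sense outside GX, GY. *)

theory Defs
  imports "HOL-Complex_Analysis.Complex_Analysis"
begin

definition gessel_steps :: "(int \<times> int) set" where
  "gessel_steps = {(-1,0), (1,1), (1,0), (-1,-1)}"

definition gessel_walks :: "nat \<Rightarrow> nat \<Rightarrow> nat \<Rightarrow> (int \<times> int) list set" where
  "gessel_walks i j k = {ws. length ws = k \<and> set ws \<subseteq> gessel_steps \<and>
      (\<forall>n\<le>k. 0 \<le> sum_list (map fst (take n ws)) \<and> 0 \<le> sum_list (map snd (take n ws))) \<and>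
      sum_list (map fst ws) = int i \<and> sum_list (map snd ws) = int j}"

definition q :: "nat \<Rightarrow> nat \<Rightarrow> nat \<Rightarrow> nat" where
  "q i j k = card (gessel_walks i j k)"

definition Q :: "complex \<Rightarrow> complex \<Rightarrow> real \<Rightarrow> complex" where
  "Q x y z = infsum (\<lambda>(i,j,k). of_nat (q i j k) * x ^ i * y ^ j * of_real z ^ k) UNIV"

definition ga :: "real \<Rightarrow> 'a::real_field \<Rightarrow> 'a" where "ga z x = of_real z * x ^ 2"
definition gb :: "real \<Rightarrow> 'a::real_field \<Rightarrow> 'a" where "gb z x = of_real z * x ^ 2 - x + of_real z"
definition gc :: "real \<Rightarrow> 'a::real_field \<Rightarrow> 'a" where "gc z x = of_real z"
definition gd :: "real \<Rightarrow> 'a::real_field \<Rightarrow> 'a" where "gd z x = gb z x ^ 2 - 4 * ga z x * gc z x"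

definition ta :: "real \<Rightarrow> 'a::real_field \<Rightarrow> 'a" where "ta z y = of_real z * y * (y + 1)"
definition tb :: "real \<Rightarrow> 'a::real_field \<Rightarrow> 'a" where "tb z y = - y"
definition tc :: "real \<Rightarrow> 'a::real_field \<Rightarrow> 'a" where "tc z y = of_real z * (y + 1)"
definition td :: "real \<Rightarrow> 'a::real_field \<Rightarrow> 'a" where "td z y = tb z y ^ 2 - 4 * ta z y * tc z y"

definition y1 :: real where "y1 = 0"
definition y2 :: "real \<Rightarrow> real" where "y2 z = (1 - 8*z^2 - sqrt (1 - 16*z^2)) / (8*z^2)"
definition y3 :: "real \<Rightarrow> real" where "y3 z = (1 - 8*z^2 + sqrt (1 - 16*z^2)) / (8*z^2)"
definition x1 :: "real \<Rightarrow> real" where "x1 z = (1 + 2*z - sqrt (1 + 4*z)) / (2*z)"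
definition x2 :: "real \<Rightarrow> real" where "x2 z = (1 - 2*z - sqrt (1 - 4*z)) / (2*z)"
definition x3 :: "real \<Rightarrow> real" where "x3 z = (1 - 2*z + sqrt (1 - 4*z)) / (2*z)"
definition x4 :: "real \<Rightarrow> real" where "x4 z = (1 + 2*z + sqrt (1 + 4*z)) / (2*z)"

text \<open>The cut [x3,x4] and the cut [y3,y4] = [y3,infinity) as subsets of the complex plane.\<close>
definition cutX :: "real \<Rightarrow> complex set" where
  "cutX z = closed_segment (of_real (x3 z)) (of_real (x4 z))"
definition cutY :: "real \<Rightarrow> complex set" where
  "cutY z = {of_real r | r. y3 z \<le> r}"

definition X0 :: "real \<Rightarrow> complex \<Rightarrow> complex" where
  "X0 z y = (let r1 = (- tb z y + csqrt (td z y)) / (2 * ta z y);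
                 r2 = (- tb z y - csqrt (td z y)) / (2 * ta z y)
             in if cmod r1 \<le> cmod r2 then r1 else r2)"

definition Y0 :: "real \<Rightarrow> complex \<Rightarrow> complex" where
  "Y0 z x = (let r1 = (- gb z x + csqrt (gd z x)) / (2 * ga z x);
                 r2 = (- gb z x - csqrt (gd z x)) / (2 * ga z x)
             in if cmod r1 \<le> cmod r2 then r1 else r2)"

text \<open>X([y1,y2]); the point y = y1 = 0 (where ta vanishes) is mapped to infinity and hence
  contributes no point of the complex plane.\<close>
definition Xcurve :: "real \<Rightarrow> complex set" where
  "Xcurve z =
     {(of_real (- tb z y) - \<i> * of_real (sqrt (- td z y))) / of_real (2 * ta z y) | y. y1 < y \<and> y \<le> y2 z} \<union>
     {(of_real (- tb z y) + \<i> * of_real (sqrt (- td z y))) / of_real (2 * ta z y) | y. y1 < y \<and> y \<le> y2 z}"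

definition Ycurve :: "real \<Rightarrow> complex set" where
  "Ycurve z =
     {(of_real (- gb z x) - \<i> * of_real (sqrt (- gd z x))) / of_real (2 * ga z x) | x. x1 z \<le> x \<and> x \<le> x2 z} \<union>
     {(of_real (- gb z x) + \<i> * of_real (sqrt (- gd z x))) / of_real (2 * ga z x) | x. x1 z \<le> x \<and> x \<le> x2 z}"

definition GX :: "real \<Rightarrow> complex set" where
  "GX z = connected_component_set (- Xcurve z) (of_real (x1 z))"

definition GY :: "real \<Rightarrow> complex set" where
  "GY z = connected_component_set (- Ycurve z) (of_real y1)"

text \<open>w is meromorphic in C (poles P), maps C minus its poles injectively (hence conformally)
  onto the complex plane cut along an arc (with the poles going to infinity), and the boundary
  values (limits from inside C, possibly infinite) at t and conj t agree.\<close>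
definition CGF :: "complex set \<Rightarrow> (complex \<Rightarrow> complex) \<Rightarrow> bool" where
  "CGF C w \<longleftrightarrow> open C \<and> simply_connected C \<and> (\<forall>t. cnj t \<in> C \<longleftrightarrow> t \<in> C) \<and>
     C \<noteq> {} \<and> C \<noteq> UNIV \<and>
     (\<exists>P \<gamma>. P \<subseteq> C \<and> open (C - P) \<and> (\<forall>p\<in>P. is_pole w p) \<and> w holomorphic_on (C - P) \<and>
        inj_on w (C - P) \<and> arc \<gamma> \<and> w ` (C - P) = - path_image \<gamma>) \<and>
     (\<forall>t\<in>frontier C.
        (\<exists>l. (w \<longlongrightarrow> l) (at t within C) \<and> (w \<longlongrightarrow> l) (at (cnj t) within C)) \<or>
        (filterlim w at_infinity (at t within C) \<and> filterlim w at_infinity (at (cnj t) within C)))"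

text \<open>Meromorphic function on an open set D: every point is a pole or a point of
  complex differentiability (no removable singularities with wrong values).\<close>
definition mero_on :: "complex set \<Rightarrow> (complex \<Rightarrow> complex) \<Rightarrow> bool" where
  "mero_on D w \<longleftrightarrow> open D \<and> w meromorphic_on D \<and>
     (\<forall>x\<in>D. is_pole w x \<or> w field_differentiable (at x))"

definition kern :: "(complex \<Rightarrow> complex) \<Rightarrow> complex \<Rightarrow> complex \<Rightarrow> complex" where
  "kern w s t = (if is_pole w s then 0 else deriv w t / (w t - w s))"

end

theory Submission
  imports Defs
begin

text \<open>
  Put f(x) = z F(x) - x Y0(x). The functional equation gives f(x) = z Q(0,0,z) - z G(Y0(x)) for
  |x| > 1, so f is invariant under the involution x \<mapsto> x' exchanging the two roots of the
  kernel with the same y = Y0(x); this involution is complex conjugation on the boundary curve of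
  GX and maps the outside of GX into GX. By the identity theorem the gluing function w is
  invariant as well. Let h be f minus 1/pi times the integral in the theorem. The jump of x Y0(x)
  across [x1,x2] is cancelled by that of the Cauchy integral, so h is holomorphic off the cut;
  every value of h is attained in the closure of GX, and by the maximum principle (with the point
  at infinity added) h is constant. The same argument applies to z G(y) - y X0(y) on GY. There the
  base point 0 is an end point of the slit, where the integral converges because of the square
  root; the third formula is the case y = -1, where G vanishes.
\<close>

section \<open>Cauchy integrals along a slit\<close>

text \<open>Boundary values from the two sides of the slit are avoided. The Joukowski map turns the
  slit integral into half a contour integral over the unit circle; moving the circle outwards
  crosses one pole, whose residue is the singular term \<open>cut_sqrt * \<rho>\<close>, and what
  remains is holomorphic across the slit. The end point \<alpha> is covered too, as the y-plane
  requires. The pole of a CGF may sit anywhere in the domain, even on the slit or at the evaluation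
  point. So w is replaced by 1/(w - w(p)), with p in the unit disc off the slit; kernel differences
  change for finitely many t at most. Explicit branches are replaced by symmetric relations. With p
  = x Y0(x), (x + 1/x) + (p + 1/p) = 1/z, and the involution is x \<mapsto> 1/p; in the y-plane it
  is y \<mapsto> y' = 1/(y X0(y)^2), with (y + 1/y + 2)(y' + 1/y' + 2) = 1/z^2. Cuts, curves and
  domains become conditions on x + 1/x and y + 1/y. The curve is the fixed line or circle of
  "involution = conjugation", where Re (x + 1/x) = 1/(2z) and |y + 1/y + 2| = 1/z.\<close>

lemma Cauchy_type_integral_holomorphic:
  fixes c W :: "real \<Rightarrow> complex"
  assumes c: "continuous_on {a..b} c" and W: "continuous_on {a..b} W"
  shows "(\<lambda>v. integral {a..b} (\<lambda>t. c t / (W t - v))) holomorphic_on - (W ` {a..b})"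
proof -
  have op: "open (- (W ` {a..b}))"
    using W compact_continuous_image compact_imp_closed by blast
  show ?thesis
    unfolding holomorphic_on_open[OF op]
  proof
    fix v assume "v \<in> - (W ` {a..b})"
    then obtain e where e: "e > 0" "ball v e \<subseteq> - (W ` {a..b})"
      using op openE by blast
    have ne: "W t - u \<noteq> 0" if "u \<in> ball v e" "t \<in> {a..b}" for u t
      using e that by auto
    have "(\<lambda>v. integral (cbox a b) (\<lambda>t. c t / (W t - v))) holomorphic_on ball v e"
    proof (rule leibniz_rule_holomorphic[where fx = "\<lambda>v t. c t / (W t - v)^2"])
      fix x t assume "x \<in> ball v e" "t \<in> cbox a b"
      then have "W t - x \<noteq> 0" using ne by auto
      then show "((\<lambda>v. c t / (W t - v)) has_field_derivative c t / (W t - x)^2) (at x within ball v e)"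
        by (auto intro!: derivative_eq_intros simp: power2_eq_square)
    next
      fix x assume "x \<in> ball v e"
      then show "(\<lambda>t. c t / (W t - x)) integrable_on cbox a b"
        using ne c W by (intro integrable_continuous continuous_intros) auto
    next
      have "continuous_on (ball v e \<times> cbox a b) (\<lambda>z. c (snd z) / (W (snd z) - fst z)^2)"
        using ne by (intro continuous_intros continuous_on_compose2[OF c] continuous_on_compose2[OF W]) auto
      then show "continuous_on (ball v e \<times> cbox a b) (\<lambda>(x, t). c t / (W t - x)^2)"
        by (simp add: case_prod_unfold)
    qed auto
    then show "\<exists>f'. ((\<lambda>v. integral {a..b} (\<lambda>t. c t / (W t - v))) has_field_derivative f') (at v)"
      using e(1) by (auto simp: holomorphic_on_open)
  qed
qed

text \<open>With t = m + r cos \<theta> the singular weight becomes d\<theta>. An antiderivative is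
  -G(arccos ((t - m)/r)); arccos is not differentiable at the two ends, so the form of the
  fundamental theorem that asks for a derivative only in the open interval is used.\<close>

lemma has_integral_arccos_substitution:
  fixes \<psi> :: "real \<Rightarrow> complex"
  assumes ab: "\<alpha> < \<beta>" and \<psi>: "continuous_on {0..pi} \<psi>"
  shows "((\<lambda>t. \<psi> (arccos ((t - (\<alpha>+\<beta>)/2) / ((\<beta>-\<alpha>)/2))) / of_real (sqrt ((t-\<alpha>)*(\<beta>-t))))
           has_integral integral {0..pi} \<psi>) {\<alpha>..\<beta>}"
proof -
  define m r where "m = (\<alpha>+\<beta>)/2" and "r = (\<beta>-\<alpha>)/2"
  have r: "r > 0" using ab by (simp add: r_def)
  have \<alpha>: "\<alpha> = m - r" and \<beta>: "\<beta> = m + r" by (auto simp: m_def r_def field_simps)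
  have rng: "-1 \<le> (t - m)/r" "(t - m)/r \<le> 1" if "t \<in> {\<alpha>..\<beta>}" for t
    using that r by (auto simp: \<alpha> \<beta> field_simps)
  have rng': "-1 < (t - m)/r" "(t - m)/r < 1" if "t \<in> {\<alpha><..<\<beta>}" for t
    using that r by (auto simp: \<alpha> \<beta> field_simps)
  define G where "G = (\<lambda>u. integral {0..u} \<psi>)"
  have G: "(G has_vector_derivative \<psi> u) (at u within {0..pi})" if "u \<in> {0..pi}" for u
    unfolding G_def using integral_has_vector_derivative[OF \<psi> that] .
  have contG: "continuous_on {0..pi} G"
    using G by (meson continuous_on_eq_continuous_within has_vector_derivative_continuous)
  have "((\<lambda>t. \<psi> (arccos ((t - m) / r)) / of_real (sqrt ((t-\<alpha>)*(\<beta>-t))))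
           has_integral ((- G (arccos ((\<beta> - m)/r))) - (- G (arccos ((\<alpha> - m)/r))))) {\<alpha>..\<beta>}"
  proof (rule fundamental_theorem_of_calculus_interior)
    have "continuous_on {\<alpha>..\<beta>} (\<lambda>t. arccos ((t - m)/r))"
      using rng r by (intro continuous_intros) auto
    then show "continuous_on {\<alpha>..\<beta>} (\<lambda>t. - G (arccos ((t - m)/r)))"
      by (intro continuous_intros continuous_on_compose2[OF contG])
         (use r rng in \<open>auto intro!: arccos_lbound arccos_ubound\<close>)
  next
    fix t assume t: "t \<in> {\<alpha><..<\<beta>}"
    have a: "arccos ((t-m)/r) \<in> {0<..<pi}"
      using arccos_lt_bounded rng'[OF t] by auto
    have "(G has_vector_derivative \<psi> (arccos ((t-m)/r))) (at (arccos ((t-m)/r)) within {0..pi})"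
      using a by (intro G) auto
    moreover have "at (arccos ((t-m)/r)) within {0..pi} = at (arccos ((t-m)/r))"
      using a by (intro at_within_Icc_at) auto
    ultimately have G': "(G has_vector_derivative \<psi> (arccos ((t-m)/r))) (at (arccos ((t-m)/r)))"
      by simp
    have sq: "sqrt (1 - ((t-m)/r)^2) * r = sqrt ((t-\<alpha>)*(\<beta>-t))"
    proof -
      have "(t-\<alpha>)*(\<beta>-t) = (1 - ((t-m)/r)^2) * r^2"
        using r by (simp add: \<alpha> \<beta> field_simps power2_eq_square)
      then show ?thesis using r by (simp add: real_sqrt_mult)
    qed
    have "((\<lambda>t. arccos ((t-m)/r)) has_real_derivative inverse (- sqrt (1 - ((t-m)/r)^2)) * (1/r)) (at t)"
      using rng'[OF t] r by (auto intro!: derivative_eq_intros)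
    moreover have "inverse (- sqrt (1 - ((t-m)/r)^2)) * (1/r) = - (1 / sqrt ((t-\<alpha>)*(\<beta>-t)))"
      unfolding sq[symmetric] using r by (simp add: field_simps)
    ultimately have A: "((\<lambda>t. arccos ((t-m)/r)) has_real_derivative - (1 / sqrt ((t-\<alpha>)*(\<beta>-t)))) (at t)"
      by simp
    have "(G \<circ> (\<lambda>t. arccos ((t-m)/r)) has_vector_derivative
            (- (1 / sqrt ((t-\<alpha>)*(\<beta>-t)))) *\<^sub>R \<psi> (arccos ((t-m)/r))) (at t)"
      by (rule vector_diff_chain_at)
         (use A G' in \<open>simp_all add: has_real_derivative_iff_has_vector_derivative\<close>)
    then have "((\<lambda>t. - G (arccos ((t-m)/r))) has_vector_derivative
            - ((- (1 / sqrt ((t-\<alpha>)*(\<beta>-t)))) *\<^sub>R \<psi> (arccos ((t-m)/r)))) (at t)"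
      by (intro has_vector_derivative_minus) (simp add: o_def)
    then show "((\<lambda>t. - G (arccos ((t-m)/r))) has_vector_derivative
            \<psi> (arccos ((t - m) / r)) / of_real (sqrt ((t-\<alpha>)*(\<beta>-t)))) (at t)"
      by (simp add: scaleR_conv_of_real field_simps)
  qed (use ab in auto)
  moreover have "(\<beta> - m)/r = 1" "(\<alpha> - m)/r = -1" using r by (auto simp: \<alpha> \<beta>)
  ultimately have "((\<lambda>t. \<psi> (arccos ((t - m) / r)) / of_real (sqrt ((t-\<alpha>)*(\<beta>-t))))
           has_integral integral {0..pi} \<psi>) {\<alpha>..\<beta>}"
    by (simp add: G_def)
  then show ?thesis by (simp only: m_def r_def)
qed

text \<open>After t = m + r cos \<theta> the slit corresponds to the upper half circle. Invariance
  of k under s \<mapsto> 1/s, which is complex conjugation on the circle, makes the lower half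
  contribute the same amount; dividing by 2 undoes this, and dividing by \<i> turns ds/s into
  d\<theta>.\<close>

lemma has_integral_semicircle:
  fixes f :: "real \<Rightarrow> complex" and k :: "complex \<Rightarrow> complex"
  assumes ab: "\<alpha> < \<beta>" and k: "continuous_on (sphere 0 1) k"
    and sym: "\<And>s. norm s = 1 \<Longrightarrow> k (inverse s) = k s"
    and f: "\<And>\<theta>. 0 < \<theta> \<Longrightarrow> \<theta> < pi \<Longrightarrow>
       f ((\<alpha>+\<beta>)/2 + (\<beta>-\<alpha>)/2 * cos \<theta>) * of_real ((\<beta>-\<alpha>)/2 * sin \<theta>) = k (cis \<theta>)"
  shows "(f has_integral (1/(2*\<i>)) * contour_integral (circlepath 0 1) (\<lambda>s. k s / s)) {\<alpha>..\<beta>}"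
proof -
  define m r where "m = (\<alpha>+\<beta>)/2" and "r = (\<beta>-\<alpha>)/2"
  have r: "r > 0" using ab by (simp add: r_def)
  have \<alpha>: "\<alpha> = m - r" and \<beta>: "\<beta> = m + r" by (auto simp: m_def r_def field_simps)
  define \<psi> where "\<psi> = (\<lambda>\<theta>. k (cis \<theta>))"
  have c\<psi>: "continuous_on A \<psi>" for A
    unfolding \<psi>_def by (intro continuous_on_compose2[OF k] continuous_intros) auto
  have I1: "((\<lambda>t. \<psi> (arccos ((t - m) / r)) / of_real (sqrt ((t-\<alpha>)*(\<beta>-t))))
           has_integral integral {0..pi} \<psi>) {\<alpha>..\<beta>}"
    using has_integral_arccos_substitution[OF ab c\<psi>] by (simp add: m_def r_def)
  have I2: "(f has_integral integral {0..pi} \<psi>) {\<alpha>..\<beta>}"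
  \<comment> \<open>At the two ends sin \<theta> = 0 and \<open>f\<close> says nothing; they are a
    null set.\<close>
  proof (rule has_integral_spike_finite[OF _ _ I1, of "{\<alpha>,\<beta>}"])
    fix t assume "t \<in> {\<alpha>..\<beta>} - {\<alpha>,\<beta>}"
    then have t: "\<alpha> < t" "t < \<beta>" by auto
    have rng': "-1 < (t - m)/r" "(t - m)/r < 1"
      using t r by (auto simp: \<alpha> \<beta> field_simps)
    define \<theta> where "\<theta> = arccos ((t-m)/r)"
    have \<theta>: "0 < \<theta>" "\<theta> < pi" using arccos_lt_bounded[OF rng'] by (auto simp: \<theta>_def)
    have ct: "cos \<theta> = (t-m)/r" using rng' by (simp add: \<theta>_def)
    then have t': "t = m + r * cos \<theta>" using r by simp
    have "(t-\<alpha>)*(\<beta>-t) = r^2 * (1 - (cos \<theta>)^2)"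
      by (simp add: t' \<alpha> \<beta> algebra_simps power2_eq_square)
    then have "(t-\<alpha>)*(\<beta>-t) = (r * sin \<theta>)^2"
      by (simp add: power_mult_distrib sin_squared_eq)
    then have sq: "sqrt ((t-\<alpha>)*(\<beta>-t)) = r * sin \<theta>"
      using r \<theta> sin_gt_zero by (simp add: less_imp_le)
    have nz: "r * sin \<theta> \<noteq> 0" using r \<theta> sin_gt_zero[of \<theta>] by auto
    have "f t * of_real (r * sin \<theta>) = k (cis \<theta>)"
      using f[OF \<theta>] by (simp add: t' m_def r_def)
    then show "f t = \<psi> (arccos ((t - m) / r)) / of_real (sqrt ((t-\<alpha>)*(\<beta>-t)))"
      using nz unfolding sq \<psi>_def \<theta>_def[symmetric] 
      by (metis nonzero_mult_div_cancel_right of_real_eq_0_iff)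
  qed auto
  have int: "\<psi> integrable_on {a..b}" for a b by (rule integrable_continuous_real[OF c\<psi>])
  have "integral {pi..2*pi} \<psi> = integral {0..pi} \<psi>"
  proof -
    have "integral {pi..2*pi} \<psi> = integral {-(2*pi)..-pi} (\<lambda>x. \<psi> (-x))"
      by (rule Henstock_Kurzweil_Integration.integral_reflect_real[symmetric])
    also have "(\<lambda>x. \<psi> (-x)) = \<psi>"
    proof
      fix x show "\<psi> (-x) = \<psi> x" using sym[of "cis x"] by (simp add: \<psi>_def)
    qed
    also have "integral {-(2*pi)..-pi} \<psi> = integral {-(2*pi)..-pi} (\<lambda>x. \<psi> (x + 2*pi))"
      by (simp add: \<psi>_def cis.ctr)
    also have "\<dots> = integral {0..pi} \<psi>"
      using integral_shift_real_ivl[of "0" "2*pi" pi \<psi>] by simp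
    finally show ?thesis .
  qed
  then have tw: "integral {0..2*pi} \<psi> = 2 * integral {0..pi} \<psi>"
    using Henstock_Kurzweil_Integration.integral_combine[of 0 pi "2*pi" \<psi>] int by auto
  have "contour_integral (circlepath 0 1) (\<lambda>s. k s / s) = integral {0..2*pi} (\<lambda>t. k (cis t) * \<i>)"
    by (simp add: circlepath_def contour_integral_part_circlepath_eq)
  also have "\<dots> = 2 * \<i> * integral {0..pi} \<psi>"
    using tw by (simp add: \<psi>_def)
  finally show ?thesis using I2 by simp
qed

lemma contour_integral_circlepath_annulus_eq:
  assumes g: "g holomorphic_on {s. a < norm s \<and> norm s < b}" and "0 \<le> a" "a < r1" "r1 \<le> r2" "r2 < b"
  shows "contour_integral (circlepath 0 r1) g = contour_integral (circlepath 0 r2) g"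
proof (rule Cauchy_theorem_homotopic_loops)
  have op: "open {s::complex. a < norm s \<and> norm s < b}"
    by (intro open_Collect_conj open_Collect_less continuous_intros)
  then show "open {s::complex. a < norm s \<and> norm s < b}" .
  show "homotopic_loops {s. a < norm s \<and> norm s < b} (circlepath 0 r1) (circlepath 0 r2)"
  proof (rule homotopic_loops_linear)
    fix t :: real assume "t \<in> {0..1}"
    show "closed_segment (circlepath 0 r1 t) (circlepath 0 r2 t) \<subseteq> {s. a < norm s \<and> norm s < b}"
    proof
      fix s assume "s \<in> closed_segment (circlepath 0 r1 t) (circlepath 0 r2 t)"
      then obtain u where u: "0 \<le> u" "u \<le> 1"
        and s: "s = (1-u) *\<^sub>R circlepath 0 r1 t + u *\<^sub>R circlepath 0 r2 t"
        by (auto simp: in_segment)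
      have "s = of_real ((1-u)*r1 + u*r2) * exp (2 * of_real pi * \<i> * of_real t)"
        by (simp add: s circlepath scaleR_conv_of_real algebra_simps)
      moreover have "norm (exp (2 * complex_of_real pi * \<i> * of_real t)) = 1"
        by (simp add: norm_exp_eq_Re)
      ultimately have "norm s = \<bar>(1-u)*r1 + u*r2\<bar>" by (metis norm_mult norm_of_real mult.right_neutral)
      moreover have "(1-u)*r1 + u*r2 = r1 + u*(r2-r1)" by (simp add: algebra_simps)
      moreover have "0 \<le> u*(r2-r1)" "u*(r2-r1) \<le> r2-r1" using u assms by (auto intro: mult_left_le_one_le)
      ultimately show "s \<in> {s. a < norm s \<and> norm s < b}" using assms by auto
    qed
  qed auto
qed (use g in auto)

text \<open>Split k(s)/(s - \<zeta>) as g(s) + k(\<zeta>)/(s - \<zeta>) with g holomorphic on the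
  whole annulus. The integral of g does not depend on the radius, while 1/(s - \<zeta>) contributes
  only once the circle has passed \<zeta>.\<close>

lemma contour_integral_annulus_residue:
  assumes k: "k holomorphic_on {s. a < norm s \<and> norm s < b}" and a: "0 \<le> a" "a < r1"
    and \<zeta>: "r1 < norm \<zeta>" "norm \<zeta> < r2" and b: "r2 < b"
  shows "contour_integral (circlepath 0 r2) (\<lambda>s. k s / (s - \<zeta>))
       = contour_integral (circlepath 0 r1) (\<lambda>s. k s / (s - \<zeta>)) + 2 * of_real pi * \<i> * k \<zeta>"
proof -
  let ?A = "{s::complex. a < norm s \<and> norm s < b}"
  have op: "open ?A"
    by (intro open_Collect_conj open_Collect_less continuous_intros)
  define g where "g = (\<lambda>s. if s = \<zeta> then deriv k \<zeta> else (k s - k \<zeta>) / (s - \<zeta>))"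
  have g: "g holomorphic_on ?A"
    unfolding g_def by (rule pole_lemma_open[OF k op])
  have eq: "contour_integral (circlepath 0 r1) g = contour_integral (circlepath 0 r2) g"
    by (rule contour_integral_circlepath_annulus_eq[OF g]) (use assms in auto)
  have kk: "contour_integral (circlepath 0 r) (\<lambda>s. k s / (s - \<zeta>)) =
     contour_integral (circlepath 0 r) g + k \<zeta> * contour_integral (circlepath 0 r) (\<lambda>s. 1 / (s - \<zeta>))"
    if r: "r = r1 \<or> r = r2" for r
  proof -
    have r0: "a < r" "r < b" "r \<noteq> norm \<zeta>" "0 < r" using r assms by auto
    have im: "path_image (circlepath 0 r) \<subseteq> ?A - {\<zeta>}"
      using r0 by auto
    have opm: "open (?A - {\<zeta>})" using op by auto
    have i1: "g contour_integrable_on circlepath 0 r"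
      by (rule contour_integrable_holomorphic_simple[OF holomorphic_on_subset[OF g] opm]) (use im in auto)
    have i2: "(\<lambda>s. 1 / (s - \<zeta>)) contour_integrable_on circlepath 0 r"
      by (rule contour_integrable_holomorphic_simple[OF _ opm]) (use im in \<open>auto intro!: holomorphic_intros\<close>)
    have "contour_integral (circlepath 0 r) (\<lambda>s. k s / (s - \<zeta>)) =
      contour_integral (circlepath 0 r) (\<lambda>s. g s + k \<zeta> * (1 / (s - \<zeta>)))"
    proof (rule contour_integral_eq)
      fix s assume "s \<in> path_image (circlepath 0 r)"
      then have "s \<noteq> \<zeta>" using im by auto
      then show "k s / (s - \<zeta>) = g s + k \<zeta> * (1 / (s - \<zeta>))"
        by (simp add: g_def add_divide_distrib[symmetric])
    qed
    also have "\<dots> = contour_integral (circlepath 0 r) g + contour_integral (circlepath 0 r) (\<lambda>s. k \<zeta> * (1 / (s - \<zeta>)))"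
      by (rule contour_integral_add) (use i1 i2 contour_integrable_lmul in blast)+
    also have "contour_integral (circlepath 0 r) (\<lambda>s. k \<zeta> * (1 / (s - \<zeta>))) = k \<zeta> * contour_integral (circlepath 0 r) (\<lambda>s. 1 / (s - \<zeta>))"
      by (rule contour_integral_lmul[OF i2])
    finally show ?thesis .
  qed
  have "((\<lambda>s. 1 / (s - \<zeta>)) has_contour_integral (2 * of_real pi * \<i> * 1)) (circlepath 0 r2)"
    using \<zeta> by (intro Cauchy_integral_circlepath_simple) auto
  then have o2: "contour_integral (circlepath 0 r2) (\<lambda>s. 1 / (s - \<zeta>)) = 2 * of_real pi * \<i>"
    by (simp add: contour_integral_unique)
  have "((\<lambda>s. 1 / (s - \<zeta>)) has_contour_integral 0) (circlepath 0 r1)"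
    by (rule Cauchy_theorem_convex_simple[of _ "ball 0 (norm \<zeta>)"])
       (use \<zeta> a in \<open>auto intro!: holomorphic_intros\<close>)
  then have o1: "contour_integral (circlepath 0 r1) (\<lambda>s. 1 / (s - \<zeta>)) = 0"
    by (simp add: contour_integral_unique)
  show ?thesis
    using kk[of r1] kk[of r2] eq o1 o2 by simp
qed

section \<open>The square root off a slit and its Joukowski uniformisation\<close>

text \<open>The branch of sqrt ((x - \<alpha>)(x - \<beta>)) that behaves like x at infinity. The
  principal root of the product itself would jump on the vertical line through the midpoint; with x
  - m factored out, the argument of \<open>csqrt\<close> meets the nonpositive axis only for x on
  the slit.\<close>

definition cut_sqrt :: "real \<Rightarrow> real \<Rightarrow> complex \<Rightarrow> complex" where
  "cut_sqrt \<alpha> \<beta> x = (x - of_real ((\<alpha>+\<beta>)/2)) * csqrt (1 - (of_real ((\<beta>-\<alpha>)/2) / (x - of_real ((\<alpha>+\<beta>)/2)))^2)"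

text \<open>Folds the unit circle onto the slit and maps |s| > 1 one-to-one onto the complement of
  the slit.\<close>

definition joukowski :: "real \<Rightarrow> real \<Rightarrow> complex \<Rightarrow> complex" where
  "joukowski \<alpha> \<beta> s = of_real ((\<alpha>+\<beta>)/2) + of_real ((\<beta>-\<alpha>)/4) * (s + inverse s)"

text \<open>The two preimages u + sqrt (u^2 - 1) and u - sqrt (u^2 - 1) have product 1, so one of
  them has modulus at least 1.\<close>

lemma joukowski_surj:
  assumes "\<alpha> < \<beta>"
  obtains s where "1 \<le> norm s" "joukowski \<alpha> \<beta> s = x"
proof -
  define u where "u = (x - of_real ((\<alpha>+\<beta>)/2)) / of_real ((\<beta>-\<alpha>)/2)"
  define c where "c = csqrt (u^2 - 1)"
  have p: "(u + c) * (u - c) = 1"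
  proof -
    have "c^2 = u^2 - 1" by (simp add: c_def)
    then show ?thesis by (simp add: algebra_simps power2_eq_square)
  qed
  then have nz: "u + c \<noteq> 0" "u - c \<noteq> 0" and i: "inverse (u + c) = u - c"  "inverse (u - c) = u + c"
    by (auto simp: inverse_unique mult.commute)
  have "of_real ((\<beta>-\<alpha>)/4) * (u + u) = of_real ((\<beta>-\<alpha>)/2) * u" by simp
  also have "\<dots> = x - of_real ((\<alpha>+\<beta>)/2)" proof -
    have "of_real ((\<beta>-\<alpha>)/2) \<noteq> (0::complex)" using assms unfolding of_real_eq_0_iff by simp
    then show ?thesis unfolding u_def by (rule nonzero_mult_div_cancel_left[of _ "x - of_real ((\<alpha>+\<beta>)/2)", unfolded times_divide_eq_right[symmetric]])
  qed
  finally have J0: "of_real ((\<beta>-\<alpha>)/4) * (u + u) = x - of_real ((\<alpha>+\<beta>)/2)" .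
  have sums: "(u + c) + (u - c) = u + u" "(u - c) + (u + c) = u + u" by auto
  have aux: "M + (x - M) = x" for M by simp
  then have J: "joukowski \<alpha> \<beta> (u + c) = x" "joukowski \<alpha> \<beta> (u - c) = x"
    unfolding joukowski_def i by (simp_all only: sums J0 aux)
  have "norm (u + c) * norm (u - c) = 1" using p by (metis norm_mult norm_one)
  then have "1 \<le> norm (u + c) \<or> 1 \<le> norm (u - c)"
    using mult_strict_mono'[of "norm (u + c)" 1 "norm (u - c)" 1] by fastforce
  then show ?thesis using J that by blast
qed

lemma joukowski_inverse: "joukowski \<alpha> \<beta> (inverse s) = joukowski \<alpha> \<beta> s"
  by (simp add: joukowski_def add.commute)

lemma joukowski_eq_iff:
  assumes "\<alpha> < \<beta>" "s \<noteq> 0" "t \<noteq> 0"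
  shows "joukowski \<alpha> \<beta> s = joukowski \<alpha> \<beta> t \<longleftrightarrow> s = t \<or> s = inverse t"
proof -
  have "joukowski \<alpha> \<beta> s = joukowski \<alpha> \<beta> t \<longleftrightarrow> s + inverse s = t + inverse t"
    using assms by (simp add: joukowski_def)
  also have "\<dots> \<longleftrightarrow> (s - t) * (s * t - 1) = 0"
  proof -
    have "(s - t) * (s * t - 1) = s * t * ((s + inverse s) - (t + inverse t))"
      using assms by (simp add: algebra_simps)
    then show ?thesis using assms by (metis eq_iff_diff_eq_0 mult_eq_0_iff)
  qed
  also have "\<dots> \<longleftrightarrow> s = t \<or> s = inverse t"
    using assms by (auto simp: inverse_eq_divide eq_divide_eq)
  finally show ?thesis .
qed

lemma joukowski_cis:
  "joukowski \<alpha> \<beta> (cis \<theta>) = of_real ((\<alpha>+\<beta>)/2 + (\<beta>-\<alpha>)/2 * cos \<theta>)"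
  by (auto simp: joukowski_def complex_eq_iff)

lemma joukowski_unit_circle:
  assumes "\<alpha> < \<beta>" "norm s = 1"
  shows "joukowski \<alpha> \<beta> s \<in> closed_segment (of_real \<alpha>) (of_real \<beta>)"
proof -
  have "s = cis (Arg s)" using assms rcis_cmod_Arg[of s] by (simp add: rcis_def)
  then have J: "joukowski \<alpha> \<beta> s = of_real ((\<alpha>+\<beta>)/2 + (\<beta>-\<alpha>)/2 * cos (Arg s))"
    using joukowski_cis by metis
  have "(\<beta>-\<alpha>)/2 * (-1) \<le> (\<beta>-\<alpha>)/2 * cos (Arg s)" "(\<beta>-\<alpha>)/2 * cos (Arg s) \<le> (\<beta>-\<alpha>)/2 * 1"
    using assms by (intro mult_left_mono; simp)+
  then have "(\<alpha>+\<beta>)/2 + (\<beta>-\<alpha>)/2 * cos (Arg s) \<in> closed_segment \<alpha> \<beta>"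
    using assms by (auto simp: closed_segment_eq_real_ivl field_simps)
  then show ?thesis unfolding J by (rule closed_segment_of_real[THEN equalityD2, THEN subsetD, OF imageI])
qed

text \<open>The principal root in \<open>cut_sqrt\<close> is (s - 1/s)/(s + 1/s): its square is
  right, and its real part is positive because (s - 1/s) times the conjugate of s + 1/s has real
  part |s|^2 - |s|^(-2) > 0.\<close>

lemma cut_sqrt_joukowski:
  assumes "\<alpha> < \<beta>" "1 < norm s"
  shows "cut_sqrt \<alpha> \<beta> (joukowski \<alpha> \<beta> s) = of_real ((\<beta>-\<alpha>)/4) * (s - inverse s)"
proof -
  have s0: "s \<noteq> 0" using assms by auto
  have ssp: "s^2 \<noteq> -1" 
  proof
    assume "s^2 = -1"
    then have "norm (s^2) = 1" by simp
    then show False using one_less_power[OF assms(2), of 2] by (simp add: norm_power)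
  qed
  then have sp: "s + inverse s \<noteq> 0" using s0 by (auto simp: field_simps power2_eq_square add_eq_0_iff)
  define q where "q = (s - inverse s) / (s + inverse s)"
  have "Re ((s - inverse s) * cnj (s + inverse s)) = (cmod s)^2 - (cmod (inverse s))^2"
    unfolding cmod_power2 by (simp add: algebra_simps power2_eq_square)
  moreover have "cmod (inverse s) < 1" using assms by (simp add: norm_inverse inverse_less_1_iff)
  ultimately have "Re ((s - inverse s) * cnj (s + inverse s)) > 0"
    using one_less_power[OF assms(2), of 2] power_le_one[of "cmod (inverse s)" 2] by auto
  moreover have "q = (s - inverse s) * cnj (s + inverse s) / of_real ((cmod (s + inverse s))^2)"
    unfolding q_def by (subst complex_div_cnj) simp
  ultimately have q: "Re q > 0" using sp by (simp del: of_real_power add: zero_less_divide_iff)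
  have "q^2 = 1 - (2 / (s + inverse s))^2"
    using sp s0 unfolding q_def by (simp add: divide_simps) (simp add: power2_eq_square algebra_simps)
  then have c: "csqrt (1 - (2 / (s + inverse s))^2) = q"
    using q by (intro csqrt_unique) auto
  have "of_real ((\<beta>-\<alpha>)/2) / (joukowski \<alpha> \<beta> s - of_real ((\<alpha>+\<beta>)/2)) = 2 / (s + inverse s)"
    using assms sp by (simp add: joukowski_def divide_simps)
  then have "cut_sqrt \<alpha> \<beta> (joukowski \<alpha> \<beta> s) = of_real ((\<beta>-\<alpha>)/4) * (s + inverse s) * q"
    unfolding cut_sqrt_def using c by (simp add: joukowski_def)
  moreover have "(s + inverse s) * q = s - inverse s" using sp by (simp add: q_def)
  ultimately show ?thesis by (simp only: mult.assoc)
qed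

text \<open>Circles |s| = const go to ellipses with foci \<alpha> and \<beta>. This describes
  neighbourhoods of the slit without inverting the Joukowski map.\<close>

lemma norm_joukowski_foci:
  assumes "\<alpha> < \<beta>" "s \<noteq> 0"
  shows "norm (joukowski \<alpha> \<beta> s - of_real \<alpha>) + norm (joukowski \<alpha> \<beta> s - of_real \<beta>)
     = (\<beta>-\<alpha>)/2 * (norm s + inverse (norm s))"
proof -
  have 1: "joukowski \<alpha> \<beta> s - of_real \<alpha> = of_real ((\<beta>-\<alpha>)/4) * ((s+1)^2 / s)"
    using assms by (simp add: joukowski_def field_simps power2_eq_square)
  have 2: "joukowski \<alpha> \<beta> s - of_real \<beta> = of_real ((\<beta>-\<alpha>)/4) * ((s-1)^2 / s)"
    using assms by (simp add: joukowski_def field_simps power2_eq_square)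
  have 3: "(norm (s+1))^2 + (norm (s-1))^2 = 2 * (norm s)^2 + 2"
    unfolding cmod_power2 by (simp add: algebra_simps power2_eq_square)
  have "norm (joukowski \<alpha> \<beta> s - of_real \<alpha>) + norm (joukowski \<alpha> \<beta> s - of_real \<beta>) =
     (\<beta>-\<alpha>)/4 * (((norm (s+1))^2 + (norm (s-1))^2) / norm s)"
    unfolding 1 2 norm_mult norm_divide norm_power norm_of_real using assms by (simp add: field_simps)
  then show ?thesis unfolding 3 using assms by (simp add: field_simps power2_eq_square)
qed


text \<open>In the variable s the integrand has, outside the closed unit disc and near it, just one
  pole: the preimage \<zeta> of x with |\<zeta>| > 1. Its residue yields the multiple of
  \<open>cut_sqrt\<close>, and \<open>H\<close> is the integral over a larger circle, which depends
  holomorphically on x everywhere inside the corresponding ellipse. At x = \<alpha> the double zero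
  of the denominator at s = -1 is cancelled by a double zero of the numerator, so the same
  \<open>H\<close> serves there.\<close>

theorem cauchy_integral_across_slit:
  fixes w \<rho> :: "complex \<Rightarrow> complex"
  assumes ab: "\<alpha> < \<beta>" and U: "open U" "closed_segment (of_real \<alpha>) (of_real \<beta>) \<subseteq> U"
    and w: "w holomorphic_on U" "inj_on w U" and \<rho>: "\<rho> holomorphic_on U"
  obtains N H where "open N" "closed_segment (of_real \<alpha>) (of_real \<beta>) \<subseteq> N" "N \<subseteq> U" "H holomorphic_on N"
    "\<And>x. x \<in> N - closed_segment (of_real \<alpha>) (of_real \<beta>) \<union> {of_real \<alpha>} \<Longrightarrow>
       ((\<lambda>t. of_real (sqrt ((t-\<alpha>)*(\<beta>-t))) * \<rho> (of_real t) * (deriv w (of_real t) / (w (of_real t) - w x)))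
          has_integral of_real pi * cut_sqrt \<alpha> \<beta> x * \<rho> x + H x) {\<alpha>..\<beta>}"
proof -
  define S where "S = closed_segment (complex_of_real \<alpha>) (of_real \<beta>)"
  define T where "T = joukowski \<alpha> \<beta>"
  define r where "r = (\<beta>-\<alpha>)/2"
  have r: "r > 0" using ab by (simp add: r_def)
  have S: "S \<subseteq> U" "compact S" using U by (auto simp: S_def)
  obtain \<epsilon> where \<epsilon>: "\<epsilon> > 0" "(\<Union>x\<in>S. ball x \<epsilon>) \<subseteq> U"
    using compact_subset_open_imp_ball_epsilon_subset[OF S(2) U(1) S(1)] .
  \<comment> \<open>Moving s radially off the unit circle by |s| - 1 moves \<open>T s\<close> by at
    most r (|s| - 1), so |s| < R keeps it within \<epsilon> of the slit.\<close>
  define R where "R = 1 + \<epsilon>/r"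
  have R: "R > 1" using \<epsilon> r by (simp add: R_def)
  have T_ge: "T s \<in> U" if s: "1 \<le> norm s" "norm s < R" for s
  proof -
    have s0: "s \<noteq> 0" using s by auto
    define \<sigma> where "\<sigma> = s / of_real (norm s)"
    have n\<sigma>: "norm \<sigma> = 1" using s0 by (simp add: \<sigma>_def norm_divide)
    have "T \<sigma> \<in> S" using joukowski_unit_circle[OF ab n\<sigma>] by (simp add: S_def T_def)
    have "T s - T \<sigma> = of_real (r/2) * ((s - \<sigma>) + (inverse s - inverse \<sigma>))"
    proof -
      have aux: "(M + k * a) - (M + k * b) = k * (a - b)" for M k a b :: complex by (simp add: algebra_simps)
      show ?thesis unfolding T_def joukowski_def aux by (simp add: r_def algebra_simps)
    qed
    moreover have "dist (T \<sigma>) (T s) = norm (T s - T \<sigma>)" by (metis dist_norm dist_commute)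
    ultimately have "dist (T \<sigma>) (T s) = (r/2) * norm ((s - \<sigma>) + (inverse s - inverse \<sigma>))"
      using r by (simp add: norm_mult del: of_real_divide)
    also have "\<dots> \<le> (r/2) * (norm (s - \<sigma>) + norm (inverse s - inverse \<sigma>))"
      using r by (intro mult_left_mono norm_triangle_ineq) auto
    also have "s - \<sigma> = \<sigma> * of_real (norm s - 1)"
      using s0 by (simp add: \<sigma>_def divide_simps) (simp add: algebra_simps)
    also have "inverse s - inverse \<sigma> = inverse s * of_real (1 - norm s)"
      using s0 by (simp add: \<sigma>_def divide_simps)
    also have "norm (\<sigma> * of_real (norm s - 1)) + norm (inverse s * of_real (1 - norm s)) \<le> 2 * (norm s - 1)"
    proof -
      have "norm (inverse s) * (norm s - 1) \<le> 1 * (norm s - 1)"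
        using s by (intro mult_right_mono) (auto simp: norm_inverse inverse_le_1_iff)
      then show ?thesis using s n\<sigma> unfolding norm_mult norm_of_real by auto
    qed
    also have "(r/2) * (2 * (norm s - 1)) < \<epsilon>"
      using s r by (simp add: R_def field_simps)
    finally have "T s \<in> ball (T \<sigma>) \<epsilon>" using r by (simp add: mult_left_mono)
    then show ?thesis using \<open>T \<sigma> \<in> S\<close> \<epsilon> by blast
  qed
  have T_U: "T s \<in> U" if s: "1/R < norm s" "norm s < R" for s
  proof (cases "1 \<le> norm s")
    case False
    have s0: "0 < norm s" using s(1) R by (smt (verit) divide_pos_pos)
    have "norm (inverse s) < R" unfolding norm_inverse using s s0 R by (simp add: field_simps)
    moreover have "1 \<le> norm (inverse s)" unfolding norm_inverse using False s0 by (simp add: one_le_inverse_iff)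
    ultimately have "T (inverse s) \<in> U" by (intro T_ge)
    then show ?thesis by (simp add: T_def joukowski_inverse)
  qed (use T_ge s in auto)
  define R' where "R' = (1+R)/2"
  have R': "1 < R'" "R' < R" using R by (auto simp: R'_def)
  \<comment> \<open>The open ellipse that is the image of 1 \<le> |s| < R', given by its sum of
    focal distances.\<close>
  define N where "N = {x::complex. norm (x - of_real \<alpha>) + norm (x - of_real \<beta>) < r * (R' + inverse R')}"
  have openN: "open N" unfolding N_def by (intro open_Collect_less continuous_intros)
  have T_N: "T s \<in> N \<longleftrightarrow> norm s < R'" if "1 \<le> norm s" for s
  proof -
    have s: "s \<noteq> 0" "norm s \<noteq> 0" using that by auto
    have "T s \<in> N \<longleftrightarrow> norm s + inverse (norm s) < R' + inverse R'"
      using norm_joukowski_foci[OF ab s(1)] r by (simp add: N_def T_def r_def[symmetric])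
    also have "\<dots> \<longleftrightarrow> (R' - norm s) * (1 - inverse (R' * norm s)) > 0"
    proof -
      have "(R' - norm s) * (1 - inverse (R' * norm s)) = (R' + inverse R') - (norm s + inverse (norm s))"
        using s R' by (simp add: field_simps)
      then show ?thesis by auto
    qed
    also have "\<dots> \<longleftrightarrow> norm s < R'"
    proof -
      have "1 < R' * norm s" using R' that by (metis less_le_trans mult_left_mono mult.right_neutral order_less_le zero_less_one less_trans)
      then have "inverse (R' * norm s) < 1" using inverse_less_1_iff by blast
      then show ?thesis by (simp add: zero_less_mult_iff)
    qed
    finally show ?thesis .
  qed
  have N_T: "\<exists>s. 1 \<le> norm s \<and> norm s < R' \<and> T s = x" if "x \<in> N" for x
    using joukowski_surj[OF ab, of x] that T_N unfolding T_def by metis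
  have NU: "N \<subseteq> U"
  proof
    fix x assume "x \<in> N"
    then obtain s where "1 \<le> norm s" "norm s < R'" "T s = x" using N_T by blast
    then show "x \<in> U" using T_ge R' by force
  qed
  have SN: "S \<subseteq> N"
  proof
    fix x assume x: "x \<in> S"
    have "dist (of_real \<alpha>) x + dist x (of_real \<beta>) = dist (complex_of_real \<alpha>) (of_real \<beta>)"
      using x by (simp add: S_def between_mem_segment[symmetric] between)
    also have "\<dots> = 2 * r" using ab by (simp add: dist_norm r_def flip: of_real_diff)
    finally have "norm (x - of_real \<alpha>) + norm (x - of_real \<beta>) = r * 2"
      by (simp add: dist_norm norm_minus_commute)
    moreover have "R' + inverse R' > 2"
    proof -
      have "R' + inverse R' - 2 = (R'-1)^2 / R'" using R' by (simp add: field_simps power2_eq_square)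
      then show ?thesis using R' by (smt (verit) divide_pos_pos zero_less_power)
    qed
    ultimately show "x \<in> N" using r by (simp add: N_def)
  qed
  \<comment> \<open>On the unit circle -(r^2/4)(s - 1/s)^2 equals (r sin \<theta>)^2: one factor r
    sin \<theta> is the weight sqrt ((t - \<alpha>)(\<beta> - t)), the other comes from dt.\<close>
  define c where "c = (\<lambda>s. - (of_real (r^2/4) * (s - inverse s)^2 * \<rho> (T s) * deriv w (T s)))"
  define H where "H = (\<lambda>x. (1/(2*\<i>)) * contour_integral (circlepath 0 R') (\<lambda>s. (c s / (w (T s) - w x)) / s))"
  have dw: "deriv w holomorphic_on U" by (rule holomorphic_deriv[OF w(1) U(1)])
  have Tcis: "T (cis \<theta>) = of_real ((\<alpha>+\<beta>)/2 + (\<beta>-\<alpha>)/2 * cos \<theta>)" for \<theta>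
    by (simp only: T_def joukowski_cis)
  let ?Ann = "{s::complex. 1/R < norm s \<and> norm s < R}"
  have Ann0: "s \<noteq> 0" if "s \<in> ?Ann" for s using that R by (auto simp: not_less)
  have Thol: "T holomorphic_on A" if "0 \<notin> A" for A
    unfolding T_def joukowski_def[abs_def] using that by (intro holomorphic_intros) auto
  have comp: "(\<lambda>s. g (T s)) holomorphic_on ?Ann" if "g holomorphic_on U" for g
    using holomorphic_on_compose_gen[OF Thol that, of ?Ann] T_U Ann0 by (auto simp: o_def)
  have chol: "c holomorphic_on ?Ann"
    unfolding c_def using Ann0 by (intro holomorphic_intros comp \<rho> dw) auto
  have wT: "(\<lambda>s. w (T s)) holomorphic_on ?Ann" by (intro comp w)
  have w_eq: "w (T s) = w x \<longleftrightarrow> T s = x" if "s \<in> ?Ann" "x \<in> U" for s x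
    using w(2) T_U that by (auto simp: inj_on_def)
  have sph: "s \<in> ?Ann" if "norm s = 1 \<or> norm s = R'" for s
    using that R R' by (auto simp: field_simps) (smt (verit) mult_less_cancel_left2 mult_less_cancel_left1 mult_le_cancel_left1)
  have c_sym: "c (inverse s) = c s" for s
    unfolding c_def T_def joukowski_inverse by (simp add: power2_commute)
  have sq: "(cis \<theta> - inverse (cis \<theta>))^2 = - of_real (4 * (sin \<theta>)^2)" for \<theta>
  proof -
    have "cis \<theta> - inverse (cis \<theta>) = 2 * \<i> * of_real (sin \<theta>)"
      by (simp add: complex_eq_iff)
    then show ?thesis by (simp add: power_mult_distrib)
  qed
  have sqs: "sqrt ((\<alpha>+\<beta>)/2 + (\<beta>-\<alpha>)/2 * cos \<theta> - \<alpha>) * sqrt (\<beta> - ((\<alpha>+\<beta>)/2 + (\<beta>-\<alpha>)/2 * cos \<theta>)) = r * sin \<theta>"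
    if "0 < \<theta>" "\<theta> < pi" for \<theta>
  proof -
    have "((\<alpha>+\<beta>)/2 + (\<beta>-\<alpha>)/2 * cos \<theta> - \<alpha>) * (\<beta> - ((\<alpha>+\<beta>)/2 + (\<beta>-\<alpha>)/2 * cos \<theta>)) = r^2 * (1 - (cos \<theta>)^2)"
      by (simp add: r_def field_simps power2_eq_square)
    also have "\<dots> = (r * sin \<theta>)^2" by (simp add: power_mult_distrib sin_squared_eq)
    finally show ?thesis using r sin_gt_zero[OF that] by (simp flip: real_sqrt_mult)
  qed
  have semi: "((\<lambda>t. of_real (sqrt ((t-\<alpha>)*(\<beta>-t))) * \<rho> (of_real t) * (deriv w (of_real t) / (w (of_real t) - w x)))
          has_integral (1/(2*\<i>)) * contour_integral (circlepath 0 1) (\<lambda>s. k s / s)) {\<alpha>..\<beta>}"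
    if k: "continuous_on (sphere 0 1) k" "\<And>s. norm s = 1 \<Longrightarrow> k (inverse s) = k s"
      and kc: "\<And>s. norm s = 1 \<Longrightarrow> s \<noteq> 1 \<Longrightarrow> s \<noteq> -1 \<Longrightarrow> k s = c s / (w (T s) - w x)" for k x
  proof (rule has_integral_semicircle[OF ab k])
    fix \<theta> assume \<theta>: "0 < \<theta>" "\<theta> < pi"
    have "Im (cis \<theta>) \<noteq> 0" using sin_gt_zero[OF \<theta>] by simp
    then have "cis \<theta> \<noteq> 1" "cis \<theta> \<noteq> -1" by (metis one_complex.simps(2) uminus_complex.simps(2) neg_0_equal_iff_equal)+
    then have "k (cis \<theta>) = c (cis \<theta>) / (w (T (cis \<theta>)) - w x)" by (intro kc) auto
    also have "c (cis \<theta>) = of_real (r * sin \<theta>) * of_real (r * sin \<theta>) * \<rho> (T (cis \<theta>)) * deriv w (T (cis \<theta>))"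
      unfolding c_def sq by (simp add: power2_eq_square)
    finally have kk: "k (cis \<theta>) = of_real (r * sin \<theta>) * of_real (r * sin \<theta>) * \<rho> (T (cis \<theta>)) * deriv w (T (cis \<theta>)) / (w (T (cis \<theta>)) - w x)" .
    show "complex_of_real (sqrt (((\<alpha> + \<beta>) / 2 + (\<beta> - \<alpha>) / 2 * cos \<theta> - \<alpha>) * (\<beta> - ((\<alpha> + \<beta>) / 2 + (\<beta> - \<alpha>) / 2 * cos \<theta>)))) *
         \<rho> (of_real ((\<alpha> + \<beta>) / 2 + (\<beta> - \<alpha>) / 2 * cos \<theta>)) *
         (deriv w (of_real ((\<alpha> + \<beta>) / 2 + (\<beta> - \<alpha>) / 2 * cos \<theta>)) /
          (w (of_real ((\<alpha> + \<beta>) / 2 + (\<beta> - \<alpha>) / 2 * cos \<theta>)) - w x)) *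
         complex_of_real ((\<beta> - \<alpha>) / 2 * sin \<theta>) = k (cis \<theta>)"
      unfolding kk real_sqrt_mult sqs[OF \<theta>] Tcis
      by (simp only: r_def mult_ac times_divide_eq_left times_divide_eq_right)
  qed
  have main: "((\<lambda>t. of_real (sqrt ((t-\<alpha>)*(\<beta>-t))) * \<rho> (of_real t) * (deriv w (of_real t) / (w (of_real t) - w x)))
          has_integral of_real pi * cut_sqrt \<alpha> \<beta> x * \<rho> x + H x) {\<alpha>..\<beta>}" if x: "x \<in> N" "x \<notin> S" for x
  proof -
    obtain \<zeta> where \<zeta>1: "1 \<le> norm \<zeta>" and \<zeta>: "norm \<zeta> < R'" "T \<zeta> = x" using N_T x by blast
    have xU: "x \<in> U" using x NU by auto
    have "norm \<zeta> \<noteq> 1" using joukowski_unit_circle[OF ab, of \<zeta>] x \<zeta> by (auto simp: T_def S_def)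
    with \<zeta>1 have \<zeta>1: "1 < norm \<zeta>" by simp
    then have \<zeta>0: "\<zeta> \<noteq> 0" by auto
    \<comment> \<open>The annulus |s| > 1/|\<zeta>| excludes 1/\<zeta>, the other preimage of
      x.\<close>
    define a where "a = 1 / norm \<zeta>"
    have a: "0 \<le> a" "a < 1" "1/R < a" using \<zeta>1 \<zeta> R' R \<zeta>0 by (auto simp: a_def field_simps)
    define A where "A = {s::complex. a < norm s \<and> norm s < R}"
    have A: "A \<subseteq> ?Ann" using a by (auto simp: A_def)
    have opA: "open A" unfolding A_def by (intro open_Collect_conj open_Collect_less continuous_intros)
    have \<zeta>A: "\<zeta> \<in> A" using \<zeta> \<zeta>1 a R' by (auto simp: A_def)
    have T\<zeta>: "T s = x \<longleftrightarrow> s = \<zeta>" if "s \<in> A" for s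
    proof -
      have "s \<noteq> 0" using that A Ann0 by blast
      moreover have "s \<noteq> inverse \<zeta>" using that by (auto simp: A_def a_def norm_inverse divide_inverse)
      ultimately show ?thesis using joukowski_eq_iff[OF ab _ \<zeta>0, of s] \<zeta>(2) by (auto simp: T_def)
    qed
    \<comment> \<open>The difference quotient of w o T at \<zeta>. It has no zero in the annulus, by
      injectivity away from \<zeta> and a nonzero derivative at it, so the integrand is
      \<open>\<kappa> s / (s - \<zeta>)\<close> with \<kappa> holomorphic.\<close>
    define D where "D = (\<lambda>s. if s = \<zeta> then deriv (\<lambda>s. w (T s)) \<zeta> else (w (T s) - w (T \<zeta>)) / (s - \<zeta>))"
    have D: "D holomorphic_on A"
      unfolding D_def by (rule pole_lemma_open[OF holomorphic_on_subset[OF wT A] opA])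
    have dT: "(T has_field_derivative of_real (r/2) * (1 - inverse \<zeta> ^ 2)) (at \<zeta>)"
      unfolding T_def joukowski_def[abs_def] using \<zeta>0
      by (auto intro!: derivative_eq_intros simp: r_def power2_eq_square)
    have "((\<lambda>s. w (T s)) has_field_derivative deriv w x * (of_real (r/2) * (1 - inverse \<zeta> ^ 2))) (at \<zeta>)"
      by (rule DERIV_chain2[OF _ dT])
         (use w(1) U(1) xU in \<open>simp add: \<zeta>(2) holomorphic_derivI\<close>)
    then have dwT: "deriv (\<lambda>s. w (T s)) \<zeta> = deriv w x * (of_real (r/2) * (1 - inverse \<zeta> ^ 2))"
      by (rule DERIV_imp_deriv)
    have dw0: "deriv w x \<noteq> 0" using holomorphic_injective_imp_regular[OF w(1) U(1) w(2) xU] .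
    have i\<zeta>: "inverse \<zeta> ^ 2 \<noteq> 1"
    proof
      assume "inverse \<zeta> ^ 2 = 1"
      then have "norm \<zeta> ^ 2 = 1" by (metis inverse_1 inverse_eq_iff_eq norm_one norm_power power_inverse)
      then show False using one_less_power[OF \<zeta>1, of 2] by simp
    qed
    have D0: "D s \<noteq> 0" if "s \<in> A" for s
    proof (cases "s = \<zeta>")
      case True
      have "deriv w x * (of_real (r/2) * (1 - inverse \<zeta> ^ 2)) \<noteq> 0" using dw0 i\<zeta> r by simp
      then show ?thesis unfolding dwT[symmetric] by (simp add: D_def True)
    next
      case False
      then show ?thesis using T\<zeta>[OF that] w_eq[of s x] that A xU \<zeta>(2) by (auto simp: D_def)
    qed
    define \<kappa> where "\<kappa> = (\<lambda>s. c s / (D s * s))"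
    have \<kappa>: "\<kappa> holomorphic_on A"
      unfolding \<kappa>_def using D0 A Ann0 by (intro holomorphic_intros holomorphic_on_subset[OF chol A] D) auto
    have eq\<kappa>: "c s / (w (T s) - w x) / s = \<kappa> s / (s - \<zeta>)" if "s \<in> A" "s \<noteq> \<zeta>" for s
      using that \<zeta>(2) by (simp add: \<kappa>_def D_def)
    have circ: "contour_integral (circlepath 0 \<rho>') (\<lambda>s. c s / (w (T s) - w x) / s) =
        contour_integral (circlepath 0 \<rho>') (\<lambda>s. \<kappa> s / (s - \<zeta>))" if "\<rho>' = 1 \<or> \<rho>' = R'" for \<rho>'
    proof (rule contour_integral_eq)
      fix s assume "s \<in> path_image (circlepath 0 \<rho>')"
      then have "norm s = \<rho>'" using that R' by auto
      then show "c s / (w (T s) - w x) / s = \<kappa> s / (s - \<zeta>)"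
        using that R' R a \<zeta> \<zeta>1 by (intro eq\<kappa>) (auto simp: A_def)
    qed
    have res: "contour_integral (circlepath 0 R') (\<lambda>s. \<kappa> s / (s - \<zeta>)) =
        contour_integral (circlepath 0 1) (\<lambda>s. \<kappa> s / (s - \<zeta>)) + 2 * of_real pi * \<i> * \<kappa> \<zeta>"
      by (rule contour_integral_annulus_residue[of _ a R]) (use \<kappa> a \<zeta> \<zeta>1 R' in \<open>auto simp: A_def\<close>)
    have cs: "cut_sqrt \<alpha> \<beta> x = of_real (r/2) * (\<zeta> - inverse \<zeta>)"
      using cut_sqrt_joukowski[OF ab \<zeta>1] \<zeta>(2) by (simp add: T_def r_def)
    have "\<kappa> \<zeta> = - cut_sqrt \<alpha> \<beta> x * \<rho> x"
    proof -
      have "\<zeta> - inverse \<zeta> = \<zeta> * (1 - inverse \<zeta> ^ 2)" using \<zeta>0 by (simp add: field_simps power2_eq_square)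
      then have "c \<zeta> = - (D \<zeta> * \<zeta>) * (of_real (r/2) * (\<zeta> - inverse \<zeta>)) * \<rho> x"
        by (simp add: c_def D_def dwT \<zeta>(2) power2_eq_square)
      then show ?thesis using D0[OF \<zeta>A] \<zeta>0 cs by (simp add: \<kappa>_def)
    qed
    then have *: "contour_integral (circlepath 0 R') (\<lambda>s. c s / (w (T s) - w x) / s) =
        contour_integral (circlepath 0 1) (\<lambda>s. c s / (w (T s) - w x) / s) - 2 * of_real pi * \<i> * (cut_sqrt \<alpha> \<beta> x * \<rho> x)"
      using res circ by simp
    have "((\<lambda>t. of_real (sqrt ((t-\<alpha>)*(\<beta>-t))) * \<rho> (of_real t) * (deriv w (of_real t) / (w (of_real t) - w x)))
          has_integral (1/(2*\<i>)) * contour_integral (circlepath 0 1) (\<lambda>s. c s / (w (T s) - w x) / s)) {\<alpha>..\<beta>}"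
    proof (rule semi)
      have sA: "sphere 0 1 \<subseteq> A" using a R by (auto simp: A_def)
      have ne: "w (T s) - w x \<noteq> 0" if "s \<in> sphere 0 1" for s
      proof -
        have "s \<in> A" "s \<noteq> \<zeta>" using that sA \<zeta>1 by auto
        then show ?thesis using T\<zeta> w_eq[OF subsetD[OF A] xU, of s] by simp
      qed
      show "continuous_on (sphere 0 1) (\<lambda>s. c s / (w (T s) - w x))"
        using ne sA A by (intro continuous_intros continuous_on_subset[OF holomorphic_on_imp_continuous_on[OF chol]]
              continuous_on_subset[OF holomorphic_on_imp_continuous_on[OF wT]]) blast+
      show "\<And>s. norm s = 1 \<Longrightarrow> c (inverse s) / (w (T (inverse s)) - w x) = c s / (w (T s) - w x)"
        by (simp only: c_sym T_def joukowski_inverse)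
    qed auto
    moreover have "(1/(2*\<i>)) * contour_integral (circlepath 0 1) (\<lambda>s. c s / (w (T s) - w x) / s) = of_real pi * cut_sqrt \<alpha> \<beta> x * \<rho> x + H x"
      unfolding H_def * by (simp add: field_simps)
    ultimately show ?thesis by simp
  qed
  have endpt: "((\<lambda>t. of_real (sqrt ((t-\<alpha>)*(\<beta>-t))) * \<rho> (of_real t) * (deriv w (of_real t) / (w (of_real t) - w (of_real \<alpha>))))
          has_integral of_real pi * cut_sqrt \<alpha> \<beta> (of_real \<alpha>) * \<rho> (of_real \<alpha>) + H (of_real \<alpha>)) {\<alpha>..\<beta>}"
  proof -
    have \<alpha>U: "of_real \<alpha> \<in> U" using S by (auto simp: S_def)
    define E where "E = (\<lambda>t. if t = of_real \<alpha> then deriv w (of_real \<alpha>) else (w t - w (of_real \<alpha>)) / (t - of_real \<alpha>))"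
    have E: "E holomorphic_on U" unfolding E_def by (rule pole_lemma_open[OF w(1) U(1)])
    have E0: "E t \<noteq> 0" if "t \<in> U" for t
      using holomorphic_injective_imp_regular[OF w(1) U(1) w(2) \<alpha>U] w(2) that \<alpha>U by (auto simp: E_def inj_on_def)
    \<comment> \<open>This is \<open>c s / (w (T s) - w \<alpha>)\<close> with the common factor (s
      + 1)^2 cancelled, hence regular at s = -1, which \<open>T\<close> maps to \<alpha>.\<close>
    define k where "k = (\<lambda>s. - (of_real (r/2) * ((s-1)^2 / s) * \<rho> (T s) * deriv w (T s) / E (T s)))"
    have kA: "k holomorphic_on ?Ann"
      unfolding k_def using Ann0 E0 T_U by (intro holomorphic_intros comp \<rho> dw E) auto
    have T\<alpha>: "T s - of_real \<alpha> = of_real (r/2) * ((s+1)^2 / s)" if "s \<noteq> 0" for s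
      using that by (simp add: T_def joukowski_def r_def field_simps power2_eq_square)
    have kc: "k s = c s / (w (T s) - w (of_real \<alpha>))" if "s \<in> ?Ann" "s \<noteq> -1" for s
    proof -
      have s0: "s \<noteq> 0" and s1: "s + 1 \<noteq> 0" using Ann0 that by (auto simp: add_eq_0_iff2)
      have Ta: "T s - of_real \<alpha> \<noteq> 0" using T\<alpha>[OF s0] s0 s1 r by simp
      then have wE: "w (T s) - w (of_real \<alpha>) = (T s - of_real \<alpha>) * E (T s)" by (simp add: E_def)
      have eq: "of_real (r^2/4) * (s - inverse s)^2 = (T s - of_real \<alpha>) * (of_real (r/2) * ((s-1)^2 / s))"
        unfolding T\<alpha>[OF s0] using s0 by (simp add: field_simps power2_eq_square)
      have aux: "- (Q * a * b / e) = - (P * Q * a * b) / (P * e)" if "P \<noteq> 0" for P Q a b e :: complex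
        using that by simp
      show ?thesis unfolding k_def c_def wE eq by (rule aux[OF Ta])
    qed
    have m1: "norm s = 1 \<Longrightarrow> s \<in> ?Ann" for s using sph by blast
    have "((\<lambda>t. of_real (sqrt ((t-\<alpha>)*(\<beta>-t))) * \<rho> (of_real t) * (deriv w (of_real t) / (w (of_real t) - w (of_real \<alpha>))))
          has_integral (1/(2*\<i>)) * contour_integral (circlepath 0 1) (\<lambda>s. k s / s)) {\<alpha>..\<beta>}"
    proof (rule semi)
      show "continuous_on (sphere 0 1) k"
        using kA m1 holomorphic_on_imp_continuous_on continuous_on_subset by (metis (no_types, lifting) mem_sphere_0 subsetI)
      show "k (inverse s) = k s" if "norm s = 1" for s
      proof -
        have "s \<noteq> 0" using that by auto
        then have "(inverse s - 1)^2 / inverse s = (s-1)^2 / s" by (simp add: field_simps power2_eq_square)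
        then show ?thesis unfolding k_def T_def joukowski_inverse by simp
      qed
    qed (use kc m1 in auto)
    also have "contour_integral (circlepath 0 1) (\<lambda>s. k s / s) = contour_integral (circlepath 0 R') (\<lambda>s. k s / s)"
    proof (rule contour_integral_circlepath_annulus_eq)
      show "(\<lambda>s. k s / s) holomorphic_on ?Ann" using Ann0 by (intro holomorphic_intros kA) auto
    qed (use R R' in auto)
    also have "\<dots> = contour_integral (circlepath 0 R') (\<lambda>s. c s / (w (T s) - w (of_real \<alpha>)) / s)"
    proof (rule contour_integral_eq)
      fix s assume "s \<in> path_image (circlepath 0 R')"
      then have "norm s = R'" using R' by auto
      then show "k s / s = c s / (w (T s) - w (of_real \<alpha>)) / s"
        using kc sph R' by (metis norm_minus_cancel norm_one less_irrefl)
    qed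
    finally have "((\<lambda>t. of_real (sqrt ((t-\<alpha>)*(\<beta>-t))) * \<rho> (of_real t) * (deriv w (of_real t) / (w (of_real t) - w (of_real \<alpha>))))
          has_integral H (of_real \<alpha>)) {\<alpha>..\<beta>}" by (simp add: H_def)
    moreover have "cut_sqrt \<alpha> \<beta> (of_real \<alpha>) = 0"
    proof -
      have "of_real \<alpha> - complex_of_real ((\<alpha>+\<beta>)/2) = - of_real r" by (simp add: r_def field_simps)
      then show ?thesis unfolding cut_sqrt_def r_def[symmetric] using r by simp
    qed
    ultimately show ?thesis by simp
  qed
  have Hhol: "H holomorphic_on N"
  proof -
    define W where "W = (\<lambda>\<theta>. w (T (of_real R' * cis \<theta>)))"
    define C where "C = (\<lambda>\<theta>. c (of_real R' * cis \<theta>) * \<i>)"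
    have sAnn: "of_real R' * cis \<theta> \<in> ?Ann" for \<theta> using sph[of "of_real R' * cis \<theta>"] R' by (simp add: norm_mult)
    have cW: "continuous_on {0..2*pi} W" and cC: "continuous_on {0..2*pi} C"
      unfolding W_def C_def using sAnn
      by (intro continuous_intros continuous_on_compose2[OF holomorphic_on_imp_continuous_on[OF wT]]
           continuous_on_compose2[OF holomorphic_on_imp_continuous_on[OF chol]]; blast)+
    have Heq: "H x = (1/(2*\<i>)) * integral {0..2*pi} (\<lambda>\<theta>. C \<theta> / (W \<theta> - w x))" for x
    proof -
      have "contour_integral (circlepath 0 R') (\<lambda>s. c s / (w (T s) - w x) / s) =
        integral {0..2*pi} (\<lambda>\<theta>. C \<theta> / (W \<theta> - w x))"
        using R' by (simp add: circlepath_def contour_integral_part_circlepath_eq C_def W_def)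
      then show ?thesis by (simp add: H_def)
    qed
    have "(\<lambda>x. integral {0..2*pi} (\<lambda>\<theta>. C \<theta> / (W \<theta> - w x))) holomorphic_on N"
    proof (rule holomorphic_on_compose_gen[OF holomorphic_on_subset[OF w(1) NU] Cauchy_type_integral_holomorphic[OF cC cW], unfolded o_def])
      \<comment> \<open>The circle of radius R' is mapped to the boundary ellipse, outside N;
        injectivity of w on U keeps the values apart.\<close>
      show "w ` N \<subseteq> - (W ` {0..2*pi})"
      proof safe
        fix x \<theta> assume x: "x \<in> N" and "w x = W \<theta>"
        then have "T (of_real R' * cis \<theta>) = x" using w_eq[OF sAnn, of x \<theta>] NU by (auto simp: W_def)
        then show False using T_N[of "of_real R' * cis \<theta>"] x R' by (simp add: norm_mult)
      qed
    qed
    then show ?thesis unfolding Heq[abs_def] by (intro holomorphic_intros) auto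
  qed
  show ?thesis
    using that[of N H] openN SN NU Hhol main endpt by (auto simp: S_def)
qed

section \<open>Uniqueness on the glued domain\<close>

lemma holomorphic_on_imp_isCont:
  assumes "f holomorphic_on A" "open A" "x \<in> A"
  shows "isCont f x"
  using assms continuous_on_eq_continuous_at holomorphic_on_imp_continuous_on by blast

text \<open>One constant for all v serves twice below: the integral tends to 0 where w has its pole,
  and it stays bounded far out in an unbounded domain.\<close>

lemma Cauchy_type_integral_bound:
  fixes c W :: "real \<Rightarrow> complex"
  assumes ab: "a \<le> b" and c: "continuous_on {a..b} c" and W: "continuous_on {a..b} W"
  obtains K where "K \<ge> 0" "\<And>v e. 0 < e \<Longrightarrow> (\<And>t. t \<in> {a..b} \<Longrightarrow> e \<le> norm (W t - v)) \<Longrightarrow>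
     norm (integral {a..b} (\<lambda>t. c t / (W t - v))) \<le> K / e"
proof -
  have "bounded (c ` {a..b})" using c compact_continuous_image compact_imp_bounded by blast
  then obtain K0 where K0: "K0 > 0" "\<And>t. t \<in> {a..b} \<Longrightarrow> norm (c t) \<le> K0"
    by (auto simp: bounded_pos)
  show ?thesis
  proof (rule that[of "K0 * (b - a)"])
    show "K0 * (b - a) \<ge> 0" using K0 ab by auto
  next
    fix v e assume e: "0 < (e::real)" "\<And>t. t \<in> {a..b} \<Longrightarrow> e \<le> norm (W t - v)"
    have ne: "W t - v \<noteq> 0" if "t \<in> {a..b}" for t using e(2)[OF that] e(1) by auto
    have "norm (integral {a..b} (\<lambda>t. c t / (W t - v))) \<le> (K0 / e) * (b - a)"
    proof (rule integral_bound[OF ab])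
      show "continuous_on {a..b} (\<lambda>t. c t / (W t - v))"
        using ne c W by (intro continuous_intros) auto
      fix t assume t: "t \<in> {a..b}"
      show "norm (c t / (W t - v)) \<le> K0 / e"
        unfolding norm_divide using K0 e t by (intro frac_le) auto
    qed
    then show "norm (integral {a..b} (\<lambda>t. c t / (W t - v))) \<le> K0 * (b - a) / e" by simp
  qed
qed

text \<open>Otherwise the image of a small disc around a, open by the open mapping theorem, would be
  a neighbourhood of g(t). Points of A close to t lie outside that disc but would share a value with
  one of its points.\<close>

lemma injective_holomorphic_boundary_value:
  fixes g :: "complex \<Rightarrow> complex"
  assumes A: "open A" "g holomorphic_on A" "inj_on g A" and a: "a \<in> A"
    and t: "t \<notin> A" "t \<in> closure A" "isCont g t"
  shows "g t \<noteq> g a"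
proof
  assume eq: "g t = g a"
  have ta: "dist a t > 0" using a t by auto
  obtain e0 where e0: "e0 > 0" "ball a e0 \<subseteq> A" using A a openE by blast
  define e where "e = min e0 (dist a t / 2)"
  have e: "e > 0" "ball a e \<subseteq> A" "e < dist a t" using e0 ta by (auto simp: e_def min_def)
  have "open (g ` ball a e)"
    using A e by (intro open_mapping_thm3) (auto intro: holomorphic_on_subset inj_on_subset)
  moreover have "g t \<in> g ` ball a e" using eq e by auto
  ultimately have "\<forall>\<^sub>F x in nhds t. g x \<in> g ` ball a e"
    using t(3) topological_tendstoD unfolding isCont_def tendsto_at_iff_tendsto_nhds by blast
  then obtain \<delta> where \<delta>: "\<delta> > 0" "\<And>x. dist x t < \<delta> \<Longrightarrow> g x \<in> g ` ball a e"
    by (auto simp: eventually_nhds_metric)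
  obtain x where x: "x \<in> A" "dist x t < min \<delta> (dist a t - e)"
    using t(2) \<delta>(1) e(3) unfolding closure_approachable by (metis min_less_iff_conj diff_gt_0_iff_gt)
  have "x \<notin> ball a e" using x dist_triangle[of a t x] by auto
  moreover obtain b where "b \<in> ball a e" "g x = g b" using \<delta>(2) x by force
  ultimately show False using A(3) e(2) x(1) by (metis inj_onD subsetD)
qed

lemma holomorphic_folded_imp_constant:
  assumes D: "open D" "connected D" and h: "h holomorphic_on D"
    and C: "C \<noteq> {}" "closure C \<subseteq> D"
    and fold: "\<And>x. x \<in> D - closure C \<Longrightarrow> \<exists>x'\<in>C. h x' = h x"
    and inf: "bounded C \<or> bounded (-D) \<and> (\<exists>K R. \<forall>x\<in>C. norm x > R \<longrightarrow> norm (h x) \<le> K)"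
  shows "h constant_on D"
proof -
  have attained: "h constant_on D" if "x \<in> D" "\<And>y. y \<in> D \<Longrightarrow> norm (h y) \<le> norm (h x)" for x
    using maximum_modulus_principle[OF h D D(1) order_refl that(1)] that(2) by blast
  have folded: "\<exists>x'\<in>closure C. h x' = h x" if "x \<in> D" for x
    using fold[of x] that closure_subset[of C] by (cases "x \<in> closure C") auto
  have hc: "continuous_on D h" using h holomorphic_on_imp_continuous_on by blast
  have nc: "continuous_on A (\<lambda>x. norm (h x))" if "A \<subseteq> D" for A
    using continuous_on_subset[OF hc that] by (intro continuous_intros)
  show ?thesis
  proof (cases "bounded C")
    case True
    then have "compact (closure C)" by simp
    then obtain x where x: "x \<in> closure C" "\<And>y. y \<in> closure C \<Longrightarrow> norm (h y) \<le> norm (h x)"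
      using continuous_attains_sup[OF _ _ nc[OF C(2)]] C(1) by auto
    show ?thesis
    proof (rule attained[of x])
      fix y assume "y \<in> D"
      then show "norm (h y) \<le> norm (h x)" using folded[of y] x(2) by force
    qed (use x C in auto)
  next
    case False
    then obtain K R where bD: "bounded (-D)" and KR: "\<And>x. x \<in> C \<Longrightarrow> norm x > R \<Longrightarrow> norm (h x) \<le> K"
      using inf by blast
    have comp: "compact (closure C \<inter> cball 0 r)" for r by (intro closed_Int_compact) auto
    have "bounded (h ` (closure C \<inter> cball 0 R))"
      by (intro compact_imp_bounded compact_continuous_image comp continuous_on_subset[OF hc]) (use C in auto)
    then obtain K1 where K1: "\<And>x. x \<in> closure C \<Longrightarrow> norm x \<le> R \<Longrightarrow> norm (h x) \<le> K1"
      unfolding bounded_iff by fastforce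
    define M where "M = max K K1"
    have "norm (h x) \<le> M" if "x \<in> C" for x
      using K1[of x] KR[OF that] that closure_subset[of C] by (cases "norm x \<le> R") (auto simp: M_def)
    then have "norm (h x) \<le> M" if "x \<in> closure C" for x
      using continuous_le_on_closure[OF nc[OF C(2)] that, of M] by blast
    then have M: "norm (h x) \<le> M" if "x \<in> D" for x using folded[OF that] by metis
    obtain b where b: "b > 0" "\<And>x. x \<in> -D \<Longrightarrow> norm x \<le> b" using bD by (auto simp: bounded_pos)
    have inD: "inverse \<xi> \<in> D" if "\<xi> \<in> ball 0 (1/b) - {0}" for \<xi>
    proof (rule ccontr)
      assume "inverse \<xi> \<notin> D"
      then have "norm (inverse \<xi>) \<le> b" using b by auto
      then have "inverse (norm \<xi>) \<le> b" by (simp add: norm_inverse)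
      then show False using that b(1) by (auto simp: field_simps)
    qed
    have "(h \<circ> inverse) holomorphic_on (ball 0 (1/b) - {0})"
      by (rule holomorphic_on_compose_gen[OF _ h]) (use inD in \<open>auto intro!: holomorphic_intros simp del: mem_ball_0 simp: image_subset_iff\<close>)
    \<comment> \<open>A bounded function has a removable singularity at infinity; g 0 is the value
      of h there.\<close>
    then have "\<exists>g. g holomorphic_on ball 0 (1/b) \<and> (\<forall>z\<in>ball 0 (1/b) - {0}. g z = (h \<circ> inverse) z)"
    proof (rule holomorphic_on_extend_bounded[THEN iffD2])
      have "eventually (\<lambda>z. z \<in> ball 0 (1/b) - {0}) (at (0::complex))"
        using b(1) by (intro eventually_at_in_open) auto
      then have "eventually (\<lambda>z. norm ((h \<circ> inverse) z) \<le> M) (at 0)"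
        by eventually_elim (use inD M in auto)
      then show "\<exists>B. eventually (\<lambda>z. norm ((h \<circ> inverse) z) \<le> B) (at 0)" by blast
    qed (use b in auto)
    then obtain g where g: "g holomorphic_on ball 0 (1/b)" "\<And>z. z \<in> ball 0 (1/b) - {0} \<Longrightarrow> g z = h (inverse z)" by auto
    have h_g: "h x = g (inverse x)" and xi: "inverse x \<in> ball 0 (1/b)" "inverse x \<noteq> 0" if "norm x > b" for x
    proof -
      have "x \<noteq> 0" using that b(1) by auto
      moreover have "inverse (norm x) < 1/b" using that b by (simp add: inverse_eq_divide frac_less2)
      ultimately show "inverse x \<in> ball 0 (1/b)" "inverse x \<noteq> 0" by (auto simp: norm_inverse)
      then show "h x = g (inverse x)" using g(2)[of "inverse x"] by auto
    qed
    have gc: "isCont (\<lambda>z. norm (g z)) 0"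
      using b(1) by (intro continuous_intros holomorphic_on_imp_isCont[OF g(1)]) auto
    show ?thesis
    proof (cases "\<forall>x\<in>D. norm (h x) \<le> norm (g 0)")
      case True
      \<comment> \<open>Here the maximum is attained at infinity. The maximum principle for g makes
        h equal to g 0 near infinity, so that the maximum is also attained at a point of D.\<close>
      have "g constant_on ball 0 (1/b)"
      proof (rule maximum_modulus_principle[OF g(1) _ _ _ order_refl, of 0])
        fix z assume z: "z \<in> ball (0::complex) (1/b)"
        then show "norm (g z) \<le> norm (g 0)"
          using True inD[of z] g(2)[of z] by (cases "z = 0") auto
      qed (use b in auto)
      then have "g (inverse (of_real (b+1))) = g 0"
        using xi(1)[of "of_real (b+1)"] b(1) unfolding constant_on_def by (force simp del: of_real_add)
      then have "h (of_real (b+1)) = g 0" using h_g[of "of_real (b+1)"] b(1) by (force simp del: of_real_add)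
      moreover have "of_real (b+1) \<in> D"
        using b(2)[of "of_real (b+1)"] b(1) by (force simp del: of_real_add)
      ultimately show ?thesis using attained[of "of_real (b+1)"] True by auto
    next
      case False
      then obtain x1 where x1: "x1 \<in> D" "norm (g 0) < norm (h x1)" by force
      \<comment> \<open>A level strictly between |h| at infinity and some larger value of |h|.
        Points where |h| reaches it stay bounded, so the maximum is sought on a compact part of the
        closure of C.\<close>
      define M' where "M' = (norm (g 0) + norm (h x1)) / 2"
      have M': "norm (g 0) < M'" "M' < norm (h x1)" using x1 by (auto simp: M'_def)
      have "eventually (\<lambda>z. norm (g z) < M') (at 0)"
        using gc M'(1) by (auto simp: isCont_def intro: order_tendstoD)
      then obtain d where d: "d > 0" "\<And>z. z \<noteq> 0 \<Longrightarrow> norm z < d \<Longrightarrow> norm (g z) < M'"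
        unfolding eventually_at by (auto simp: dist_norm)
      define r where "r = max b (1/d)"
      have far: "norm (h x) < M'" if "norm x > r" for x
      proof -
        have x: "norm x > b" "norm x > 1/d" using that by (auto simp: r_def)
        have "x \<noteq> 0" using x b by auto
        then have "norm (inverse x) < d" unfolding norm_inverse using x d by (simp add: field_simps)
        then show ?thesis using h_g[OF x(1)] xi(2)[OF x(1)] d(2) by simp
      qed
      define E where "E = closure C \<inter> cball 0 r"
      have inE: "\<exists>x'\<in>E. h x' = h x" if x: "x \<in> D" "norm (h x) \<ge> M'" for x
      proof -
        obtain x' where "x' \<in> closure C" "h x' = h x" using folded[OF x(1)] by blast
        moreover have "\<not> norm x' > r" using far[of x'] x(2) calculation by auto
        ultimately show ?thesis by (auto simp: E_def)
      qed
      have "E \<noteq> {}" using inE[OF x1(1)] M' by auto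
      moreover have ED: "E \<subseteq> D" using C by (auto simp: E_def)
      ultimately obtain x where x: "x \<in> E" "\<And>y. y \<in> E \<Longrightarrow> norm (h y) \<le> norm (h x)"
        using continuous_attains_sup[OF _ _ nc[of E]] comp unfolding E_def by blast
      have xM: "norm (h x) \<ge> M'" using inE[OF x1(1)] M' x(2) by force
      show ?thesis
      proof (rule attained[of x])
        fix y assume "y \<in> D"
        then show "norm (h y) \<le> norm (h x)"
          using inE[of y] x(2) xM by (cases "norm (h y) \<ge> M'") force+
      qed (use x ED in auto)
    qed
  qed
qed

text \<open>The case of a gluing function that is holomorphic on D but for one pole p off the slit.
  The integral depends on x through w(x) only, so any partner point sharing the values of f and w
  also shares the value of h. When the base point is \<alpha> itself, f has no value of its own
  there and the regular part B supplies it.\<close>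

theorem gluing_one_pole:
  fixes f w B \<rho> :: "complex \<Rightarrow> complex"
  defines "S \<equiv> \<lambda>\<alpha> \<beta>. closed_segment (complex_of_real \<alpha>) (complex_of_real \<beta>)"
  assumes D: "open D" "connected D" and ab: "\<alpha> < \<beta>"
    and C: "open C" "S \<alpha> \<beta> \<subseteq> C" "closure C \<subseteq> D"
    and f: "f holomorphic_on D - S \<alpha> \<beta>"
    and U: "open U" "S \<alpha> \<beta> \<subseteq> U" "B holomorphic_on U" "\<rho> holomorphic_on U"
      "\<And>x. x \<in> U - S \<alpha> \<beta> \<Longrightarrow> f x = B x + cut_sqrt \<alpha> \<beta> x * \<rho> x"
    and w: "w holomorphic_on D - {p}" "p \<in> C - S \<alpha> \<beta>" "is_pole w p" "inj_on w (C - {p})"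
    and fold: "\<And>x. x \<in> D - closure C \<Longrightarrow> \<exists>x'\<in>C - S \<alpha> \<beta> - {p}. f x' = f x \<and> w x' = w x"
    and inf: "bounded C \<or> bounded (-D) \<and> (\<exists>K R. \<forall>x\<in>C. norm x > R \<longrightarrow> norm (f x) \<le> K)"
    and x0: "x0 \<in> C - S \<alpha> \<beta> \<union> {of_real \<alpha>}" "x0 \<noteq> p"
    and x: "x \<in> D - S \<alpha> \<beta>"
  shows "f x - (if x0 \<in> S \<alpha> \<beta> then B x0 else f x0) = of_real (1/pi) *
     integral {\<alpha>..\<beta>} (\<lambda>t. of_real (sqrt ((t-\<alpha>)*(\<beta>-t))) * \<rho> (of_real t) * (kern w x (of_real t) - kern w x0 (of_real t)))"
proof -
  define S' where "S' = closed_segment (complex_of_real \<alpha>) (complex_of_real \<beta>)"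
  have CD: "C \<subseteq> D" using C closure_subset by blast
  have closedS: "closed S'" "compact S'" by (auto simp: S'_def)
  have oS: "of_real t \<in> S' \<longleftrightarrow> t \<in> {\<alpha>..\<beta>}" for t
    using ab by (simp add: S'_def closed_segment_of_real closed_segment_eq_real_ivl inj_image_mem_iff[OF inj_of_real])
  have S'_alt: "S' = of_real ` {\<alpha>..\<beta>}"
    using ab by (simp add: S'_def closed_segment_of_real closed_segment_eq_real_ivl)
  note [simp] = S_def S'_def[symmetric]
  define U' where "U' = U \<inter> (C - {p})"
  have U': "open U'" "S' \<subseteq> U'" "U' \<subseteq> D - {p}" using U C w CD by (auto simp: U'_def open_delete)
  define \<phi> where "\<phi> = (\<lambda>v t. of_real (sqrt ((t-\<alpha>)*(\<beta>-t))) * \<rho> (of_real t) * (deriv w (of_real t) / (w (of_real t) - v)))"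
  obtain N H where N: "open N" "S' \<subseteq> N" "N \<subseteq> U'" "H holomorphic_on N"
    "\<And>x. x \<in> N - S' \<union> {of_real \<alpha>} \<Longrightarrow> (\<phi> (w x) has_integral of_real pi * cut_sqrt \<alpha> \<beta> x * \<rho> x + H x) {\<alpha>..\<beta>}"
  proof (rule cauchy_integral_across_slit[OF ab U'(1), of w \<rho>])
    show "w holomorphic_on U'" using w(1) U'(3) holomorphic_on_subset by blast
    show "inj_on w U'" by (rule inj_on_subset[OF w(4)]) (auto simp: U'_def)
    show "\<rho> holomorphic_on U'" by (rule holomorphic_on_subset[OF U(4)]) (auto simp: U'_def)
  qed (use U'(2) that in \<open>auto simp: \<phi>_def\<close>)
  define c where "c = (\<lambda>t. of_real (sqrt ((t-\<alpha>)*(\<beta>-t))) * \<rho> (of_real t) * deriv w (of_real t))"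
  define W where "W = (\<lambda>t. w (complex_of_real t))"
  define A where "A = (\<lambda>v. integral {\<alpha>..\<beta>} (\<phi> v))"
  have wU: "w holomorphic_on U'" using w(1) U'(3) holomorphic_on_subset by blast
  have dwU: "deriv w holomorphic_on U'" by (rule holomorphic_deriv[OF wU U'(1)])
  have \<rho>U: "\<rho> holomorphic_on U'" using U by (auto simp: U'_def intro: holomorphic_on_subset)
  have cont: "continuous_on {\<alpha>..\<beta>} (\<lambda>t. g (complex_of_real t))" if "g holomorphic_on U'" for g
    using U'(2) oS by (intro continuous_on_compose2[OF holomorphic_on_imp_continuous_on[OF that]] continuous_intros) auto
  have cW: "continuous_on {\<alpha>..\<beta>} W" and cc: "continuous_on {\<alpha>..\<beta>} c"
    unfolding W_def c_def by (intro continuous_intros cont wU dwU \<rho>U)+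
  have \<phi>c: "\<phi> v = (\<lambda>t. c t / (W t - v))" for v by (simp add: \<phi>_def c_def W_def)
  have WS: "W ` {\<alpha>..\<beta>} = w ` S'" by (auto simp: W_def S'_alt)
  have Ahol: "A holomorphic_on - (w ` S')"
    using Cauchy_type_integral_holomorphic[OF cc cW] by (simp add: A_def \<phi>c WS)
  obtain K where K: "K \<ge> 0" "\<And>v e. 0 < e \<Longrightarrow> (\<And>s. s \<in> S' \<Longrightarrow> e \<le> norm (w s - v)) \<Longrightarrow> norm (A v) \<le> K / e"
  proof -
    obtain K where "K \<ge> 0" "\<And>v e. 0 < e \<Longrightarrow> (\<And>t. t \<in> {\<alpha>..\<beta>} \<Longrightarrow> e \<le> norm (W t - v)) \<Longrightarrow>
     norm (integral {\<alpha>..\<beta>} (\<lambda>t. c t / (W t - v))) \<le> K / e"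
      using Cauchy_type_integral_bound[OF less_imp_le[OF ab] cc cW] by blast
    moreover from this(2) have "norm (A v) \<le> K / e" if "0 < e" "\<And>s. s \<in> S' \<Longrightarrow> e \<le> norm (w s - v)" for v e
      unfolding A_def \<phi>c using that oS by (simp add: W_def)
    ultimately show ?thesis using that by blast
  qed
  have avoid: "w y \<notin> w ` S'" if y: "y \<in> D - S' - {p}" for y
  proof -
    consider "y \<in> C" | "y \<in> closure C" "y \<notin> C" | "y \<notin> closure C" by blast
    then show ?thesis
    proof cases
      case 1
      then show ?thesis using w(2,4) C(2) y by (auto simp: inj_on_def)
    next
      case 2
      have cl: "y \<in> closure (C - {p})"
        unfolding closure_approachable
      proof safe
        fix e :: real assume "e > 0"
        then have "min e (dist y p) > 0" using y by auto
        then obtain z where "z \<in> C" "dist z y < min e (dist y p)"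
          using 2 unfolding closure_approachable by blast
        then show "\<exists>z\<in>C - {p}. dist z y < e" by (auto simp: dist_commute)
      qed
      have "isCont w y"
        by (rule holomorphic_on_imp_isCont[OF w(1)]) (use y D(1) in auto)
      then have "w y \<noteq> w s" if "s \<in> S'" for s
        using 2 cl that C w CD
        by (intro injective_holomorphic_boundary_value[of "C - {p}"]) (auto intro: holomorphic_on_subset)
      then show ?thesis by auto
    next
      case 3
      then obtain x' where x': "x' \<in> C - S' - {p}" "w x' = w y" using fold[of y] y by auto
      have "w x' \<noteq> w s" if "s \<in> S'" for s
      proof -
        have "s \<in> C - {p}" "x' \<noteq> s" using that x' w(2) C(2) by auto
        then show ?thesis using inj_onD[OF w(4)] x' by blast
      qed
      then show ?thesis using x' by auto
    qed
  qed
  \<comment> \<open>The values on the slit are those dictated by the expansion near it, in which the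
    \<open>cut_sqrt\<close> terms of f and of the integral cancel; the value at p reflects that the
    integral vanishes as w tends to infinity.\<close>
  define h where "h = (\<lambda>x. if x \<in> S' then B x - H x / of_real pi else if x = p then f x else f x - A (w x) / of_real pi)"
  have Ap: "((\<lambda>x. A (w x)) \<longlongrightarrow> 0) (at p)"
  proof -
    have "bounded (w ` S')" using cW WS compact_continuous_image compact_imp_bounded compact_Icc by metis
    then obtain m where m: "m > 0" "\<And>s. s \<in> S' \<Longrightarrow> norm (w s) \<le> m" by (auto simp: bounded_pos)
    have lim: "filterlim (\<lambda>x. norm (w x)) at_top (at p)"
      using w(3) unfolding is_pole_def filterlim_at_infinity_conv_norm_at_top .
    have "((\<lambda>x. K / (norm (w x) - m)) \<longlongrightarrow> 0) (at p)"
      by (rule real_tendsto_divide_at_top[OF tendsto_const])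
         (use filterlim_tendsto_add_at_top[OF tendsto_const[of "-m"] lim] in simp)
    moreover have "eventually (\<lambda>x. norm (A (w x)) \<le> K / (norm (w x) - m)) (at p)"
    proof -
      have "eventually (\<lambda>x. norm (w x) > m) (at p)" using lim by (simp add: filterlim_at_top_dense)
      then show ?thesis
      proof eventually_elim
        case (elim x)
        show ?case
        proof (rule K(2))
          fix s assume "s \<in> S'"
          then show "norm (w x) - m \<le> norm (w s - w x)"
            using m(2)[of s] norm_triangle_ineq2[of "w x" "w s"] by (simp add: norm_minus_commute)
        qed (use elim in auto)
      qed
    qed
    ultimately show ?thesis by (rule Lim_null_comparison[rotated])
  qed
  have opDS: "open (D - S')" "open (D - S' - {p})" using D closedS by auto
  have h1: "h holomorphic_on D - S' - {p}"
  proof -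
    have "(\<lambda>x. A (w x)) holomorphic_on D - S' - {p}"
      using holomorphic_on_compose_gen[OF holomorphic_on_subset[OF w(1)] Ahol, of "D - S' - {p}"] avoid by (auto simp: o_def image_subset_iff)
    then have "(\<lambda>x. f x - A (w x) / of_real pi) holomorphic_on D - S' - {p}"
      using f by (intro holomorphic_intros) (auto intro: holomorphic_on_subset)
    then show ?thesis by (rule holomorphic_transform) (auto simp: h_def)
  qed
  have p: "p \<in> D - S'" using w(2) CD by auto
  have fc: "continuous_on (D - S') f" using f holomorphic_on_imp_continuous_on by auto
  have h2: "h holomorphic_on D - S'"
  proof (rule no_isolated_singularity[where K="{p}"])
    have "isCont h y" if y: "y \<in> D - S'" for y
    proof (cases "y = p")
      case False
      then show ?thesis using y by (intro holomorphic_on_imp_isCont[OF h1 opDS(2)]) auto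
    next
      case True
      have "isCont f p" using fc p opDS(1) by (simp add: continuous_on_eq_continuous_at)
      then have "((\<lambda>x. f x - A (w x) / of_real pi) \<longlongrightarrow> f p - 0 / of_real pi) (at p)"
        using Ap by (intro tendsto_intros) (auto simp: isCont_def)
      moreover have "eventually (\<lambda>x. f x - A (w x) / of_real pi = h x) (at p)"
      proof -
        have "eventually (\<lambda>x. x \<in> D - S' - {p}) (at p)" using p opDS by (intro eventually_at_in_open) auto
        then show ?thesis by eventually_elim (auto simp: h_def)
      qed
      ultimately have "(h \<longlongrightarrow> f p) (at p)" using Lim_transform_eventually by fastforce
      moreover have "h p = f p" using p by (simp add: h_def)
      ultimately show ?thesis using True by (simp add: isCont_def)
    qed
    then show "continuous_on (D - S') h" by (simp add: continuous_at_imp_continuous_on)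
  qed (use h1 opDS in auto)
  have h3: "h holomorphic_on N"
  proof -
    have "(\<lambda>x. B x - H x / of_real pi) holomorphic_on N"
      using N U by (intro holomorphic_intros) (auto simp: U'_def intro: holomorphic_on_subset)
    then show ?thesis
    proof (rule holomorphic_transform)
      fix x assume xN: "x \<in> N"
      show "B x - H x / of_real pi = h x"
      proof (cases "x \<in> S'")
        case False
        then have "A (w x) = of_real pi * cut_sqrt \<alpha> \<beta> x * \<rho> x + H x"
          unfolding A_def using N(5)[of x] xN by (simp add: integral_unique)
        moreover have "f x = B x + cut_sqrt \<alpha> \<beta> x * \<rho> x" "x \<noteq> p"
          using U(5)[of x] N(3) U'(3) xN False by (auto simp: U'_def)
        ultimately show ?thesis using False by (simp add: h_def field_simps)
      qed (simp add: h_def)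
    qed
  qed
  have hD: "h holomorphic_on D"
  proof -
    have "h holomorphic_on (D - S') \<union> N" using h2 h3 opDS N(1) by (intro holomorphic_on_Un) auto
    moreover have "(D - S') \<union> N = D" using N U' by auto
    ultimately show ?thesis by simp
  qed
  have "h constant_on D"
  proof (rule holomorphic_folded_imp_constant[OF D hD _ C(3)])
    show "C \<noteq> {}" using w(2) by auto
    fix y assume y: "y \<in> D - closure C"
    then obtain x' where "x' \<in> C - S' - {p}" "f x' = f y" "w x' = w y" using fold[of y] by auto
    moreover have "y \<notin> S'" "y \<noteq> p" using y C(2) w(2) closure_subset[of C] by auto
    ultimately have "h x' = h y" "x' \<in> C" by (auto simp: h_def)
    then show "\<exists>x'\<in>C. h x' = h y" by blast
  next
    show "bounded C \<or> bounded (-D) \<and> (\<exists>K R. \<forall>x\<in>C. norm x > R \<longrightarrow> norm (h x) \<le> K)"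
    proof (cases "bounded C")
      case False
      then obtain Kf R where bD: "bounded (-D)" and Kf: "\<And>x. x \<in> C \<Longrightarrow> norm x > R \<Longrightarrow> norm (f x) \<le> Kf"
        using inf by blast
      have cw: "compact (w ` S')" using cW WS compact_continuous_image by (metis compact_Icc)
      obtain RN where RN: "\<And>s. s \<in> S' \<Longrightarrow> norm s \<le> RN" using closedS(2) compact_imp_bounded bounded_iff by metis
      \<comment> \<open>A bounded neighbourhood of the slit. Points of C far out lie outside it, so
        by injectivity their w-values lie outside the open set \<open>w\<close>
        N'\<open>, at a fixed distance from\<close>w \<open>S'\<close>.\<close>
      define N' where "N' = N \<inter> ball 0 (RN + 1)"
      have N': "open N'" "S' \<subseteq> N'" using N RN by (force simp: N'_def)+
      have opw': "open (w ` N')"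
      proof (rule open_mapping_thm3[OF _ N'(1)])
        have "N' \<subseteq> U'" using N(3) by (auto simp: N'_def)
        then show "w holomorphic_on N'" "inj_on w N'"
          using wU inj_on_subset[OF w(4), of N'] by (auto simp: U'_def intro: holomorphic_on_subset)
      qed
      obtain e where e: "e > 0" "(\<Union>v\<in>w ` S'. ball v e) \<subseteq> w ` N'"
        using compact_subset_open_imp_ball_epsilon_subset[OF cw opw'] N'(2) by (metis image_mono)
      define R' where "R' = max R (max (RN + 1) (norm p))"
      have "norm (h y) \<le> Kf + K / e / pi" if y: "y \<in> C" "norm y > R'" for y
      proof -
        have yn: "y \<notin> N'" "y \<noteq> p" "y \<notin> S'" using y N' by (auto simp: R'_def N'_def)
        have "N' \<subseteq> C - {p}" using N(3) by (auto simp: N'_def U'_def)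
        then have "w y \<notin> w ` N'" using w(4) yn y by (auto simp: inj_on_def)
        then have "norm (A (w y)) \<le> K / e"
          using e by (intro K(2)) (force simp: dist_norm not_less[symmetric])+
        then have "norm (A (w y) / of_real pi) \<le> K / e / pi" using divide_right_mono[of "norm (A (w y))" "K / e" pi] by (simp add: norm_divide del: divide_divide_eq_left)
        moreover have "norm (f y) \<le> Kf" using Kf y by (auto simp: R'_def)
        ultimately show ?thesis using yn norm_triangle_ineq4[of "f y" "A (w y) / of_real pi"] by (simp add: h_def)
      qed
      then show ?thesis using bD by blast
    qed auto
  qed
  moreover have \<alpha>S: "of_real \<alpha> \<in> S'" using oS ab by simp
  moreover have x0D: "x0 \<in> D" using x0 \<alpha>S C CD by auto
  ultimately have hx: "h x = h x0" using x by (auto simp: constant_on_def)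
  have cs0: "cut_sqrt \<alpha> \<beta> (of_real \<alpha>) = 0"
  proof -
    have "of_real \<alpha> - complex_of_real ((\<alpha>+\<beta>)/2) = - of_real ((\<beta>-\<alpha>)/2)" by (simp add: field_simps)
    then show ?thesis unfolding cut_sqrt_def using ab by simp
  qed
  have A0: "(\<phi> (w x0) has_integral A (w x0)) {\<alpha>..\<beta>}" and
    h0: "h x0 = (if x0 \<in> S' then B x0 else f x0) - A (w x0) / of_real pi"
  proof -
    have intg: "(\<phi> (w x0) has_integral A (w x0)) {\<alpha>..\<beta>}" if "x0 \<notin> S'"
      unfolding A_def using avoid[of x0] that x0D x0(2) cW cc
      by (intro integrable_integral, unfold \<phi>c, intro integrable_continuous_real continuous_intros) (force simp: WS[symmetric])+
    have x0\<alpha>: "x0 = of_real \<alpha>" if "x0 \<in> S'" using x0 that by auto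
    have i2: "(\<phi> (w (of_real \<alpha>)) has_integral H (of_real \<alpha>)) {\<alpha>..\<beta>}"
      using N(5)[of "of_real \<alpha>"] cs0 by simp
    then have i3: "A (w (of_real \<alpha>)) = H (of_real \<alpha>)" by (simp add: A_def integral_unique)
    show "(\<phi> (w x0) has_integral A (w x0)) {\<alpha>..\<beta>}" using intg x0\<alpha> i2 i3 by metis
    show "h x0 = (if x0 \<in> S' then B x0 else f x0) - A (w x0) / of_real pi"
      using x0(2) x0\<alpha> i3 by (auto simp: h_def)
  qed
  have np: "\<not> is_pole w y" if "y \<in> D - {p}" for y
    using not_is_pole_holomorphic[of "D - {p}" y w] w(1) D(1) that by (simp add: open_delete)
  have kern0: "of_real (sqrt ((t-\<alpha>)*(\<beta>-t))) * \<rho> (of_real t) * kern w x0 (of_real t) = \<phi> (w x0) t" for t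
    using np[of x0] x0D x0 by (simp add: kern_def \<phi>_def)
  define F0 where "F0 = (if x0 \<in> S' then B x0 else f x0)"
  note h0 = h0[folded F0_def]
  show ?thesis
    unfolding S_def S'_def[symmetric] F0_def[symmetric]
  proof (cases "x = p")
    case True
    \<comment> \<open>The default value 0 of \<open>kern\<close> at a pole agrees with the limit 0
      of the Cauchy integral at p.\<close>
    have "(\<lambda>t. of_real (sqrt ((t-\<alpha>)*(\<beta>-t))) * \<rho> (of_real t) * (kern w x (of_real t) - kern w x0 (of_real t))) = (\<lambda>t. - \<phi> (w x0) t)"
      using w(3) True kern0 by (auto simp: kern_def[of w p])
    moreover have "integral {\<alpha>..\<beta>} (\<lambda>t. - \<phi> (w x0) t) = - A (w x0)"
      using has_integral_neg[OF A0] by (rule integral_unique)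
    moreover have "h x = f x" using True p by (simp add: h_def)
    ultimately show "f x - F0 = of_real (1/pi) *
     integral {\<alpha>..\<beta>} (\<lambda>t. of_real (sqrt ((t-\<alpha>)*(\<beta>-t))) * \<rho> (of_real t) * (kern w x (of_real t) - kern w x0 (of_real t)))"
      using hx h0 by (simp add: algebra_simps)
  next
    case False
    have xs: "x \<in> D - S' - {p}" using x False by simp
    have Ax: "(\<phi> (w x) has_integral A (w x)) {\<alpha>..\<beta>}"
      unfolding A_def using avoid[OF xs] cW cc
      by (intro integrable_integral, unfold \<phi>c, intro integrable_continuous_real continuous_intros) (force simp: WS[symmetric])+
    have kernx: "of_real (sqrt ((t-\<alpha>)*(\<beta>-t))) * \<rho> (of_real t) * kern w x (of_real t) = \<phi> (w x) t" for t
      using np[of x] xs by (simp add: kern_def \<phi>_def)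
    have "(\<lambda>t. of_real (sqrt ((t-\<alpha>)*(\<beta>-t))) * \<rho> (of_real t) * (kern w x (of_real t) - kern w x0 (of_real t))) = (\<lambda>t. \<phi> (w x) t - \<phi> (w x0) t)"
      by (rule ext) (simp only: kern0[symmetric] kernx[symmetric] right_diff_distrib)
    moreover have "integral {\<alpha>..\<beta>} (\<lambda>t. \<phi> (w x) t - \<phi> (w x0) t) = A (w x) - A (w x0)"
      using has_integral_diff[OF Ax A0] by (rule integral_unique)
    moreover have "f x - F0 = A (w x) / of_real pi - A (w x0) / of_real pi"
      using hx h0 xs by (simp add: h_def algebra_simps)
    ultimately show "f x - F0 = of_real (1/pi) *
     integral {\<alpha>..\<beta>} (\<lambda>t. of_real (sqrt ((t-\<alpha>)*(\<beta>-t))) * \<rho> (of_real t) * (kern w x (of_real t) - kern w x0 (of_real t)))"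
      by (simp add: diff_divide_distrib)
  qed
qed

section \<open>Conformal gluing functions\<close>

lemma mero_on_punctured_nbhd:
  assumes w: "mero_on D w" and x: "x \<in> D"
  obtains r where "r > 0" "ball x r \<subseteq> D" "w holomorphic_on (ball x r - {x})" "\<forall>y\<in>ball x r - {x}. \<not> is_pole w y"
proof -
  have D: "open D" "w meromorphic_on D" using w by (auto simp: mero_on_def)
  have "isolated_singularity_at w x" using D(2) x meromorphic_on_altdef by blast
  then obtain r1 where r1: "r1 > 0" "w analytic_on ball x r1 - {x}" by (auto simp: isolated_singularity_at_def)
  obtain r2 where r2: "r2 > 0" "ball x r2 \<subseteq> D" using D(1) x openE by blast
  define r where "r = min r1 r2"
  have an: "w analytic_on ball x r - {x}" by (rule analytic_on_subset[OF r1(2)]) (auto simp: r_def)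
  show ?thesis
  proof (rule that[of r])
    show "\<forall>y\<in>ball x r - {x}. \<not> is_pole w y"
      using analytic_at_imp_no_pole analytic_on_subset[OF an] by blast
    show "w holomorphic_on ball x r - {x}" using an by (rule analytic_imp_holomorphic)
    show "r > 0" "ball x r \<subseteq> D" using r1 r2 by (auto simp: r_def)
  qed
qed

lemma mero_on_open_nonpoles:
  assumes w: "mero_on D w"
  shows "open {x \<in> D. \<not> is_pole w x}" "w holomorphic_on {x \<in> D. \<not> is_pole w x}"
proof -
  show "open {x \<in> D. \<not> is_pole w x}"
    unfolding open_contains_ball
  proof safe
    fix x assume x: "x \<in> D" "\<not> is_pole w x"
    obtain r where "r > 0" "ball x r \<subseteq> D" "w holomorphic_on (ball x r - {x})" "\<forall>y\<in>ball x r - {x}. \<not> is_pole w y"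
      using mero_on_punctured_nbhd[OF w x(1)] by blast
    then show "\<exists>e>0. ball x e \<subseteq> {x \<in> D. \<not> is_pole w x}" using x by (intro exI[of _ r]) auto
  qed
  show "w holomorphic_on {x \<in> D. \<not> is_pole w x}"
    unfolding holomorphic_on_def using w field_differentiable_at_within unfolding mero_on_def by blast
qed

text \<open>Near a pole of w the reciprocal tends to 0, so the \<open>if\<close> only fills in
  removable singularities; elsewhere the denominator is nonzero by assumption.\<close>

lemma mero_on_reciprocal_holomorphic:
  assumes w: "mero_on D w" and A: "open A" "A \<subseteq> D"
    and ne: "\<And>x. x \<in> A \<Longrightarrow> \<not> is_pole w x \<Longrightarrow> w x \<noteq> c"
  shows "(\<lambda>x. if is_pole w x then 0 else inverse (w x - c)) holomorphic_on A" (is "?g holomorphic_on A")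
  unfolding holomorphic_on_open[OF A(1)]
proof
  fix x assume x: "x \<in> A"
  have xD: "x \<in> D" using x A by auto
  obtain r0 where r0: "r0 > 0" "ball x r0 \<subseteq> D" "w holomorphic_on (ball x r0 - {x})" "\<forall>y\<in>ball x r0 - {x}. \<not> is_pole w y"
    using mero_on_punctured_nbhd[OF w xD] by blast
  obtain r1 where r1: "r1 > 0" "ball x r1 \<subseteq> A" using A x openE by blast
  define r where "r = min r0 r1"
  have r: "r > 0" "ball x r \<subseteq> A" "w holomorphic_on (ball x r - {x})" "\<forall>y\<in>ball x r - {x}. \<not> is_pole w y"
  proof -
    show "w holomorphic_on (ball x r - {x})" by (rule holomorphic_on_subset[OF r0(3)]) (auto simp: r_def)
  qed (use r0 r1 in \<open>auto simp: r_def\<close>)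
  have "?g holomorphic_on ball x r"
  proof (cases "is_pole w x")
    case True
    have "(\<lambda>y. if y = x then 0 else inverse (w y - c)) holomorphic_on ball x r"
    proof (rule is_pole_inverse_holomorphic)
      show "(\<lambda>y. w y - c) holomorphic_on ball x r - {x}" using r(3) by (intro holomorphic_intros)
      show "is_pole (\<lambda>y. w y - c) x" using True by (simp add: is_pole_minus_const_iff)
      show "\<forall>y\<in>ball x r - {x}. w y - c \<noteq> 0"
      proof
        fix y assume "y \<in> ball x r - {x}"
        then have "w y \<noteq> c" using r(2,4) by (intro ne) auto
        then show "w y - c \<noteq> 0" by simp
      qed
    qed auto
    then show ?thesis by (rule holomorphic_transform) (use r True in auto)
  next
    case False
    have "ball x r \<subseteq> {x \<in> D. \<not> is_pole w x}" using False r A by force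
    then have "w holomorphic_on ball x r" using mero_on_open_nonpoles(2)[OF w] holomorphic_on_subset by blast
    then have "(\<lambda>y. inverse (w y - c)) holomorphic_on ball x r"
    proof (intro holomorphic_intros)
      fix y assume "y \<in> ball x r"
      then have "w y \<noteq> c" using r(2,4) False by (intro ne) auto
      then show "w y - c \<noteq> 0" by simp
    qed
    then show ?thesis by (rule holomorphic_transform) (use r False in auto)
  qed
  then show "\<exists>f'. (?g has_field_derivative f') (at x)"
    using r(1) by (auto simp: holomorphic_on_open)
qed

text \<open>Replacing w by the Moebius transform 1/(w - c) changes the kernel by a term independent of
  the pole parameter s, so differences of kernels are invariant; the junk value 0 of the kernel
  is the right one because w - w(s) is infinite there.\<close>
lemma kern_reciprocal:
  fixes c :: complex and w :: "complex \<Rightarrow> complex"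
  defines "v \<equiv> \<lambda>x. if is_pole w x then 0 else inverse (w x - c)"
  assumes w: "mero_on D w" and t: "t \<in> D" "\<not> is_pole w t" "w t \<noteq> c"
    and pole: "is_pole v s \<longleftrightarrow> \<not> is_pole w s \<and> w s = c"
    and ne: "\<not> is_pole w s \<Longrightarrow> w t \<noteq> w s"
  shows "kern v s t = kern w s t - deriv w t / (w t - c)"
proof -
  have op: "open {x \<in> D. \<not> is_pole w x}" and hol: "w holomorphic_on {x \<in> D. \<not> is_pole w x}"
    using mero_on_open_nonpoles[OF w] .
  have "(w has_field_derivative deriv w t) (at t)"
    by (rule holomorphic_derivI[OF hol op]) (use t in auto)
  then have "((\<lambda>x. inverse (w x - c)) has_field_derivative - deriv w t / (w t - c)^2) (at t)"
    using t by (auto intro!: derivative_eq_intros simp: power2_eq_square field_simps)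
  moreover have "eventually (\<lambda>x. inverse (w x - c) = v x) (nhds t)"
    using eventually_nhds_in_open[OF op, of t] t by (auto simp: v_def elim!: eventually_mono)
  ultimately have "(v has_field_derivative - deriv w t / (w t - c)^2) (at t)"
    using DERIV_cong_ev[of t t "\<lambda>x. inverse (w x - c)" v] by blast
  then have dv: "deriv v t = - deriv w t / (w t - c)^2" by (rule DERIV_imp_deriv)
  have tc: "w t - c \<noteq> 0" using t by simp
  have vt: "v t = inverse (w t - c)" using t by (simp add: v_def)
  consider "is_pole w s" | "\<not> is_pole w s" "w s = c" | "\<not> is_pole w s" "w s \<noteq> c" by blast
  then show ?thesis
  proof cases
    case 1
    then have "v s = 0" "\<not> is_pole v s" using pole by (auto simp: v_def)
    then show ?thesis using 1 tc by (simp add: kern_def dv vt power2_eq_square)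
  next
    case 2
    then show ?thesis using pole by (simp add: kern_def)
  next
    case 3
    have nz: "w s - c \<noteq> 0" "w t - w s \<noteq> 0" using 3 ne by auto
    have aux: "- d / a^2 / (inverse a - inverse b) = d * b / (a * (a - b))" if "a \<noteq> 0" "b \<noteq> 0" "a \<noteq> b" for a b d :: complex
    proof -
      have "inverse a - inverse b = - ((a - b) / (a * b))" using that by (simp add: field_simps)
      then show ?thesis using that by (simp add: power2_eq_square)
    qed
    have "kern v s t = - deriv w t / (w t - c)^2 / (inverse (w t - c) - inverse (w s - c))"
      using 3 pole by (simp add: kern_def dv vt) (simp add: v_def)
    also have "\<dots> = deriv w t * (w s - c) / ((w t - c) * ((w t - c) - (w s - c)))"
      using tc nz by (intro aux) auto
    also have "\<dots> = deriv w t * (w s - c) / ((w t - c) * (w t - w s))" by simp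
    also have "\<dots> = deriv w t / (w t - w s) - deriv w t / (w t - c)"
    proof -
      have "d * b / (a * (a - b)) = d / (a - b) - d / a" if "a \<noteq> 0" "a \<noteq> b" for a b d :: complex
        using that by (simp add: field_simps)
      from this[of "w t - c" "w s - c" "deriv w t"] show ?thesis using nz tc by simp
    qed
    finally show ?thesis using 3 by (simp add: kern_def)
  qed
qed

text \<open>By the identity theorem the meromorphic function w o \<iota> - w, having zeros that
  accumulate at t0, vanishes off a sparse set. Since \<open>mero_on\<close> admits no wrongly filled
  points, continuity upgrades this to all non-poles, and poles are carried to poles.\<close>

lemma mero_on_involution_extend:
  assumes w: "mero_on D w" and \<Omega>: "open \<Omega>" "connected \<Omega>" "\<Omega> \<subseteq> D"
    and \<iota>: "\<iota> holomorphic_on \<Omega>" "\<And>x. x \<in> \<Omega> \<Longrightarrow> \<iota> x \<in> \<Omega>" "\<And>x. x \<in> \<Omega> \<Longrightarrow> \<iota> (\<iota> x) = x"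
    and t0: "t0 \<in> \<Omega>" "frequently (\<lambda>t. w (\<iota> t) = w t) (at t0)"
    and x: "x \<in> \<Omega>"
  shows "is_pole w (\<iota> x) \<longleftrightarrow> is_pole w x" "\<not> is_pole w x \<Longrightarrow> w (\<iota> x) = w x"
proof -
  have mer: "w meromorphic_on \<Omega>"
    using w \<Omega> meromorphic_on_subset by (auto simp: mero_on_def)
  have \<iota>a: "\<iota> analytic_on \<Omega>" using \<iota> \<Omega> analytic_on_open by blast
  have "(\<lambda>y. w (\<iota> y) - w y) meromorphic_on \<Omega>"
    using \<iota>(2) by (intro meromorphic_intros mer meromorphic_on_compose[OF mer \<iota>a]) auto
  then have "eventually (\<lambda>z. w (\<iota> z) - w z = 0) (cosparse \<Omega>) \<or> eventually (\<lambda>z. w (\<iota> z) - w z \<noteq> 0) (cosparse \<Omega>)"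
    by (rule meromorphic_imp_constant_or_avoid) (use \<Omega> in auto)
  moreover have "\<not> eventually (\<lambda>z. w (\<iota> z) - w z \<noteq> 0) (cosparse \<Omega>)"
    using t0 \<Omega> by (auto simp: eventually_cosparse_open_eq frequently_def)
  ultimately have eq: "eventually (\<lambda>z. w (\<iota> z) = w z) (at y)" if "y \<in> \<Omega>" for y
    using that \<Omega> by (auto simp: eventually_cosparse_open_eq)
  have cont: "isCont \<iota> y" if "y \<in> \<Omega>" for y using holomorphic_on_imp_isCont[OF \<iota>(1) \<Omega>(1) that] .
  have contw: "isCont w y" if "y \<in> \<Omega>" "\<not> is_pole w y" for y
    using w that \<Omega>(3) by (auto simp: mero_on_def intro: field_differentiable_imp_continuous_at)
  have comp: "isCont (\<lambda>z. w (\<iota> z)) y" if "y \<in> \<Omega>" "\<not> is_pole w (\<iota> y)" for y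
    using cont[OF that(1)] contw[OF \<iota>(2)[OF that(1)] that(2)] by (rule isCont_o2)
  have np: "is_pole w (\<iota> y)" if "y \<in> \<Omega>" "is_pole w y" for y
  proof (rule ccontr)
    assume "\<not> is_pole w (\<iota> y)"
    then have "((\<lambda>z. w (\<iota> z)) \<longlongrightarrow> w (\<iota> y)) (at y)" using comp that by (auto simp: isCont_def)
    then have "(w \<longlongrightarrow> w (\<iota> y)) (at y)" using eq[OF that(1)] Lim_transform_eventually by blast
    then show False using that(2) unfolding is_pole_def
      by (meson not_tendsto_and_filterlim_at_infinity trivial_limit_at)
  qed
  show "is_pole w (\<iota> x) \<longleftrightarrow> is_pole w x"
    using np[OF x] np[OF \<iota>(2)[OF x]] \<iota>(3)[OF x] by auto
  then show "w (\<iota> x) = w x" if "\<not> is_pole w x"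
  proof -
    have "((\<lambda>z. w (\<iota> z)) \<longlongrightarrow> w (\<iota> x)) (at x)" using comp[OF x] that \<open>is_pole w (\<iota> x) \<longleftrightarrow> is_pole w x\<close> by (auto simp: isCont_def)
    then have "(w \<longlongrightarrow> w (\<iota> x)) (at x)" using eq[OF x] Lim_transform_eventually by blast
    moreover have "(w \<longlongrightarrow> w x) (at x)" using contw[OF x that] by (simp add: isCont_def)
    ultimately show ?thesis using tendsto_unique trivial_limit_at by blast
  qed
qed

text \<open>The definition of a CGF speaks of limits from inside C. Continuity of w at both points
  identifies these limits with values and excludes the infinite case.\<close>

lemma CGF_boundary_symmetric:
  assumes cgf: "CGF C w" and t: "t \<in> frontier C" and c: "isCont w t" "isCont w (cnj t)"
  shows "w (cnj t) = w t"
proof -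
  have C: "open C" "\<And>t. cnj t \<in> C \<longleftrightarrow> t \<in> C" using cgf by (auto simp: CGF_def)
  have im: "cnj ` C = C" 
  proof
    show "C \<subseteq> cnj ` C"
    proof
      fix x assume "x \<in> C" then have "cnj x \<in> C" using C by simp
      then show "x \<in> cnj ` C" by (metis complex_cnj_cnj image_eqI)
    qed
  qed (use C in auto)
  have cl: "t \<in> closure C" "t \<notin> C" using t C(1) by (auto simp: frontier_def interior_open)
  have "cnj t \<in> closure C"
    using closure_linear_image_subset[OF bounded_linear.linear[OF bounded_linear_cnj], of C] cl unfolding im by blast
  moreover have "cnj t \<notin> C" using C cl by blast
  ultimately have nb: "at (cnj t) within C \<noteq> bot" "at t within C \<noteq> bot"
    using cl by (auto simp: trivial_limit_within islimpt_in_closure)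
  have lim: "(w \<longlongrightarrow> w t) (at t within C)" "(w \<longlongrightarrow> w (cnj t)) (at (cnj t) within C)"
    using c unfolding isCont_def by (blast intro: tendsto_within_subset)+
  from cgf t have "(\<exists>l. (w \<longlongrightarrow> l) (at t within C) \<and> (w \<longlongrightarrow> l) (at (cnj t) within C)) \<or>
        (filterlim w at_infinity (at t within C) \<and> filterlim w at_infinity (at (cnj t) within C))"
    by (auto simp: CGF_def)
  then show ?thesis
  proof
    assume "\<exists>l. (w \<longlongrightarrow> l) (at t within C) \<and> (w \<longlongrightarrow> l) (at (cnj t) within C)"
    then show ?thesis using lim nb tendsto_unique by metis
  next
    assume "filterlim w at_infinity (at t within C) \<and> filterlim w at_infinity (at (cnj t) within C)"
    then show ?thesis using lim nb not_tendsto_and_filterlim_at_infinity by blast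
  qed
qed

text \<open>Reduces an arbitrary CGF to \<open>gluing_one_pole\<close>. The unit circle separates
  the ingredients: slit, base point and the new pole lie in the disc, whereas \<iota> acts on the
  exterior, so that a folded point never meets any of them.\<close>

theorem gluing_CGF:
  fixes f w B \<rho> \<iota> :: "complex \<Rightarrow> complex"
  defines "S \<equiv> \<lambda>\<alpha> \<beta>. closed_segment (complex_of_real \<alpha>) (complex_of_real \<beta>)"
  assumes D: "connected D" and ab: "\<alpha> < \<beta>"
    and w: "mero_on D w" "CGF C w"
    and C: "ball 0 1 \<subseteq> C" "S \<alpha> \<beta> \<subseteq> ball 0 1" "closure C \<subseteq> D"
    and \<Omega>: "connected (D - cball 0 1)" "frontier C \<inter> cball 0 1 = {}"
    and \<iota>: "\<iota> holomorphic_on D - cball 0 1"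
      "\<And>x. x \<in> D - cball 0 1 \<Longrightarrow> \<iota> x \<in> D - cball 0 1"
      "\<And>x. x \<in> D - cball 0 1 \<Longrightarrow> \<iota> (\<iota> x) = x"
      "\<And>x. x \<in> frontier C \<Longrightarrow> \<iota> x = cnj x"
      "\<And>x. x \<in> D - closure C \<Longrightarrow> \<iota> x \<in> C"
    and t0: "t0 \<in> frontier C" "t0 islimpt frontier C"
    and f: "f holomorphic_on D - S \<alpha> \<beta>" "\<And>x. x \<in> D - cball 0 1 \<Longrightarrow> f (\<iota> x) = f x"
    and U: "open U" "S \<alpha> \<beta> \<subseteq> U" "B holomorphic_on U" "\<rho> holomorphic_on U"
      "\<And>x. x \<in> U - S \<alpha> \<beta> \<Longrightarrow> f x = B x + cut_sqrt \<alpha> \<beta> x * \<rho> x"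
    and inf: "bounded C \<or> bounded (-D) \<and> (\<exists>K R. \<forall>x\<in>C. norm x > R \<longrightarrow> norm (f x) \<le> K)"
    and x0: "x0 \<in> ball 0 1 - S \<alpha> \<beta> \<union> {of_real \<alpha>}"
    and x: "x \<in> D - S \<alpha> \<beta>"
  shows "f x - (if x0 \<in> S \<alpha> \<beta> then B x0 else f x0) = of_real (1/pi) *
     integral {\<alpha>..\<beta>} (\<lambda>t. of_real (sqrt ((t-\<alpha>)*(\<beta>-t))) * \<rho> (of_real t) * (kern w x (of_real t) - kern w x0 (of_real t)))"
proof -
  define S' where "S' = closed_segment (complex_of_real \<alpha>) (complex_of_real \<beta>)"
  have SS: "S \<alpha> \<beta> = S'" by (simp add: S_def S'_def)
  note C = C[unfolded SS] and f = f[unfolded SS] and U = U[unfolded SS] and x0 = x0[unfolded SS] and x = x[unfolded SS]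
  define \<Omega> where "\<Omega> = D - cball 0 1"
  note \<iota> = \<iota>[folded \<Omega>_def] and \<Omega>c = \<Omega>[folded \<Omega>_def] and f = f[folded \<Omega>_def]
  define NP where "NP = {x \<in> D. \<not> is_pole w x}"
  have NP: "open NP" "w holomorphic_on NP" using mero_on_open_nonpoles[OF w(1)] by (auto simp: NP_def)
  have opD: "open D" using w(1) by (simp add: mero_on_def)
  have op\<Omega>: "open \<Omega>" using opD by (auto simp: \<Omega>_def)
  obtain P where P: "P \<subseteq> C" "open (C - P)" "\<forall>p\<in>P. is_pole w p" "w holomorphic_on (C - P)" "inj_on w (C - P)"
    using w(2) unfolding CGF_def by (elim conjE exE) (erule (4) that)
  have opC: "open C" using w(2) unfolding CGF_def by (rule conjunct1)
  have CD: "C \<subseteq> D" using C(3) closure_subset by blast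
  have P_iff: "is_pole w y \<longleftrightarrow> y \<in> P" if "y \<in> C" for y
    using P that not_is_pole_holomorphic[OF P(2) _ P(4), of y] by auto
  have CP: "C - P \<subseteq> NP" using P_iff CD by (auto simp: NP_def)
  have contw: "isCont w y" if "y \<in> NP" for y using holomorphic_on_imp_isCont[OF NP(2,1) that] .
  have fr\<Omega>: "frontier C \<subseteq> \<Omega>" using \<Omega>c(2) C(3) by (auto simp: \<Omega>_def frontier_def)
  have \<Omega>D: "\<Omega> \<subseteq> D" by (auto simp: \<Omega>_def)
  have fold: "is_pole w (\<iota> y) \<longleftrightarrow> is_pole w y" "\<not> is_pole w y \<Longrightarrow> w (\<iota> y) = w y" if y: "y \<in> \<Omega>" for y
  proof -
    have t0\<Omega>: "t0 \<in> \<Omega>" using t0 fr\<Omega> by auto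
    have fr: "frequently (\<lambda>t. w (\<iota> t) = w t) (at t0)"
    proof -
      \<comment> \<open>Poles are isolated. Close to t0, but different from it, neither t nor its
        conjugate is a pole, and the boundary symmetry gives w(\<iota> t) = w t along the
        curve.\<close>
      have "eventually (\<lambda>t. \<not> is_pole w t) (at u)" if u: "u \<in> D" for u
      proof -
        obtain r where "r > 0" "ball u r \<subseteq> D" "w holomorphic_on (ball u r - {u})" "\<forall>y\<in>ball u r - {u}. \<not> is_pole w y"
          using mero_on_punctured_nbhd[OF w(1) u] by blast
        then show ?thesis unfolding eventually_at by (intro exI[of _ r]) (auto simp: dist_commute)
      qed note ev = this
      have e1: "eventually (\<lambda>t. \<not> is_pole w t) (at t0)" using ev t0\<Omega> by (auto simp: \<Omega>_def)
      have ct: "cnj t0 \<in> \<Omega>" using \<iota>(2)[OF t0\<Omega>] \<iota>(4)[OF t0(1)] by simp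
      have "(cnj \<longlongrightarrow> cnj t0) (at t0)" by (intro tendsto_intros)
      moreover have "eventually (\<lambda>t. cnj t \<noteq> cnj t0) (at t0)" by (simp add: eventually_at_filter)
      ultimately have lim: "filterlim cnj (at (cnj t0)) (at t0)" by (rule filterlim_atI)
      have e0: "eventually (\<lambda>t. \<not> is_pole w t) (at (cnj t0))" using ev[of "cnj t0"] ct by (simp add: \<Omega>_def)
      have e2: "eventually (\<lambda>t. \<not> is_pole w (cnj t)) (at t0)"
        using eventually_compose_filterlim[OF e0 lim] .
      have "frequently (\<lambda>t. t \<in> frontier C) (at t0)" using t0(2) islimpt_conv_frequently_at by blast
      moreover have "eventually (\<lambda>t. t \<in> frontier C \<longrightarrow> w (\<iota> t) = w t) (at t0)"
        using e1 e2
      proof eventually_elim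
        case (elim t)
        show ?case
        proof
          assume t: "t \<in> frontier C"
          have "t \<in> \<Omega>" using t fr\<Omega> by blast
          then have "cnj t \<in> \<Omega>" using \<iota>(2)[of t] \<iota>(4)[OF t] by simp
          then have "t \<in> NP" "cnj t \<in> NP" using elim \<open>t \<in> \<Omega>\<close> by (auto simp: NP_def \<Omega>_def)
          then have "w (cnj t) = w t" using CGF_boundary_symmetric[OF w(2) t] contw by simp
          then show "w (\<iota> t) = w t" by (simp only: \<iota>(4)[OF t])
        qed
      qed
      ultimately show ?thesis by (rule frequently_mp[rotated])
    qed
    show "is_pole w (\<iota> y) \<longleftrightarrow> is_pole w y"
      by (rule mero_on_involution_extend(1)[OF w(1) op\<Omega> \<Omega>c(1) \<Omega>D \<iota>(1,2,3) t0\<Omega> fr y])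
    show "w (\<iota> y) = w y" if np: "\<not> is_pole w y"
      by (rule mero_on_involution_extend(2)[OF w(1) op\<Omega> \<Omega>c(1) \<Omega>D \<iota>(1,2,3) t0\<Omega> fr y np])
  qed
  have out\<Omega>: "y \<in> \<Omega>" if "y \<in> D" "y \<notin> C" for y
  proof (cases "y \<in> closure C")
    case True
    then have "y \<in> frontier C" using that interior_open[OF opC] by (simp add: frontier_def)
    then show ?thesis using fr\<Omega> by blast
  next
    case False
    have "cball (0::complex) 1 \<subseteq> closure C" using closure_mono[OF C(1)] by simp
    then have "y \<notin> cball 0 1" using False by blast
    then show ?thesis using that by (simp add: \<Omega>_def)
  qed
  \<comment> \<open>Injectivity of w is given on C - P only; kernels need points of the disc to be
    separated from all of D. For y outside the closure of C, the partner \<iota> y is in C but not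
    in the disc, hence different from a.\<close>
  have sep: "w y \<noteq> w a" if a: "a \<in> ball 0 1" "a \<notin> P" and y: "y \<in> NP" "y \<noteq> a" for a y
  proof -
    have aC: "a \<in> C - P" using a C by auto
    consider "y \<in> C" | "y \<notin> C" "y \<in> closure C" | "y \<notin> closure C" by blast
    then show ?thesis
    proof cases
      case 1
      then have "y \<in> C - P" using y P_iff by (auto simp: NP_def)
      then show ?thesis using P(5) aC y by (auto simp: inj_on_def)
    next
      case 2
      have "y \<in> closure (C - P)"
      proof -
        have "open (NP \<inter> S)" if "open S" for S using NP that by auto
        have "NP \<inter> closure C \<subseteq> closure (NP \<inter> C)" by (rule open_Int_closure_subset[OF NP(1)])
        moreover have "NP \<inter> C \<subseteq> C - P" using P(3) by (auto simp: NP_def)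
        ultimately show ?thesis using y 2 closure_mono by blast
      qed
      then show ?thesis
        using 2 aC P contw[OF y(1)] by (intro injective_holomorphic_boundary_value[of "C - P"]) auto
    next
      case 3
      have yD: "y \<in> D" using y by (auto simp: NP_def)
      have y\<Omega>: "y \<in> \<Omega>" using out\<Omega> yD 3 closure_subset[of C] by auto
      have i: "\<iota> y \<in> C" "\<iota> y \<in> \<Omega>" using \<iota>(5)[of y] \<iota>(2)[OF y\<Omega>] 3 yD by auto
      have "\<iota> y \<notin> P" "w (\<iota> y) = w y" using fold[OF y\<Omega>] y P_iff[OF i(1)] by (auto simp: NP_def)
      moreover have "\<iota> y \<noteq> a" using i(2) a(1) by (auto simp: \<Omega>_def)
      ultimately show ?thesis using P(5) aC i(1) by (metis DiffI inj_onD)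
    qed
  qed
  have S'prop: "closed S'" by (simp add: S'_def)
  obtain p where p: "p \<in> ball 0 1 - S' - {x0}" "p \<notin> P"
  proof -
    define A where "A = ball 0 1 - S' - {x0}"
    have A: "open A" using S'prop by (auto simp: A_def open_delete)
    have "A \<noteq> {}"
    proof
      assume e: "A = {}"
      \<comment> \<open>Two points off the real axis, of which x0 can be only one.\<close>
      have i: "\<i> / 2 \<in> ball 0 (1::real)" "\<i> / 3 \<in> ball 0 (1::real)" by auto
      have "\<i> / 2 \<notin> S'" "\<i> / 3 \<notin> S'"
        unfolding S'_def closed_segment_of_real by (auto simp: complex_eq_iff)
      moreover have "ball 0 1 - S' - {x0} = {}" using e by (simp only: A_def)
      ultimately have "\<i> / 2 = x0" "\<i> / 3 = x0" using i by blast+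
      then show False by (simp add: complex_eq_iff)
    qed
    then obtain a where a: "a \<in> A" by blast
    show ?thesis
    proof (cases "a \<in> P")
      case False
      then show ?thesis using that a by (auto simp: A_def)
    next
      case True
      \<comment> \<open>If the point found is a pole of w, some nearby point is not, since poles are
        isolated.\<close>
      have "a \<in> D" using True P CD by auto
      then obtain r where r: "r > 0" "ball a r \<subseteq> D" "w holomorphic_on (ball a r - {a})" "\<forall>y\<in>ball a r - {a}. \<not> is_pole w y"
        using mero_on_punctured_nbhd[OF w(1)] by blast
      have "a islimpt UNIV" by simp
      have "open (ball a r \<inter> A)" "a \<in> ball a r \<inter> A" using r a A by auto
      then obtain b where "b \<in> ball a r \<inter> A" "b \<noteq> a"
        using islimptE[OF \<open>a islimpt UNIV\<close>, of "ball a r \<inter> A"] by blast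
      then have "b \<in> ball 0 1 - S' - {x0}" "\<not> is_pole w b" using r(4) by (auto simp: A_def)
      then show ?thesis using that[of b] P(3) by blast
    qed
  qed
  have pC: "p \<in> C - P" "p \<notin> S'" "p \<in> NP" using p C CP by auto
  \<comment> \<open>The pole moves to p, and the poles of w become zeros of v.\<close>
  define v where "v = (\<lambda>x. if is_pole w x then 0 else inverse (w x - w p))"
  have wp: "w y \<noteq> w p" if "y \<in> NP" "y \<noteq> p" for y
    using sep[of p y] that p by auto
  have v: "v holomorphic_on D - {p}"
    unfolding v_def using wp by (intro mero_on_reciprocal_holomorphic[OF w(1)]) (auto simp: NP_def opD open_delete)
  have v0: "v y = 0 \<longleftrightarrow> is_pole w y" if "y \<in> D - {p}" for y
    using wp[of y] that by (auto simp: v_def NP_def)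
  have vp: "is_pole v p"
  proof -
    have "((\<lambda>y. w y - w p) \<longlongrightarrow> 0) (at p)"
      using contw[OF pC(3)] by (simp add: isCont_def LIM_zero)
    moreover have ev: "eventually (\<lambda>y. y \<in> NP - {p}) (at p)" using NP pC by (intro eventually_at_in_open) auto
    then have "eventually (\<lambda>y. w y - w p \<noteq> 0) (at p)" by eventually_elim (use wp in auto)
    ultimately have "filterlim (\<lambda>y. w y - w p) (at 0) (at p)" by (simp add: filterlim_at)
    then have "filterlim (\<lambda>y. inverse (w y - w p)) at_infinity (at p)"
      by (rule filterlim_compose[OF filterlim_inverse_at_infinity])
    moreover have "eventually (\<lambda>y. inverse (w y - w p) = v y) (at p)"
      using ev by eventually_elim (auto simp: v_def NP_def)
    ultimately show ?thesis unfolding is_pole_def by (rule filterlim_cong[THEN iffD1, OF refl refl, rotated])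
  qed
  have v_inj0: "v a \<noteq> v b" if "a \<in> C - P - {p}" "b \<in> C - P - {p}" "a \<noteq> b" for a b
  proof -
    have "w a \<noteq> w b" using P(5) that by (auto simp: inj_on_def)
    moreover have "v a = inverse (w a - w p)" "v b = inverse (w b - w p)"
      using that P_iff by (auto simp: v_def)
    ultimately show ?thesis by simp
  qed
  have vP: "v a = 0 \<longleftrightarrow> a \<in> P" if "a \<in> C - {p}" for a using v0[of a] P_iff[of a] that CD by auto
  \<comment> \<open>A CGF is injective off its poles, so that it has at most one pole must be
    proved. At two poles v would be 0; but v is injective on C - P - {p} with a added, and b is a
    boundary point of that set.\<close>
  have P1: "a = b" if ab': "a \<in> P" "b \<in> P" for a b
  proof (rule ccontr)
    assume ne: "a \<noteq> b"
    have nab: "a \<noteq> p" "b \<noteq> p" "a \<in> C" "b \<in> C" using ab' p P by auto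
    have nbhd: "\<exists>r>0. ball u r \<subseteq> C - {p} \<and> ball u r \<inter> P = {u}" if "u \<in> P" for u
    proof -
      have "u \<in> D" using that P CD by auto
      then obtain r where r: "r > 0" "ball u r \<subseteq> D" "w holomorphic_on (ball u r - {u})" "\<forall>y\<in>ball u r - {u}. \<not> is_pole w y"
        using mero_on_punctured_nbhd[OF w(1)] by blast
      have "u \<in> C - {p}" "open (C - {p})" using that P p opC by (auto simp: open_delete)
      then obtain r' where "r' > 0" "ball u r' \<subseteq> C - {p}" using openE by blast
      then have "min r r' > 0" "ball u (min r r') \<subseteq> C - {p}" using r(1) by auto
      moreover have "y = u" if "y \<in> ball u (min r r')" "y \<in> P" for y
      proof (rule ccontr)
        assume "y \<noteq> u"
        then have "\<not> is_pole w y" using r(4) that(1) by simp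
        then show False using P(3) that(2) by blast
      qed
      ultimately show ?thesis using \<open>u \<in> P\<close> by (intro exI[of _ "min r r'"]) auto
    qed
    obtain r where r: "r > 0" "ball a r \<subseteq> C - {p}" "ball a r \<inter> P = {a}" using nbhd[OF ab'(1)] by blast
    obtain s where s: "s > 0" "ball b s \<subseteq> C - {p}" "ball b s \<inter> P = {b}" using nbhd[OF ab'(2)] by blast
    define A where "A = (C - P - {p}) \<union> ball a r"
    have A_eq: "A = insert a (C - P - {p})" using r by (auto simp: A_def)
    have vab: "v a = 0" "v b = 0" using vP[of a] vP[of b] nab ab' by auto
    have "v b \<noteq> v a"
    proof (rule injective_holomorphic_boundary_value[of A v a b])
      show "open A" unfolding A_def using P(2) by (auto simp: open_delete)
      show "v holomorphic_on A" by (rule holomorphic_on_subset[OF v]) (use A_eq nab CD in auto)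
      show "inj_on v A"
      proof -
        have "inj_on v (C - P - {p})" by (rule inj_onI, rule ccontr) (use v_inj0 in blast)
        moreover have "v y \<noteq> 0" if "y \<in> C - P - {p}" for y using vP[of y] that by auto
        then have "v a \<notin> v ` (C - P - {p} - {a})" using vab(1) by (metis (no_types, lifting) DiffD1 imageE)
        ultimately show ?thesis unfolding A_eq inj_on_insert by blast
      qed
      show "a \<in> A" "b \<notin> A" using A_eq ab' ne by auto
      show "isCont v b" by (rule holomorphic_on_imp_isCont[OF v]) (use opD nab CD in \<open>auto simp: open_delete\<close>)
      have "b islimpt ball b s" using s(1) by (simp add: islimpt_ball)
      then have "b islimpt (ball b s - {b})" by (simp add: islimpt_punctured[symmetric])
      moreover have "ball b s - {b} \<subseteq> A" unfolding A_eq using s by blast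
      ultimately have "b islimpt A" by (rule islimpt_subset)
      then show "b \<in> closure A" by (simp add: closure_def)
    qed
    then show False using vab by simp
  qed
  have vinj: "inj_on v (C - {p})"
  proof (rule inj_onI)
    fix a b assume ab': "a \<in> C - {p}" "b \<in> C - {p}" "v a = v b"
    show "a = b"
    proof (cases "a \<in> P")
      case True
      then have "b \<in> P" using vP ab' by metis
      then show ?thesis using P1 True by blast
    next
      case False
      then have "b \<notin> P" using vP ab' by metis
      then show ?thesis using v_inj0[of a b] False ab' by blast
    qed
  qed
  have main: "f x - (if x0 \<in> S' then B x0 else f x0) = of_real (1/pi) *
     integral {\<alpha>..\<beta>} (\<lambda>t. of_real (sqrt ((t-\<alpha>)*(\<beta>-t))) * \<rho> (of_real t) * (kern v x (of_real t) - kern v x0 (of_real t)))"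
    unfolding S'_def
  proof (rule gluing_one_pole[OF opD D(1) ab opC])
    show "\<exists>x'\<in>C - closed_segment (of_real \<alpha>) (of_real \<beta>) - {p}. f x' = f y \<and> v x' = v y" if y: "y \<in> D - closure C" for y
    proof -
      have y\<Omega>: "y \<in> \<Omega>" using out\<Omega> y closure_subset[of C] by auto
      have "\<iota> y \<in> C" "\<iota> y \<notin> ball 0 1" using \<iota>(5)[OF y] \<iota>(2)[OF y\<Omega>] by (auto simp: \<Omega>_def)
      moreover have "f (\<iota> y) = f y" using f(2)[OF y\<Omega>] .
      moreover have "v (\<iota> y) = v y" using fold[OF y\<Omega>] by (simp add: v_def)
      moreover have "\<iota> y \<notin> S'" "\<iota> y \<noteq> p" using \<open>\<iota> y \<notin> ball 0 1\<close> C(2) p(1) by blast+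
      ultimately show ?thesis unfolding S'_def[symmetric] by blast
    qed
    show "x0 \<in> C - closed_segment (of_real \<alpha>) (of_real \<beta>) \<union> {of_real \<alpha>}" "x0 \<noteq> p"
      using x0 C p by (auto simp: S'_def)
    show "closed_segment (of_real \<alpha>) (of_real \<beta>) \<subseteq> C" using C(1,2) by (auto simp: S'_def)
    show "closure C \<subseteq> D" by (rule C(3))
    show "f holomorphic_on D - closed_segment (of_real \<alpha>) (of_real \<beta>)" using f(1) by (simp add: S'_def)
    show "open U" "B holomorphic_on U" "\<rho> holomorphic_on U" by (fact U)+
    show "closed_segment (of_real \<alpha>) (of_real \<beta>) \<subseteq> U" using U(2) by (simp add: S'_def)
    show "f y = B y + cut_sqrt \<alpha> \<beta> y * \<rho> y" if "y \<in> U - closed_segment (of_real \<alpha>) (of_real \<beta>)" for y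
      using U(5) that by (simp add: S'_def)
    show "v holomorphic_on D - {p}" "is_pole v p" "inj_on v (C - {p})" by (fact v vp vinj)+
    show "p \<in> C - closed_segment (of_real \<alpha>) (of_real \<beta>)" using pC by (simp add: S'_def)
    show "bounded C \<or> bounded (-D) \<and> (\<exists>K R. \<forall>x\<in>C. norm x > R \<longrightarrow> norm (f x) \<le> K)" by (fact inf)
    show "x \<in> D - closed_segment (of_real \<alpha>) (of_real \<beta>)" using x by (simp add: S'_def)
  qed
  have kv: "kern v y t = kern w y t - deriv w t / (w t - w p)"
    if y: "y \<in> D" and t: "t \<in> S'" "t \<notin> P" "t \<noteq> y" for y t
  proof -
    have tC: "t \<in> C - P" using t C by auto
    have tNP: "t \<in> NP" using tC CP by auto
    show ?thesis
    proof (rule kern_reciprocal[of D w t "w p" y, folded v_def, OF w(1)])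
      show "t \<in> D" "\<not> is_pole w t" using tNP by (auto simp: NP_def)
      show "w t \<noteq> w p" using wp[OF tNP] t pC by auto
      show "is_pole v y \<longleftrightarrow> \<not> is_pole w y \<and> w y = w p"
      proof (cases "y = p")
        case True
        then show ?thesis using vp pC by (auto simp: NP_def)
      next
        case False
        then have "\<not> is_pole v y" using not_is_pole_holomorphic[OF _ _ v, of y] y opD by (auto simp: open_delete)
        moreover have "is_pole w y \<or> w y \<noteq> w p" using wp[of y] y False by (auto simp: NP_def)
        ultimately show ?thesis by auto
      qed
      show "w t \<noteq> w y" if "\<not> is_pole w y"
        using sep[of t y] t C(2) y that by (auto simp: NP_def)
    qed
  qed
  have "integral {\<alpha>..\<beta>} (\<lambda>t. of_real (sqrt ((t-\<alpha>)*(\<beta>-t))) * \<rho> (of_real t) * (kern v x (of_real t) - kern v x0 (of_real t))) =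
    integral {\<alpha>..\<beta>} (\<lambda>t. of_real (sqrt ((t-\<alpha>)*(\<beta>-t))) * \<rho> (of_real t) * (kern w x (of_real t) - kern w x0 (of_real t)))"
  proof (rule integral_spike)
    \<comment> \<open>The comparison \<open>kv\<close> excludes t at a pole of w and t equal to x or
      x0. On the slit this leaves out at most one pole and an end point.\<close>
    have "{t. complex_of_real t \<in> P} \<subseteq> {Re (SOME a. a \<in> P)}"
    proof
      fix t assume "t \<in> {t. complex_of_real t \<in> P}"
      then have tP: "of_real t \<in> P" by simp
      then have "(SOME a. a \<in> P) \<in> P" by (rule someI)
      then have "(SOME a. a \<in> P) = of_real t" using P1 tP by blast
      then show "t \<in> {Re (SOME a. a \<in> P)}" by simp
    qed
    then have "finite ({t. of_real t \<in> P} \<union> {\<alpha>,\<beta>})" using finite_subset by auto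
    then show "negligible ({t. of_real t \<in> P} \<union> {\<alpha>,\<beta>})" by (rule negligible_finite)
    fix t assume t: "t \<in> {\<alpha>..\<beta>} - ({t. of_real t \<in> P} \<union> {\<alpha>,\<beta>})"
    have tS: "of_real t \<in> S'" using t by (auto simp: S'_def closed_segment_of_real closed_segment_eq_real_ivl)
    have "x0 \<in> D" "x0 \<noteq> of_real t" "x \<noteq> of_real t" using x0 t tS x C CD by (auto simp: S'_def)
    then show "of_real (sqrt ((t-\<alpha>)*(\<beta>-t))) * \<rho> (of_real t) * (kern w x (of_real t) - kern w x0 (of_real t)) =
      of_real (sqrt ((t-\<alpha>)*(\<beta>-t))) * \<rho> (of_real t) * (kern v x (of_real t) - kern v x0 (of_real t))"
      using kv[of x "of_real t"] kv[of x0 "of_real t"] tS t x by auto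
  qed
  then show ?thesis using main SS by simp
qed

section \<open>The functional equation\<close>

definition quadrant_walks :: "nat \<Rightarrow> (int \<times> int) list set" where
  "quadrant_walks k = {ws. length ws = k \<and> set ws \<subseteq> gessel_steps \<and>
      (\<forall>n\<le>k. 0 \<le> sum_list (map fst (take n ws)) \<and> 0 \<le> sum_list (map snd (take n ws)))}"

text \<open>Because 0 ^ 0 = 1, setting x or y to 0 keeps exactly the walks that end on the
  corresponding axis.\<close>

definition walk_poly :: "nat \<Rightarrow> complex \<Rightarrow> complex \<Rightarrow> complex" where
  "walk_poly k x y = (\<Sum>ws\<in>quadrant_walks k. x ^ nat (sum_list (map fst ws)) * y ^ nat (sum_list (map snd ws)))"

lemma finite_gessel_steps: "finite gessel_steps" "card gessel_steps = 4"
  by (auto simp: gessel_steps_def)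

lemma finite_quadrant_walks: "finite (quadrant_walks k)" "card (quadrant_walks k) \<le> 4 ^ k"
proof -
  have sub: "quadrant_walks k \<subseteq> {ws. set ws \<subseteq> gessel_steps \<and> length ws = k}"
    by (auto simp: quadrant_walks_def)
  have fin: "finite {ws. set ws \<subseteq> gessel_steps \<and> length ws = k}"
    by (rule finite_lists_length_eq[OF finite_gessel_steps(1)])
  show "finite (quadrant_walks k)" using sub fin finite_subset by blast
  have "card (quadrant_walks k) \<le> card {ws. set ws \<subseteq> gessel_steps \<and> length ws = k}"
    by (rule card_mono[OF fin sub])
  also have "\<dots> = 4 ^ k" using card_lists_length_eq[OF finite_gessel_steps(1)] finite_gessel_steps(2) by simp
  finally show "card (quadrant_walks k) \<le> 4 ^ k" .
qed

lemma quadrant_walks_nonneg: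
  assumes "ws \<in> quadrant_walks k"
  shows "0 \<le> sum_list (map fst ws)" "0 \<le> sum_list (map snd ws)"
  using assms by (auto simp: quadrant_walks_def dest: spec[of _ k])

lemma walk_poly_0: "walk_poly 0 x y = 1"
proof -
  have "quadrant_walks 0 = {[]}" by (auto simp: quadrant_walks_def)
  then show ?thesis by (simp add: walk_poly_def)
qed

lemma quadrant_walks_Suc:
  "quadrant_walks (Suc k) = (\<lambda>(ws, s). ws @ [s]) ` (SIGMA ws:quadrant_walks k.
     {s \<in> gessel_steps. 0 \<le> sum_list (map fst ws) + fst s \<and> 0 \<le> sum_list (map snd ws) + snd s})"
proof (intro set_eqI iffI)
  fix us assume us: "us \<in> quadrant_walks (Suc k)"
  then have "length us = Suc k" by (simp add: quadrant_walks_def)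
  then obtain ws s where us': "us = ws @ [s]" "length ws = k"
    by (metis append_butlast_last_id length_butlast diff_Suc_1 list.size(3) nat.distinct(1))
  have all: "\<forall>n\<le>Suc k. 0 \<le> sum_list (map fst (take n us)) \<and> 0 \<le> sum_list (map snd (take n us))"
    and st: "set us \<subseteq> gessel_steps" using us by (auto simp: quadrant_walks_def)
  have "ws \<in> quadrant_walks k"
    unfolding quadrant_walks_def
  proof safe
    fix n assume n: "n \<le> k"
    then have "take n us = take n ws" using us' by simp
    then show "0 \<le> sum_list (map fst (take n ws))" "0 \<le> sum_list (map snd (take n ws))"
      using all n by (metis le_SucI)+
  qed (use us' st in auto)
  moreover have "0 \<le> sum_list (map fst ws) + fst s \<and> 0 \<le> sum_list (map snd ws) + snd s" "s \<in> gessel_steps"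
    using all[rule_format, of "Suc k"] st us' by auto
  ultimately show "us \<in> (\<lambda>(ws, s). ws @ [s]) ` (SIGMA ws:quadrant_walks k.
     {s \<in> gessel_steps. 0 \<le> sum_list (map fst ws) + fst s \<and> 0 \<le> sum_list (map snd ws) + snd s})"
    using us'(1) by force
next
  fix us assume "us \<in> (\<lambda>(ws, s). ws @ [s]) ` (SIGMA ws:quadrant_walks k.
     {s \<in> gessel_steps. 0 \<le> sum_list (map fst ws) + fst s \<and> 0 \<le> sum_list (map snd ws) + snd s})"
  then obtain ws s where us: "us = ws @ [s]" and ws: "ws \<in> quadrant_walks k" and s: "s \<in> gessel_steps"
    "0 \<le> sum_list (map fst ws) + fst s" "0 \<le> sum_list (map snd ws) + snd s" by auto
  have l: "length ws = k" "set ws \<subseteq> gessel_steps" using ws by (auto simp: quadrant_walks_def)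
  show "us \<in> quadrant_walks (Suc k)"
    unfolding quadrant_walks_def
  proof safe
    fix n assume n: "n \<le> Suc k"
    have "0 \<le> sum_list (map fst (take n us)) \<and> 0 \<le> sum_list (map snd (take n us))"
    proof (cases "n = Suc k")
      case True
      then show ?thesis using s us l by auto
    next
      case False
      then have "n \<le> k" using n by simp
      then show ?thesis using ws us l by (auto simp: quadrant_walks_def)
    qed
    then show "0 \<le> sum_list (map fst (take n us))" "0 \<le> sum_list (map snd (take n us))" by auto
  qed (use us l s in auto)
qed

text \<open>Multiplied by xy, the four steps have weights y, x^2 y^2, x^2 y and 1. The subtracted
  terms are the steps leaving the quadrant: (-1,0) from i = 0, and (-1,-1) from i = 0 or j = 0,
  where the corner is counted twice and added back.\<close>

lemma walk_poly_Suc: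
  "x * y * walk_poly (Suc k) x y = (y + 1 + x^2 * y + x^2 * y^2) * walk_poly k x y
     - (y + 1) * walk_poly k 0 y - walk_poly k x 0 + walk_poly k 0 0"
proof -
  define X where "X = (\<lambda>ws::(int \<times> int) list. sum_list (map fst ws))"
  define Y where "Y = (\<lambda>ws::(int \<times> int) list. sum_list (map snd ws))"
  define A where "A = (\<lambda>ws. {s \<in> gessel_steps. 0 \<le> X ws + fst s \<and> 0 \<le> Y ws + snd s})"
  have finA: "finite (A ws)" for ws unfolding A_def using finite_gessel_steps by simp
  have "walk_poly (Suc k) x y = (\<Sum>(ws,s)\<in>(SIGMA ws:quadrant_walks k. A ws). x ^ nat (X ws + fst s) * y ^ nat (Y ws + snd s))"
    unfolding walk_poly_def quadrant_walks_Suc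
    by (subst sum.reindex) (auto simp: inj_on_def A_def X_def Y_def intro!: sum.cong)
  also have "\<dots> = (\<Sum>ws\<in>quadrant_walks k. \<Sum>s\<in>A ws. x ^ nat (X ws + fst s) * y ^ nat (Y ws + snd s))"
    using finA finite_quadrant_walks by (subst sum.Sigma) auto
  finally have "x * y * walk_poly (Suc k) x y = (\<Sum>ws\<in>quadrant_walks k. x * y * (\<Sum>s\<in>A ws. x ^ nat (X ws + fst s) * y ^ nat (Y ws + snd s)))"
    by (simp add: sum_distrib_left)
  also have "\<dots> = (\<Sum>ws\<in>quadrant_walks k. (y + 1 + x^2 * y + x^2 * y^2) * (x ^ nat (X ws) * y ^ nat (Y ws))
     - (y + 1) * (0 ^ nat (X ws) * y ^ nat (Y ws)) - x ^ nat (X ws) * 0 ^ nat (Y ws) + 0 ^ nat (X ws) * 0 ^ nat (Y ws))"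
  proof (rule sum.cong[OF refl])
    fix ws assume ws: "ws \<in> quadrant_walks k"
    obtain i j where ij: "X ws = int i" "Y ws = int j"
      using quadrant_walks_nonneg[OF ws] by (metis X_def Y_def nonneg_int_cases)
    have "(\<Sum>s\<in>A ws. x ^ nat (X ws + fst s) * y ^ nat (Y ws + snd s)) =
      (\<Sum>s\<in>gessel_steps. if 0 \<le> int i + fst s \<and> 0 \<le> int j + snd s then x ^ nat (int i + fst s) * y ^ nat (int j + snd s) else 0)"
      unfolding A_def ij using finite_gessel_steps by (subst sum.inter_filter) auto
    also have "\<dots> = (if i \<ge> 1 then x ^ (i-1) * y ^ j else 0) + x ^ (i+1) * y ^ (j+1) + x ^ (i+1) * y ^ j
        + (if i \<ge> 1 \<and> j \<ge> 1 then x ^ (i-1) * y ^ (j-1) else 0)"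
      by (auto simp: gessel_steps_def nat_add_distrib nat_diff_distrib)
    finally have s: "(\<Sum>s\<in>A ws. x ^ nat (X ws + fst s) * y ^ nat (Y ws + snd s)) = \<dots>" .
    show "x * y * (\<Sum>s\<in>A ws. x ^ nat (X ws + fst s) * y ^ nat (Y ws + snd s)) =
       (y + 1 + x^2 * y + x^2 * y^2) * (x ^ nat (X ws) * y ^ nat (Y ws))
     - (y + 1) * (0 ^ nat (X ws) * y ^ nat (Y ws)) - x ^ nat (X ws) * 0 ^ nat (Y ws) + 0 ^ nat (X ws) * 0 ^ nat (Y ws)"
      unfolding s unfolding ij nat_int by (cases i; cases j) (simp_all add: algebra_simps power2_eq_square)
  qed
  also have "\<dots> = (y + 1 + x^2 * y + x^2 * y^2) * walk_poly k x y
     - (y + 1) * walk_poly k 0 y - walk_poly k x 0 + walk_poly k 0 0"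
    unfolding walk_poly_def X_def Y_def by (simp add: sum.distrib sum_subtractf sum_distrib_left)
  finally show ?thesis .
qed

text \<open>\<open>Q\<close> is an unordered sum over all triples. Grouping it by length is
  justified by absolute summability: there are at most 4^k walks of length k, so the terms of length
  k have total modulus at most (4z)^k.\<close>

lemma Q_sums:
  assumes z: "0 \<le> z" "z < 1/4" and xy: "norm x \<le> 1" "norm y \<le> 1"
  shows "(\<lambda>k. of_real z ^ k * walk_poly k x y) sums Q x y z"
proof -
  define W where "W = (\<lambda>k. {..k} \<times> {..k::nat})"
  have fiber: "gessel_walks i j k = {ws \<in> quadrant_walks k. sum_list (map fst ws) = int i \<and> sum_list (map snd ws) = int j}" for i j k
    by (auto simp: gessel_walks_def quadrant_walks_def)
  have bound: "sum_list (map fst ws) \<le> int k" "sum_list (map snd ws) \<le> int k" if "ws \<in> quadrant_walks k" for ws k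
  proof -
    have "length ws = k" "set ws \<subseteq> gessel_steps" using that by (auto simp: quadrant_walks_def)
    then show "sum_list (map fst ws) \<le> int k" "sum_list (map snd ws) \<le> int k"
      by (induction ws arbitrary: k) (auto simp: gessel_steps_def)
  qed
  have q0: "q i j k = 0" if "(i, j) \<notin> W k" for i j k
  proof -
    have "gessel_walks i j k = {}" using bound that by (force simp: fiber W_def)
    then show ?thesis by (simp add: q_def)
  qed
  have poly: "(\<Sum>(i,j)\<in>W k. of_nat (q i j k) * u ^ i * v ^ j) = walk_poly k u v" for k u v
  proof -
    define g where "g = (\<lambda>ws::(int \<times> int) list. (nat (sum_list (map fst ws)), nat (sum_list (map snd ws))))"
    have gW: "g ` quadrant_walks k \<subseteq> W k" using bound by (auto simp: g_def W_def nat_le_iff)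
    have "walk_poly k u v = (\<Sum>ws\<in>quadrant_walks k. u ^ fst (g ws) * v ^ snd (g ws))"
      by (simp add: walk_poly_def g_def)
    also have "\<dots> = (\<Sum>p\<in>W k. \<Sum>ws\<in>{ws \<in> quadrant_walks k. g ws = p}. u ^ fst (g ws) * v ^ snd (g ws))"
      by (rule sum.group[symmetric]) (use gW finite_quadrant_walks in \<open>auto simp: W_def\<close>)
    also have "\<dots> = (\<Sum>(i,j)\<in>W k. of_nat (q i j k) * u ^ i * v ^ j)"
    proof (rule sum.cong[OF refl])
      fix p assume "p \<in> W k"
      obtain i j where p: "p = (i, j)" by force
      have eq: "{ws \<in> quadrant_walks k. g ws = p} = gessel_walks i j k"
        using quadrant_walks_nonneg by (auto simp: fiber g_def p)
      have "(\<Sum>ws\<in>{ws \<in> quadrant_walks k. g ws = p}. u ^ fst (g ws) * v ^ snd (g ws)) =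
         (\<Sum>ws\<in>gessel_walks i j k. u ^ i * v ^ j)"
        unfolding eq[symmetric] by (rule sum.cong) (auto simp: p)
      then show "(\<Sum>ws\<in>{ws \<in> quadrant_walks k. g ws = p}. u ^ fst (g ws) * v ^ snd (g ws)) =
        (case p of (i,j) \<Rightarrow> of_nat (q i j k) * u ^ i * v ^ j)"
        by (simp add: p q_def)
    qed
    finally show ?thesis by simp
  qed
  define F where "F = (\<lambda>(k, i, j). of_nat (q i j k) * x ^ i * y ^ j * of_real z ^ k :: complex)"
  have Fsum: "((\<lambda>ij. F (k, ij)) has_sum of_real z ^ k * walk_poly k x y) UNIV" for k
  proof (rule has_sum_finite_neutralI[of "W k"])
    show "of_real z ^ k * walk_poly k x y = (\<Sum>ij\<in>W k. F (k, ij))"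
      by (simp add: poly[symmetric] F_def sum_distrib_left case_prod_unfold mult_ac)
    show "F (k, ij) = 0" if "ij \<in> UNIV - W k" for ij
      using q0[of "fst ij" "snd ij" k] that by (simp add: F_def case_prod_unfold)
  qed (auto simp: W_def)
  define N where "N = (\<lambda>k. \<Sum>ij\<in>W k. norm (F (k, ij)))"
  have Nsum: "((\<lambda>ij. norm (F (k, ij))) has_sum N k) UNIV" for k
    unfolding N_def
  proof (rule has_sum_finite_neutralI[of "W k"])
    show "norm (F (k, ij)) = 0" if "ij \<in> UNIV - W k" for ij
      using q0[of "fst ij" "snd ij" k] that by (simp add: F_def case_prod_unfold)
  qed (auto simp: W_def)
  have Nle: "N k \<le> (4*z) ^ k" for k
  proof -
    have "N k \<le> (\<Sum>(i,j)\<in>W k. real (q i j k) * z ^ k)"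
      unfolding N_def
    proof (rule sum_mono)
      fix ij assume "ij \<in> W k"
      obtain i j where ij: "ij = (i,j)" by force
      have "norm x ^ i * norm y ^ j \<le> 1 * 1"
        using xy by (intro mult_mono power_le_one) auto
      then have "(real (q i j k) * z ^ k) * (norm x ^ i * norm y ^ j) \<le> (real (q i j k) * z ^ k) * 1"
        using z by (intro mult_left_mono) auto
      then show "norm (F (k, ij)) \<le> (case ij of (i,j) \<Rightarrow> real (q i j k) * z ^ k)"
        using z by (simp add: F_def ij norm_mult norm_power mult_ac)
    qed
    also have "\<dots> = z ^ k * (\<Sum>(i,j)\<in>W k. real (q i j k))"
      by (simp add: sum_distrib_left case_prod_unfold mult_ac)
    also have "(\<Sum>(i,j)\<in>W k. real (q i j k)) = real (card (quadrant_walks k))"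
    proof -
      \<comment> \<open>At x = y = 1 the polynomial counts walks.\<close>
      have "complex_of_real (\<Sum>(i,j)\<in>W k. real (q i j k)) = walk_poly k 1 1"
        by (simp add: poly[symmetric] case_prod_unfold)
      also have "\<dots> = complex_of_real (real (card (quadrant_walks k)))" by (simp add: walk_poly_def)
      finally show ?thesis using of_real_eq_iff by blast
    qed
    also have "z ^ k * real (card (quadrant_walks k)) \<le> z ^ k * 4 ^ k"
      using finite_quadrant_walks(2)[of k] z by (intro mult_left_mono) (auto simp: numeral_power_le_of_nat_cancel_iff of_nat_le_numeral_power_cancel_iff)
    finally show ?thesis by (simp add: power_mult_distrib mult.commute)
  qed
  have N0: "N k \<ge> 0" for k unfolding N_def by (intro sum_nonneg) auto
  have "summable (\<lambda>k. (4*z) ^ k)" using z by (intro summable_geometric) auto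
  then have "summable N"
    by (rule summable_comparison_test') (use Nle N0 in auto)
  then have "N summable_on UNIV" using N0 by (rule summable_nonneg_imp_summable_on)
  then have "(N has_sum infsum N UNIV) UNIV" by simp
  then have "(\<lambda>p. norm (F p)) summable_on (UNIV \<times> UNIV)"
    using Nsum N0 by (intro summable_on_SigmaI[where g = N]) (auto simp: has_sum_imp_summable)
  then have "F summable_on (UNIV \<times> UNIV)" by (rule abs_summable_summable)
  then have "(F has_sum infsum F (UNIV \<times> UNIV)) (UNIV \<times> UNIV)" by simp
  then have "((\<lambda>k. of_real z ^ k * walk_poly k x y) has_sum infsum F (UNIV \<times> UNIV)) UNIV"
    by (rule has_sum_SigmaD) (use Fsum in auto)
  moreover have "infsum F (UNIV \<times> UNIV) = Q x y z"
    unfolding Q_def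
    by (rule infsum_reindex_bij_witness[of _ "\<lambda>(i,j,k). (k,i,j)" "\<lambda>(k,i,j). (i,j,k)"]) (auto simp: F_def)
  ultimately show ?thesis using has_sum_imp_sums by simp
qed

text \<open>The polynomial in the recursion is (y + 1)(1 + x^2 y), so after summation assumption K
  makes the two terms with Q(x,y,z) cancel, leaving only boundary series.\<close>

theorem kernel_functional_equation:
  assumes z: "0 < z" "z < 1/4" and xy: "norm x \<le> 1" "norm y \<le> 1"
    and K: "of_real z * (y + 1) * (1 + x^2 * y) = x * y"
  shows "of_real z * Q x 0 z + of_real z * (y + 1) * Q 0 y z - of_real z * Q 0 0 z = x * y"
proof -
  have z': "0 \<le> z" using z by simp
  note S = Q_sums[OF z' z(2)]
  have "(\<lambda>k. of_real z ^ Suc k * walk_poly (Suc k) x y) sums (Q x y z - 1)"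
    using S[OF xy] by (subst sums_Suc_iff) (simp add: walk_poly_0)
  then have a: "(\<lambda>k. x * y * (of_real z ^ Suc k * walk_poly (Suc k) x y)) sums (x * y * (Q x y z - 1))"
    by (rule sums_mult)
  have e: "x * y * (of_real z ^ Suc k * walk_poly (Suc k) x y) =
     of_real z * ((y + 1 + x^2 * y + x^2 * y^2) * (of_real z ^ k * walk_poly k x y)
      - (y + 1) * (of_real z ^ k * walk_poly k 0 y) - of_real z ^ k * walk_poly k x 0 + of_real z ^ k * walk_poly k 0 0)" for k
  proof -
    have "x * y * (of_real z ^ Suc k * walk_poly (Suc k) x y) = of_real z * of_real z ^ k * (x * y * walk_poly (Suc k) x y)"
      by (simp add: mult_ac)
    then show ?thesis unfolding walk_poly_Suc by (simp add: algebra_simps)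
  qed
  have "(\<lambda>k. of_real z * ((y + 1 + x^2 * y + x^2 * y^2) * (of_real z ^ k * walk_poly k x y)
      - (y + 1) * (of_real z ^ k * walk_poly k 0 y) - of_real z ^ k * walk_poly k x 0 + of_real z ^ k * walk_poly k 0 0)) sums
      (of_real z * ((y + 1 + x^2 * y + x^2 * y^2) * Q x y z - (y + 1) * Q 0 y z - Q x 0 z + Q 0 0 z))"
    using xy by (intro sums_mult sums_add sums_diff S) auto
  with a have "x * y * (Q x y z - 1) = of_real z * ((y + 1 + x^2 * y + x^2 * y^2) * Q x y z - (y + 1) * Q 0 y z - Q x 0 z + Q 0 0 z)"
    unfolding e by (rule sums_unique2)
  moreover have "of_real z * ((y + 1 + x^2 * y + x^2 * y^2) * Q x y z) = x * y * Q x y z"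
    unfolding K[symmetric] by (simp add: algebra_simps power2_eq_square)
  ultimately show ?thesis by (simp add: algebra_simps)
qed

section \<open>Small roots and starlike domains\<close>

lemma Re_csqrt_pos: "\<omega> \<notin> \<real>\<^sub>\<le>\<^sub>0 \<Longrightarrow> 0 < Re (csqrt \<omega>)"
proof -
  assume \<omega>: "\<omega> \<notin> \<real>\<^sub>\<le>\<^sub>0"
  have "Re (csqrt \<omega>) \<noteq> 0"
  proof
    assume "Re (csqrt \<omega>) = 0"
    then have "csqrt \<omega> = \<i> * of_real (Im (csqrt \<omega>))" by (simp add: complex_eq_iff)
    then have "(csqrt \<omega>)^2 = - of_real ((Im (csqrt \<omega>))^2)" by (metis of_real_power power_mult_distrib power2_i mult_minus1)
    then have "\<omega> = of_real (- ((Im (csqrt \<omega>))^2))" by simp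
    then show False using \<omega> by (metis neg_le_0_iff_le nonpos_Reals_of_real_iff zero_le_power2)
  qed
  then show ?thesis using Re_csqrt[of \<omega>] by linarith
qed

lemma csqrt_not_minus_one: "1 + csqrt \<omega> \<noteq> 0"
proof
  assume "1 + csqrt \<omega> = 0"
  then have "Re (1 + csqrt \<omega>) = Re 0" by (rule arg_cong)
  then have "1 + Re (csqrt \<omega>) = 0" by (simp only: plus_complex.sel one_complex.sel zero_complex.sel)
  then show False using Re_csqrt[of \<omega>] by linarith
qed

lemma cut_sqrt_power2:
  assumes "\<alpha> < \<beta>" "x \<noteq> of_real ((\<alpha>+\<beta>)/2)"
  shows "(cut_sqrt \<alpha> \<beta> x)^2 = (x - of_real \<alpha>) * (x - of_real \<beta>)"
proof -
  define m r where "m = complex_of_real ((\<alpha>+\<beta>)/2)" and "r = complex_of_real ((\<beta>-\<alpha>)/2)"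
  have xm: "x - m \<noteq> 0" using assms by (simp add: m_def)
  have "(cut_sqrt \<alpha> \<beta> x)^2 = (x - m)^2 * (1 - (r / (x - m))^2)"
    unfolding cut_sqrt_def m_def[symmetric] r_def[symmetric] power_mult_distrib by simp
  also have "\<dots> = (x - m)^2 - r^2" using xm by (simp add: field_simps)
  also have "\<dots> = (x - (m - r)) * (x - (m + r))" by (simp add: algebra_simps power2_eq_square)
  moreover have "m - r = of_real \<alpha>" "m + r = of_real \<beta>"
    unfolding m_def r_def of_real_diff[symmetric] of_real_add[symmetric] of_real_eq_iff by (simp_all add: field_simps)
  ultimately show ?thesis by simp
qed

text \<open>If 1 - (r/(x - m))^2 were a real k \<le> 0, then (x - m)^2 = r^2/(1 - k), so x - m would
  be real of modulus at most r and x on the slit.\<close>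

lemma not_in_segment_cut_sqrt:
  assumes "\<alpha> < \<beta>" "x \<notin> closed_segment (of_real \<alpha>) (of_real \<beta>)"
  shows "x \<noteq> of_real ((\<alpha>+\<beta>)/2)" "1 - (of_real ((\<beta>-\<alpha>)/2) / (x - of_real ((\<alpha>+\<beta>)/2)))^2 \<notin> \<real>\<^sub>\<le>\<^sub>0"
    "cut_sqrt \<alpha> \<beta> x \<noteq> 0"
proof -
  obtain s where s: "1 \<le> norm s" "joukowski \<alpha> \<beta> s = x" using joukowski_surj[OF assms(1)] .
  then have s1: "1 < norm s" using joukowski_unit_circle[OF assms(1), of s] assms(2) by (cases "norm s = 1") auto
  show m: "x \<noteq> of_real ((\<alpha>+\<beta>)/2)"
  proof
    assume "x = of_real ((\<alpha>+\<beta>)/2)"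
    moreover have "(\<alpha>+\<beta>)/2 \<in> closed_segment \<alpha> \<beta>" using assms(1) by (auto simp: closed_segment_eq_real_ivl)
    ultimately show False using assms(2) by (metis closed_segment_of_real image_eqI)
  qed
  have s0: "s \<noteq> 0" using s1 by auto
  have "s - inverse s \<noteq> 0"
  proof
    assume "s - inverse s = 0"
    then have "norm s = norm (inverse s)" by simp
    then show False using s1 by (simp add: norm_inverse) (metis inverse_less_1_iff less_asym)
  qed
  then show nz: "cut_sqrt \<alpha> \<beta> x \<noteq> 0"
    using cut_sqrt_joukowski[OF assms(1) s1] assms(1) s(2) by auto
  define m r where "m = (\<alpha>+\<beta>)/2" and "r = (\<beta>-\<alpha>)/2"
  have r: "r > 0" using assms by (simp add: r_def)
  show "1 - (of_real ((\<beta>-\<alpha>)/2) / (x - of_real ((\<alpha>+\<beta>)/2)))^2 \<notin> \<real>\<^sub>\<le>\<^sub>0"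
    unfolding m_def[symmetric] r_def[symmetric]
  proof
    assume "1 - (of_real r / (x - of_real m))^2 \<in> \<real>\<^sub>\<le>\<^sub>0"
    then obtain k where k: "1 - (of_real r / (x - of_real m))^2 = of_real k" "k \<le> 0" by (auto elim: nonpos_Reals_cases)
    have xm: "x - of_real m \<noteq> 0" using m by (simp add: m_def)
    have "(of_real r / (x - of_real m))^2 = complex_of_real (1 - k)" using k(1) by (simp add: algebra_simps)
    then have "(of_real r)^2 = complex_of_real (1 - k) * (x - of_real m)^2" using xm by (simp add: field_simps)
    then have "(x - of_real m)^2 = complex_of_real (r^2 / (1 - k))" using k(2) by (simp add: field_simps)
    also have "\<dots> = (complex_of_real (r / sqrt (1-k)))^2" using k(2) by (simp add: power_divide flip: of_real_power)
    finally have "x - of_real m = of_real (r / sqrt (1-k)) \<or> x - of_real m = - of_real (r / sqrt (1-k))"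
      by (simp only: power2_eq_iff)
    then have x: "x = of_real (m + r / sqrt (1-k)) \<or> x = of_real (m - r / sqrt (1-k))" by (auto simp: algebra_simps)
    have "1 \<le> sqrt (1 - k)" using k(2) by simp
    then have "0 \<le> r / sqrt (1-k)" "r / sqrt (1-k) \<le> r" using r by (auto simp: field_simps)
    moreover have "m - r = \<alpha>" "m + r = \<beta>" by (auto simp: m_def r_def field_simps)
    ultimately have "m + r / sqrt (1-k) \<in> closed_segment \<alpha> \<beta>" "m - r / sqrt (1-k) \<in> closed_segment \<alpha> \<beta>"
      using assms(1) r by (auto simp: closed_segment_eq_real_ivl)
    then have "x \<in> closed_segment (of_real \<alpha>) (of_real \<beta>)" using x by (metis closed_segment_of_real image_eqI)
    then show False using assms(2) by simp
  qed
qed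

lemma continuous_on_cut_sqrt:
  assumes "\<alpha> < \<beta>" "T \<inter> closed_segment (of_real \<alpha>) (of_real \<beta>) = {}"
  shows "continuous_on T (cut_sqrt \<alpha> \<beta>)"
proof -
  have ne: "x - of_real ((\<alpha>+\<beta>)/2) \<noteq> 0" "1 - (of_real ((\<beta>-\<alpha>)/2) / (x - of_real ((\<alpha>+\<beta>)/2)))^2 \<notin> \<real>\<^sub>\<le>\<^sub>0" if "x \<in> T" for x
    using not_in_segment_cut_sqrt[OF assms(1), of x] assms(2) that by auto
  show ?thesis
  proof (rule continuous_at_imp_continuous_on, rule ballI)
    fix x assume x: "x \<in> T"
    have "isCont (\<lambda>x. 1 - (of_real ((\<beta>-\<alpha>)/2) / (x - of_real ((\<alpha>+\<beta>)/2)))^2) x"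
      using ne(1)[OF x] by (intro continuous_intros) auto
    from isCont_o2[OF this continuous_at_csqrt[OF ne(2)[OF x]]]
    show "isCont (cut_sqrt \<alpha> \<beta>) x"
      unfolding cut_sqrt_def[abs_def] by (intro continuous_intros)
  qed
qed

text \<open>The negative sign, coming from the factor x - m, is what later decides between the two
  square roots.\<close>

lemma cut_sqrt_left:
  assumes "\<alpha> < \<beta>" "t < \<alpha>"
  shows "cut_sqrt \<alpha> \<beta> (of_real t) = - of_real (sqrt ((\<alpha>-t)*(\<beta>-t)))"
proof -
  define m r where "m = (\<alpha>+\<beta>)/2" and "r = (\<beta>-\<alpha>)/2"
  have tm: "t - m < 0" and r: "r > 0" and rm: "r < m - t" using assms by (auto simp: m_def r_def field_simps)
  have "r^2 \<le> (m-t)^2" using r rm by (intro power_mono) auto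
  then have "(r / (t-m))^2 \<le> 1" by (simp add: power_divide power2_commute[of m t] divide_le_eq_1)
  then have nn: "0 \<le> 1 - (r / (t-m))^2" by simp
  have "complex_of_real r / (of_real t - of_real m) = of_real (r / (t-m))" by simp
  then have "1 - (of_real r / (of_real t - of_real m))^2 = complex_of_real (1 - (r/(t-m))^2)"
    by (metis of_real_1 of_real_diff of_real_power)
  then have "cut_sqrt \<alpha> \<beta> (of_real t) = of_real (t - m) * of_real (sqrt (1 - (r/(t-m))^2))"
    unfolding cut_sqrt_def m_def[symmetric] r_def[symmetric] using nn by (simp add: csqrt_of_real_nonneg)
  also have "\<dots> = - of_real (sqrt ((m-t)^2) * sqrt (1 - (r/(t-m))^2))" using tm by (simp add: algebra_simps)
  also have "sqrt ((m-t)^2) * sqrt (1 - (r/(t-m))^2) = sqrt ((\<alpha>-t)*(\<beta>-t))"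
  proof -
    have "(r/(t-m))^2 * (m-t)^2 = r^2" using tm by (simp add: power_divide power2_commute[of m t])
    then have "(m-t)^2 * (1 - (r/(t-m))^2) = (m-t)^2 - r^2" by (simp add: algebra_simps)
    also have "\<dots> = (\<alpha>-t)*(\<beta>-t)" by (simp add: m_def r_def field_simps power2_eq_square)
    finally show ?thesis by (simp only: real_sqrt_mult[symmetric])
  qed
  finally show ?thesis .
qed

text \<open>The quotient f/g is continuous and takes only the values 1 and -1, hence is constant on
  a connected set.\<close>

lemma connected_same_square_imp_eq:
  fixes f g :: "complex \<Rightarrow> complex"
  assumes T: "connected T" "continuous_on T f" "continuous_on T g" and sq: "\<And>x. x \<in> T \<Longrightarrow> (f x)^2 = (g x)^2"
    and ne: "\<And>x. x \<in> T \<Longrightarrow> g x \<noteq> 0" and p: "p \<in> T" "f p = g p" and x: "x \<in> T"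
  shows "f x = g x"
proof -
  have "continuous_on T (\<lambda>x. f x / g x)" using T ne by (intro continuous_intros) auto
  moreover have r: "f x / g x = 1 \<or> f x / g x = -1" if "x \<in> T" for x
    using sq[OF that] ne[OF that] by (auto simp: power2_eq_iff)
  then have "(\<lambda>x. f x / g x) ` T \<subseteq> {1, -1}" by blast
  then have "finite ((\<lambda>x. f x / g x) ` T)" by (rule finite_subset) auto
  ultimately have "(\<lambda>x. f x / g x) constant_on T" using T(1) continuous_finite_range_constant by blast
  then have "f x / g x = f p / g p" using x p(1) by (auto simp: constant_on_def)
  then show ?thesis using p ne x by (auto simp: field_simps)
qed

text \<open>Removing the whole ray to the right of \<alpha> instead of the slit leaves a set
  starlike about a point to the left of \<alpha>. The points put back are limits of that set, and
  sets between a connected set and its closure are connected.\<close>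

lemma connected_strip_minus_segment:
  assumes "a < \<alpha>" "\<alpha> < b" and le: "\<alpha> \<le> \<beta>"
  shows "connected ({x. a < Re x \<and> Re x < b} - closed_segment (of_real \<alpha>) (of_real \<beta>))"
proof -
  define U where "U = {x. a < Re x \<and> Re x < b}"
  define A where "A = {x \<in> U. Im x = 0 \<longrightarrow> Re x < \<alpha>}"
  define p where "p = (a + \<alpha>) / 2"
  have pa: "a < p" "p < \<alpha>" using assms by (auto simp: p_def)
  have pA: "of_real p \<in> A" using pa assms by (auto simp: A_def U_def)
  have "starlike A"
    unfolding starlike_def
  proof (intro bexI[of _ "of_real p"] ballI subsetI)
    fix x y assume x: "x \<in> A" and "y \<in> closed_segment (of_real p) x"
    then obtain u where u: "0 \<le> u" "u \<le> 1" "y = (1-u) *\<^sub>R of_real p + u *\<^sub>R x" by (auto simp: in_segment)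
    have Im: "Im y = u * Im x" and Re: "Re y = (1-u) * p + u * Re x" using u by auto
    have x': "a < Re x" "Re x < b" using x by (auto simp: A_def U_def)
    have conv: "c < (1-u) * c1 + u * c2" if "c < c1" "c < c2" for c c1 c2 :: real
      using convex_bound_lt[of "-c1" "-c" "-c2" "1-u" u] that u by (auto simp: algebra_simps)
    have conv': "(1-u) * c1 + u * c2 < c" if "c1 < c" "c2 < c" for c c1 c2 :: real
      using convex_bound_lt[of c1 c c2 "1-u" u] that u by auto
    have "Re y < \<alpha>" if "Im y = 0"
    proof (cases "u = 0")
      case False
      then have "Re x < \<alpha>" using that Im x by (auto simp: A_def)
      then show ?thesis unfolding Re using pa by (intro conv') auto
    qed (use Re pa in auto)
    moreover have "a < Re y" "Re y < b" unfolding Re using x' pa assms by (intro conv conv'; simp)+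
    ultimately show "y \<in> A" by (auto simp: A_def U_def)
  qed (use pA in auto)
  then have "connected A" by (rule starlike_imp_connected)
  moreover have seg: "closed_segment (complex_of_real \<alpha>) (of_real \<beta>) = of_real ` {\<alpha>..\<beta>}"
    using le by (simp add: closed_segment_of_real closed_segment_eq_real_ivl)
  have "A \<subseteq> U - closed_segment (of_real \<alpha>) (of_real \<beta>)" unfolding seg by (auto simp: A_def)
  moreover have "U - closed_segment (of_real \<alpha>) (of_real \<beta>) \<subseteq> closure A"
  proof
    fix x assume "x \<in> U - closed_segment (of_real \<alpha>) (of_real \<beta>)"
    then have xU: "x \<in> U" by simp
    show "x \<in> closure A"
    proof (cases "x \<in> A")
      case True then show ?thesis using closure_subset by blast
    next
      case False
      then have im: "Im x = 0" using xU by (auto simp: A_def)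
      show ?thesis
        unfolding closure_approachable
      proof safe
        fix e :: real assume e: "e > 0"
        have "x + \<i> * of_real (e/2) \<in> A" using xU im e by (auto simp: A_def U_def)
        moreover have "dist (x + \<i> * of_real (e/2)) x < e" using e by (simp add: dist_norm norm_mult)
        ultimately show "\<exists>y\<in>A. dist y x < e" by blast
      qed
    qed
  qed
  ultimately show ?thesis using connected_intermediate_closure unfolding U_def by blast
qed

text \<open>Off the positive axis the exterior is the image under exp of a convex half-strip;
  whatever part of the axis belongs to T lies in the closure of this image. One lemma thus serves
  the bounded cut of the x-plane and the unbounded one of the y-plane.\<close>

lemma connected_exterior_minus_positive_reals:
  assumes T: "T \<subseteq> - cball 0 1" "\<And>x. 1 < norm x \<Longrightarrow> Im x \<noteq> 0 \<or> Re x < 0 \<Longrightarrow> x \<in> T"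
  shows "connected (T::complex set)"
proof (rule connected_intermediate_closure)
  define A where "A = exp ` {w::complex. 0 < Re w \<and> 0 < Im w \<and> Im w < 2 * pi}"
  have "convex {w::complex. 0 < Re w \<and> 0 < Im w \<and> Im w < 2 * pi}"
    unfolding Collect_conj_eq
    by (intro convex_Int convex_halfspace_Re_gt convex_halfspace_Im_gt convex_halfspace_Im_lt)
  then show conA: "connected A" unfolding A_def
    by (intro connected_continuous_image continuous_intros convex_connected)
  have A: "x \<in> A" if x: "1 < norm x" "Im x \<noteq> 0 \<or> Re x < 0" for x
  proof -
    have "x \<noteq> 0" using x by auto
    define w where "w = of_real (ln (norm x)) + \<i> * of_real (Arg2pi x)"
    have "exp w = x" using \<open>x \<noteq> 0\<close> Arg2pi_eq[of x] by (simp add: w_def exp_add exp_of_real)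
    moreover have "0 < ln (norm x)" using x(1) by (rule ln_gt_zero)
    moreover have "Arg2pi x \<noteq> 0"
    proof
      assume "Arg2pi x = 0"
      then have "x \<in> \<real> \<and> 0 \<le> Re x" using Arg2pi_eq_0 by blast
      then show False using x by (auto elim: Reals_cases)
    qed
    then have "0 < Arg2pi x" using Arg2pi_ge_0[of x] by linarith
    ultimately show ?thesis unfolding A_def using Arg2pi_lt_2pi[of x]
      by (intro image_eqI[of _ _ w]) (auto simp: w_def)
  qed
  show "A \<subseteq> T"
  proof
    fix x assume "x \<in> A"
    then obtain w where w: "x = exp w" "0 < Re w" "0 < Im w" "Im w < 2 * pi" by (auto simp: A_def)
    have n: "1 < norm x" using w by simp
    have "Im x \<noteq> 0 \<or> Re x < 0"
    proof (rule ccontr)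
      assume "\<not> ?thesis"
      then have "sin (Im w) = 0" "0 \<le> exp (Re w) * cos (Im w)" using w by (auto simp: Re_exp Im_exp)
      then have "sin (Im w) = 0" "0 \<le> cos (Im w)" by (auto simp: zero_le_mult_iff)
      then have "cos (Im w) = 1" using sin_cos_squared_add[of "Im w"] by (auto simp: power2_eq_1_iff)
      then obtain n :: int where n: "Im w = of_int n * 2 * pi" using cos_one_2pi_int by metis
      then have "0 < real_of_int n" "real_of_int n < 1" using w pi_gt_zero by (auto simp: zero_less_mult_iff)
      then have "0 < n" "n < 1" by simp_all
      then show False by linarith
    qed
    then show "x \<in> T" using T n by blast
  qed
  show "T \<subseteq> closure A"
  proof
    fix x assume "x \<in> T"
    then have x: "1 < norm x" using T by (auto simp: subset_iff)
    show "x \<in> closure A"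
    proof (cases "Im x = 0")
      case False then show ?thesis using A x closure_subset by blast
    next
      case True
      show ?thesis unfolding closure_approachable
      proof safe
        fix e :: real assume e: "e > 0"
        have "norm x \<le> norm (x + \<i> * of_real (e/2))" using True by (simp add: cmod_def)
        then have "x + \<i> * of_real (e/2) \<in> A" using x True e by (intro A) auto
        moreover have "dist (x + \<i> * of_real (e/2)) x < e" using e by (simp add: dist_norm norm_mult)
        ultimately show "\<exists>y\<in>A. dist y x < e" by blast
      qed
    qed
  qed
qed

text \<open>The third assumption on \<psi> says that shrinking an exterior point of {\<psi> \<le> 0}
  lands in {\<psi> < 0} while it stays outside the disc. Hence L is starlike about 0 and touches
  \<Gamma> only as its frontier, which no connected subset of the complement of \<Gamma> can
  cross.\<close>

lemma starlike_component:
  fixes \<psi> :: "complex \<Rightarrow> real"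
  assumes \<psi>: "continuous_on UNIV \<psi>" "\<And>x. norm x = 1 \<Longrightarrow> \<psi> x < 0"
    "\<And>x s. 1 < s * norm x \<Longrightarrow> 0 < s \<Longrightarrow> s < 1 \<Longrightarrow> \<psi> x \<le> 0 \<Longrightarrow> \<psi> (of_real s * x) < 0"
    and p: "p \<in> ball 0 1"
  defines "\<Gamma> \<equiv> {x. 1 < norm x \<and> \<psi> x = 0}" and "L \<equiv> {x. norm x \<le> 1 \<or> \<psi> x < 0}"
  shows "connected_component_set (- \<Gamma>) p = L" "open L" "closure L = L \<union> \<Gamma>" "frontier L = \<Gamma>"
    "\<And>t. t \<in> \<Gamma> \<Longrightarrow> t islimpt \<Gamma>"
proof -
  have L_alt: "L = ball 0 1 \<union> {x. \<psi> x < 0}" using \<psi>(2) by (force simp: L_def)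
  have opc: "open {x. \<psi> x < 0}" "open {x. \<psi> x > 0}" "closed {x. \<psi> x \<le> 0}"
    using \<psi>(1) by (auto intro: open_Collect_less closed_Collect_le continuous_intros)
  show opL: "open L" unfolding L_alt using opc by auto
  have shrink: "of_real s * x \<in> L" if "0 \<le> s" "s < 1" "norm x \<le> 1 \<or> \<psi> x \<le> 0" for s x
  proof (cases "s * norm x \<le> 1")
    case True then show ?thesis using that by (simp add: L_def norm_mult)
  next
    case False
    then have "s > 0" using that by (cases "s = 0") auto
    moreover have "norm x > 1"
    proof (rule ccontr)
      assume "\<not> ?thesis"
      then have "s * norm x \<le> 1 * 1" using that by (intro mult_mono) auto
      then show False using False by simp
    qed
    ultimately show ?thesis using \<psi>(3)[of s x] that False by (auto simp: L_def)
  qed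
  have "starlike L"
    unfolding starlike_def
  proof (intro bexI[of _ 0] ballI subsetI)
    fix x y assume x: "x \<in> L" and "y \<in> closed_segment 0 x"
    then obtain u where u: "0 \<le> u" "u \<le> 1" "y = of_real u * x" by (auto simp: in_segment scaleR_conv_of_real)
    then show "y \<in> L" using shrink[of u x] x by (cases "u = 1") (auto simp: L_def)
  qed (auto simp: L_def)
  then have conL: "connected L" by (rule starlike_imp_connected)
  have dis: "L \<inter> \<Gamma> = {}" by (auto simp: L_def \<Gamma>_def)
  have cl: "closure L = L \<union> \<Gamma>"
  proof
    have eq: "L \<union> \<Gamma> = cball 0 1 \<union> {x. \<psi> x \<le> 0}" by (force simp: L_def \<Gamma>_def)
    show "closure L \<subseteq> L \<union> \<Gamma>"
    proof (rule closure_minimal)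
      show "closed (L \<union> \<Gamma>)" unfolding eq using opc by auto
    qed auto
    show "L \<union> \<Gamma> \<subseteq> closure L"
    proof -
      have "x \<in> closure L" if x: "x \<in> \<Gamma>" for x
        unfolding closure_approachable
      proof safe
        fix e :: real assume e: "e > 0"
        have nx: "norm x > 1" "\<psi> x = 0" using x by (auto simp: \<Gamma>_def)
        define s where "s = max 0 (1 - e / (2 * norm x))"
        have "e / (2 * norm x) > 0" using e nx by (intro divide_pos_pos) auto
        then have s: "0 \<le> s" "s < 1" "1 - s \<le> e / (2 * norm x)" by (auto simp: s_def)
        have "of_real s * x - x = - (of_real (1 - s) * x)" by (simp add: algebra_simps)
        then have "dist (of_real s * x) x = (1 - s) * norm x" using s by (simp add: dist_norm norm_mult del: of_real_diff)
        also have "\<dots> \<le> e / (2 * norm x) * norm x" using s by (intro mult_right_mono) auto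
        also have "\<dots> < e" using nx e by simp
        finally show "\<exists>y\<in>L. dist y x < e" using shrink[of s x] s nx by force
      qed
      then show ?thesis using closure_subset by blast
    qed
  qed
  then show "closure L = L \<union> \<Gamma>" .
  show fr: "frontier L = \<Gamma>" using cl dis opL by (auto simp: frontier_def interior_open)
  show "connected_component_set (- \<Gamma>) p = L"
  proof
    have pL: "p \<in> L" using p by (auto simp: L_def)
    show "L \<subseteq> connected_component_set (- \<Gamma>) p"
      by (rule connected_component_maximal[OF pL conL]) (use dis in auto)
    show "connected_component_set (- \<Gamma>) p \<subseteq> L"
    proof (rule ccontr)
      assume "\<not> ?thesis"
      then have a: "connected_component_set (- \<Gamma>) p - L \<noteq> {}" by auto
      have b: "connected_component_set (- \<Gamma>) p \<inter> L \<noteq> {}"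
      proof -
        have "p \<notin> \<Gamma>" using pL dis by blast
        then have "p \<in> connected_component_set (- \<Gamma>) p" by simp
        then show ?thesis using pL by blast
      qed
      have "connected_component_set (- \<Gamma>) p \<inter> frontier L \<noteq> {}"
        by (rule connected_Int_frontier[OF connected_connected_component b a])
      then show False using fr connected_component_subset[of "-\<Gamma>" p] by auto
    qed
  qed
  show "t islimpt \<Gamma>" if t: "t \<in> \<Gamma>" for t
  proof (rule ccontr)
    assume "\<not> ?thesis"
    then obtain r where r: "r > 0" "\<And>y. y \<in> \<Gamma> \<Longrightarrow> y \<noteq> t \<Longrightarrow> \<not> dist y t < r"
      unfolding islimpt_approachable by blast
    have nt: "norm t > 1" "\<psi> t = 0" using t by (auto simp: \<Gamma>_def)
    define A where "A = ball t r - {t}"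
    \<comment> \<open>If t were isolated in \<Gamma>, this connected punctured ball would miss the
      frontier of L; but it contains (1 - h) t inside L and (1 + h) t outside.\<close>
    have conA: "connected A" unfolding A_def by (intro connected_punctured_ball) auto
    define h where "h = min (1/2) (r / (2 * norm t))"
    have h: "0 < h" "h < 1" "h * norm t < r"
    proof -
      have "h * norm t \<le> r / (2 * norm t) * norm t" using nt by (intro mult_right_mono) (auto simp: h_def)
      also have "\<dots> < r" using nt r by simp
      finally show "h * norm t < r" .
        have "r / (2 * norm t) > 0" using nt r by (intro divide_pos_pos) auto
      then show "0 < h" "h < 1" by (auto simp: h_def)
    qed
    have dist: "of_real (1 + k) * t \<in> A" if "\<bar>k\<bar> = h" for k
    proof -
      have "of_real (1 + k) * t - t = of_real k * t" by (simp add: algebra_simps)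
      then have "dist (of_real (1+k) * t) t = h * norm t" using that by (simp add: dist_norm norm_mult del: of_real_add)
      then show ?thesis using h nt by (auto simp: A_def dist_commute)
    qed
    have "of_real (1 + -h) * t \<in> A \<inter> L" using dist[of "-h"] h shrink[of "1 - h" t] nt by auto
    moreover have "of_real (1 + h) * t \<in> A - L"
    proof -
      have "of_real (1 + h) * t \<notin> L"
      proof
        assume L: "of_real (1 + h) * t \<in> L"
        have n: "norm (of_real (1 + h) * t) = (1 + h) * norm t" using h by (simp add: norm_mult del: of_real_add)
        have "1 * 1 < (1 + h) * norm t" using h nt by (intro mult_strict_mono) auto
        then have "\<psi> (of_real (1 + h) * t) < 0" using L n by (auto simp: L_def)
        then have "\<psi> (of_real (1/(1+h)) * (of_real (1 + h) * t)) < 0"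
          using h nt n by (intro \<psi>(3)) (auto simp: less_imp_le simp del: of_real_add)
        moreover have "of_real (1/(1+h)) * (of_real (1 + h) * t) = t"
          using h by (simp add: mult.assoc[symmetric] del: of_real_add flip: of_real_mult)
        ultimately show False using nt by simp
      qed
      then show ?thesis using dist[of h] h by auto
    qed
    ultimately have "A \<inter> frontier L \<noteq> {}" using connected_Int_frontier[OF conA] by blast
    then obtain y where "y \<in> A" "y \<in> \<Gamma>" unfolding fr by blast
    then show False using r(2)[of y] by (auto simp: A_def dist_commute)
  qed
qed

section \<open>The smaller root of a quadratic\<close>

text \<open>The root of A r^2 + B r + C with the smaller modulus, with the leading coefficient
  cleared from the denominator: it stays holomorphic where A vanishes, at x = 0 and at y =
  -1.\<close>

definition small_root :: "complex \<Rightarrow> complex \<Rightarrow> complex \<Rightarrow> complex" where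
  "small_root A B C = - 2 * C / (B * (1 + csqrt (1 - 4 * A * C / B^2)))"

lemma small_root_eq:
  assumes B: "B \<noteq> 0"
  shows "A * (small_root A B C)^2 + B * small_root A B C + C = 0"
proof -
  define c where "c = csqrt (1 - 4 * A * C / B^2)"
  have c1: "1 + c \<noteq> 0" unfolding c_def by (rule csqrt_not_minus_one)
  have c2: "c^2 = 1 - 4 * A * C / B^2" by (simp add: c_def)
  have ac: "4 * A * C = B^2 * (1 - c^2)" using B by (simp add: c2)
  have s: "small_root A B C = - 2 * C / (B * (1 + c))" by (simp add: small_root_def c_def)
  have "A * (small_root A B C)^2 = (4 * A * C) * C / (B^2 * (1 + c)^2)"
    by (simp add: s power_divide power_mult_distrib) (simp add: power2_eq_square)
  also have "\<dots> = (1 - c) * C / (1 + c)"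
  proof -
    have "1 - c^2 = (1 - c) * (1 + c)" by (simp add: algebra_simps power2_eq_square)
    then show ?thesis unfolding ac using B c1 by (simp add: power2_eq_square)
  qed
  finally have 1: "A * (small_root A B C)^2 = (1 - c) * C / (1 + c)" .
  have 2: "B * small_root A B C = - 2 * C / (1 + c)" using B by (simp add: s)
  have "(1 - c) * C / (1 + c) + - 2 * C / (1 + c) = ((1 - c) * C - 2 * C) / (1 + c)"
    by (simp add: diff_divide_distrib)
  also have "(1 - c) * C - 2 * C = - (C * (1 + c))" by (simp add: algebra_simps)
  finally show ?thesis unfolding 1 2 using c1 by simp
qed

text \<open>With c the principal square root, A r^2 = C (1 - c)/(1 + c), and |1 - c| < |1 + c| as Re
  c > 0. The roots having product C/A, the bound says that this one is strictly the smaller.\<close>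

lemma small_root_norm:
  assumes B: "B \<noteq> 0" and C: "C \<noteq> 0" and \<omega>: "1 - 4 * A * C / B^2 \<notin> \<real>\<^sub>\<le>\<^sub>0"
  shows "norm (A * (small_root A B C)^2) < norm C"
proof -
  define c where "c = csqrt (1 - 4 * A * C / B^2)"
  have c1: "1 + c \<noteq> 0" unfolding c_def by (rule csqrt_not_minus_one)
  have c0: "0 < Re c" unfolding c_def by (rule Re_csqrt_pos[OF \<omega>])
  have s: "small_root A B C = - 2 * C / (B * (1 + c))" by (simp add: small_root_def c_def)
  have "A * (small_root A B C)^2 = - (B * small_root A B C + C)"
    using small_root_eq[OF B, of A C] by (simp add: algebra_simps eq_neg_iff_add_eq_0)
  also have "\<dots> = C * ((1 - c) / (1 + c))"
  proof -
    have 2: "B * small_root A B C = - 2 * C / (1 + c)" using B by (simp add: s)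
    show ?thesis unfolding 2 using c1 by (simp add: field_simps)
  qed
  finally have "norm (A * (small_root A B C)^2) = norm C * (norm (1 - c) / norm (1 + c))"
    by (simp add: norm_mult norm_divide)
  moreover have "norm (1 - c) < norm (1 + c)"
    unfolding cmod_def using c0 by (intro real_sqrt_less_mono) (simp add: power2_eq_square algebra_simps)
  then have "norm (1 - c) / norm (1 + c) < 1" using c1 by simp
  then have "norm C * (norm (1 - c) / norm (1 + c)) < norm C * 1"
    using C by (intro mult_strict_left_mono) auto
  ultimately show ?thesis by simp
qed

lemma small_root_alt:
  assumes A: "A \<noteq> 0" and B: "B \<noteq> 0"
  shows "small_root A B C = (- B + B * csqrt (1 - 4 * A * C / B^2)) / (2 * A)"
proof -
  define c where "c = csqrt (1 - 4 * A * C / B^2)"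
  have c1: "1 + c \<noteq> 0" unfolding c_def by (rule csqrt_not_minus_one)
  have c2: "c^2 = 1 - 4 * A * C / B^2" by (simp add: c_def)
  have ac: "4 * A * C = B^2 * (1 - c^2)" using B by (simp add: c2)
  have "- 2 * C * (2 * A) = (- B + B * c) * (B * (1 + c))"
    using ac by (simp add: algebra_simps power2_eq_square)
  then show ?thesis unfolding small_root_def c_def[symmetric]
    by (rule frac_eq_eq[THEN iffD2, rotated 2]) (use A B c1 in auto)
qed

text \<open>Two distinct roots r and s satisfy C = A r s, so |A r^2| |A s^2| = |C|^2 and they cannot
  both meet the bound.\<close>

lemma small_root_unique:
  assumes A: "A \<noteq> 0" and B: "B \<noteq> 0" and C: "C \<noteq> 0" and \<omega>: "1 - 4 * A * C / B^2 \<notin> \<real>\<^sub>\<le>\<^sub>0"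
    and r: "A * r^2 + B * r + C = 0" "norm (A * r^2) < norm C"
  shows "r = small_root A B C"
proof (rule ccontr)
  define s where "s = small_root A B C"
  assume "r \<noteq> small_root A B C"
  then have ne: "r - s \<noteq> 0" by (simp add: s_def)
  have s: "A * s^2 + B * s + C = 0" "norm (A * s^2) < norm C"
    unfolding s_def using small_root_eq[OF B] small_root_norm[OF B C \<omega>] by auto
  have "(r - s) * (A * (r + s) + B) = 0" using r(1) s(1) by algebra
  then have "B = - A * (r + s)" using ne by (simp add: add_eq_0_iff)
  then have c: "C = A * r * s" using r(1) by algebra
  have "norm (A * r^2) * norm (A * s^2) < norm C * norm C"
    using r(2) s(2) by (intro mult_strict_mono') auto
  moreover have "norm (A * r^2) * norm (A * s^2) = norm C * norm C"
    unfolding c by (simp add: norm_mult norm_power power2_eq_square)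
  ultimately show False by simp
qed

text \<open>The roots in \<open>X0\<close> and \<open>Y0\<close> use the principal root of the
  discriminant, which is B c only up to sign. Choosing by modulus removes the dependence on that
  sign.\<close>

lemma smaller_root_select:
  assumes A: "A \<noteq> 0" and B: "B \<noteq> 0" and \<omega>: "1 - 4 * A * C / B^2 \<notin> \<real>\<^sub>\<le>\<^sub>0"
  shows "(let r1 = (- B + csqrt (B^2 - 4 * A * C)) / (2 * A); r2 = (- B - csqrt (B^2 - 4 * A * C)) / (2 * A)
          in if cmod r1 \<le> cmod r2 then r1 else r2) = small_root A B C"
proof -
  define c where "c = csqrt (1 - 4 * A * C / B^2)"
  define s where "s = csqrt (B^2 - 4 * A * C)"
  have c0: "0 < Re c" unfolding c_def by (rule Re_csqrt_pos[OF \<omega>])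
  have "s^2 = B^2 - 4 * A * C" by (simp add: s_def)
  also have "\<dots> = (B * c)^2" using B by (simp add: c_def power_mult_distrib algebra_simps)
  finally have s: "s = B * c \<or> s = - (B * c)" by (simp add: power2_eq_iff)
  have "norm (1 - c) < norm (1 + c)"
    unfolding cmod_def using c0 by (intro real_sqrt_less_mono) (simp add: power2_eq_square algebra_simps)
  then have "norm B * norm (1 - c) < norm B * norm (1 + c)" using B by simp
  moreover have "norm (- B + B * c) = norm B * norm (1 - c)" "norm (- B - B * c) = norm B * norm (1 + c)"
  proof -
    have "- B + B * c = - (B * (1 - c))" "- B - B * c = - (B * (1 + c))" by (auto simp: algebra_simps)
    then show "norm (- B + B * c) = norm B * norm (1 - c)" "norm (- B - B * c) = norm B * norm (1 + c)"
      by (simp_all only: norm_minus_cancel norm_mult)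
  qed
  ultimately have less: "norm (- B + B * c) < norm (- B - B * c)" by simp
  then have "norm ((- B + B * c) / (2 * A)) < norm ((- B - B * c) / (2 * A))"
    using A unfolding norm_divide by (intro divide_strict_right_mono) auto
  then show ?thesis
    unfolding small_root_alt[OF A B] c_def[symmetric] s_def[symmetric] Let_def using s
  proof (elim disjE)
    assume s: "s = - (B * c)"
    have e: "- B + s = - B - B * c" "- B - s = - B + B * c" by (simp_all add: s)
    assume "cmod ((- B + B * c) / (2 * A)) < cmod ((- B - B * c) / (2 * A))"
    then show "(if cmod ((- B + s) / (2 * A)) \<le> cmod ((- B - s) / (2 * A)) then (- B + s) / (2 * A) else (- B - s) / (2 * A)) = (- B + B * c) / (2 * A)"
      unfolding e by (simp only: not_le[symmetric] if_False)
  qed simp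
qed

text \<open>With a nonpositive discriminant the roots form a conjugate pair, and a complex number
  belongs to it once its squared modulus is the product of the roots and twice its real part is
  their sum.\<close>

lemma conjugate_roots_iff:
  fixes a b c :: real and p :: complex
  assumes a: "a > 0" and d: "b^2 - 4 * a * c \<le> 0"
  shows "p = (of_real (-b) - \<i> * of_real (sqrt (- (b^2 - 4 * a * c)))) / of_real (2 * a) \<or>
         p = (of_real (-b) + \<i> * of_real (sqrt (- (b^2 - 4 * a * c)))) / of_real (2 * a)
     \<longleftrightarrow> a * (norm p)^2 = c \<and> 2 * a * Re p = - b"
proof -
  define s where "s = sqrt (- (b^2 - 4 * a * c))"
  have s2: "s^2 = 4 * a * c - b^2" using d by (simp add: s_def)
  have "p = (of_real (-b) - \<i> * of_real s) / of_real (2 * a) \<or> p = (of_real (-b) + \<i> * of_real s) / of_real (2 * a)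
     \<longleftrightarrow> 2 * a * Re p = - b \<and> (2 * a * Im p = - s \<or> 2 * a * Im p = s)"
    using a by (auto simp: complex_eq_iff field_simps)
  also have "(2 * a * Im p = - s \<or> 2 * a * Im p = s) \<longleftrightarrow> (2 * a * Im p)^2 = s^2" by (auto simp: power2_eq_iff)
  also have "2 * a * Re p = - b \<and> (2 * a * Im p)^2 = s^2 \<longleftrightarrow> a * (norm p)^2 = c \<and> 2 * a * Re p = - b"
  proof -
    have "(2 * a * Im p)^2 = s^2 \<longleftrightarrow> a * (norm p)^2 = c" if "2 * a * Re p = - b"
    proof -
      have "b^2 = (2 * a * Re p)^2" using that by simp
      then have "(2 * a * Im p)^2 = s^2 \<longleftrightarrow> 4 * a * (a * (norm p)^2) = 4 * a * c"
        unfolding s2 cmod_power2 by (auto simp: power_mult_distrib algebra_simps power2_eq_square)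
      then show ?thesis using a by simp
    qed
    then show ?thesis by blast
  qed
  finally show ?thesis unfolding s_def .
qed

text \<open>The identity is propagated from the unit disc to the exterior through a neighbourhood of -1.\<close>
lemma identity_on_exterior:
  assumes W: "open W" "\<Phi> holomorphic_on W" "-1 \<in> W" "\<Omega> \<subseteq> W" and \<Omega>: "open \<Omega>" "connected \<Omega>" "W - cball 0 1 \<subseteq> \<Omega>"
    and 0: "\<And>x. x \<in> W \<Longrightarrow> norm x < 1 \<Longrightarrow> \<Phi> x = 0" and x: "x \<in> \<Omega> \<union> {-1::complex}"
  shows "\<Phi> x = (0::complex)"
proof -
  obtain e0 where e0: "e0 > 0" "ball (-1) e0 \<subseteq> W" using W openE by blast
  define e where "e = min e0 1"
  have e: "e > 0" "e \<le> 1" "ball (-1) e \<subseteq> W" using e0 by (auto simp: e_def)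
  define T where "T = \<Omega> \<union> ball (-1) e"
  have m1: "(-1::complex) = of_real (-1)" by simp
  define a where "a = complex_of_real (-1 - e/2)"
  have "a \<in> ball (-1::complex) e" unfolding a_def
    unfolding m1 mem_ball dist_of_real dist_real_def using e by simp
  moreover have "norm a > 1" using e unfolding a_def norm_of_real by simp
  then have "a \<notin> cball 0 1" by simp
  ultimately have "a \<in> \<Omega> \<inter> ball (-1) e" using \<Omega>(3) e(3) by blast
  then have conT: "connected T" unfolding T_def using \<Omega>(2) by (intro connected_Un) auto
  have TW: "T \<subseteq> W" using W e by (auto simp: T_def)
  show ?thesis
  proof (rule analytic_continuation_open[of "ball (-1) e \<inter> ball 0 1" T \<Phi> "\<lambda>_. 0"])
    show "open T" using \<Omega> by (auto simp: T_def)
    have "of_real (-1 + e/2) \<in> ball (-1::complex) e"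
      unfolding m1 mem_ball dist_of_real dist_real_def using e by simp
    moreover have "norm (complex_of_real (-1 + e/2)) < 1" using e unfolding norm_of_real by simp
    ultimately show "ball (-1) e \<inter> ball (0::complex) 1 \<noteq> {}" by (metis IntI empty_iff mem_ball_0)
    show "\<Phi> holomorphic_on T" using W TW holomorphic_on_subset by blast
    show "x \<in> T" using x e by (auto simp: T_def)
  qed (use conT e 0 in \<open>auto simp: T_def subset_iff\<close>)
qed

section \<open>The x-plane\<close>

lemma inverse_sum_real:
  assumes "x \<noteq> 0" "Im (x + inverse x) = 0"
  shows "Im x = 0 \<or> norm x = 1"
proof -
  have n: "(norm x)^2 \<noteq> 0" using assms by simp
  have i: "Im (inverse x) = - Im x / (norm x)^2" by (simp add: cmod_power2)
  have "Im x * (1 - 1 / (norm x)^2) = 0" using assms(2)[unfolded plus_complex.sel i] by (simp add: algebra_simps)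
  then have "Im x = 0 \<or> (norm x)^2 = 1" using n by auto
  then show ?thesis by (smt (verit) norm_ge_zero power2_eq_1_iff)
qed

lemma inverse_sum_unit_circle: "norm x = 1 \<Longrightarrow> x + inverse x = of_real (2 * Re x)"
  using complex_div_cnj[of 1 x] by (simp add: complex_eq_iff inverse_eq_divide)

lemma inverse_sum_eq_iff:
  assumes "x \<noteq> 0" "y \<noteq> 0"
  shows "x + inverse x = y + inverse y \<longleftrightarrow> x = y \<or> x = inverse (y::complex)"
proof -
  have "(x - y) * (x * y - 1) = x * y * ((x + inverse x) - (y + inverse y))"
    using assms by (simp add: algebra_simps)
  then have "x + inverse x = y + inverse y \<longleftrightarrow> x = y \<or> x * y = 1"
    using assms by auto
  also have "x * y = 1 \<longleftrightarrow> x = inverse y" using assms by (auto simp: inverse_eq_divide eq_divide_eq)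
  finally show ?thesis .
qed

text \<open>Off the unit circle a real value of x + 1/x forces x to be real, and then |x| + 1/|x|
  \<le> 2 gives |x| = 1 after all.\<close>

lemma inverse_sum_segment_imp_unit:
  fixes x :: complex
  assumes x: "x \<noteq> 0" and v: "x + inverse x = of_real v" "\<bar>v\<bar> \<le> 2"
  shows "norm x = 1"
proof (rule ccontr)
  assume n: "norm x \<noteq> 1"
  have "Im (x + inverse x) = 0" using v by simp
  then have "Im x = 0" using inverse_sum_real[OF x] n by blast
  then obtain t where t: "x = of_real t" by (metis complex_is_Real_iff Reals_cases)
  have t0: "t \<noteq> 0" using x t by auto
  have "complex_of_real (t + inverse t) = of_real v" using v(1) t by simp
  then have tv: "t + inverse t = v" by (simp only: of_real_eq_iff)
  have "t^2 + 1 = v * t" using t0 tv by (auto simp: power2_eq_square field_simps)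
  then have "\<bar>t\<bar>^2 + 1 = \<bar>v\<bar> * \<bar>t\<bar>" by (metis abs_mult abs_of_nonneg add_nonneg_nonneg power2_abs zero_le_one zero_le_power2)
  also have "\<dots> \<le> 2 * \<bar>t\<bar>" using v(2) by (intro mult_right_mono) auto
  finally have "(\<bar>t\<bar> - 1)^2 \<le> 0" by (simp add: power2_eq_square algebra_simps)
  then have "\<bar>t\<bar> = 1" by simp
  then show False using n t by simp
qed

lemma inverse_sum_gt_2_imp_positive:
  fixes x :: complex
  assumes x: "x \<noteq> 0" and v: "x + inverse x = of_real v" "v > 2"
  obtains t where "x = of_real t" "t > 0" "t + inverse t = v"
proof -
  have "norm x \<noteq> 1"
  proof
    assume n: "norm x = 1"
    then have "complex_of_real v = of_real (2 * Re x)" using inverse_sum_unit_circle v by metis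
    then have "v = 2 * Re x" by (simp only: of_real_eq_iff)
    then show False using v n complex_Re_le_cmod[of x] by linarith
  qed
  moreover have "Im (x + inverse x) = 0" using v by simp
  ultimately have "Im x = 0" using inverse_sum_real[OF x] by blast
  then obtain t where t: "x = of_real t" by (metis complex_is_Real_iff Reals_cases)
  have "complex_of_real (t + inverse t) = of_real v" using v(1) t by simp
  then have tv: "t + inverse t = v" by (simp only: of_real_eq_iff)
  moreover have "t > 0"
  proof (rule ccontr)
    assume "\<not> t > 0"
    then have "t + inverse t \<le> 0" by (simp add: add_nonpos_nonpos)
    then show False using tv v by simp
  qed
  ultimately show ?thesis using that t by blast
qed

text \<open>The sign of the second factor is fixed by a single real point to the left of the slit.\<close>
lemma slit_sqrt_factor:
  fixes g h :: "complex \<Rightarrow> complex"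
  assumes ab: "a < \<alpha>" "\<alpha> < \<beta>" "\<beta> < b"
    and cont: "continuous_on ({x. a < Re x \<and> Re x < b} - closed_segment (of_real \<alpha>) (of_real \<beta>)) g"
      "continuous_on {x. a < Re x \<and> Re x < b} h"
    and sq: "\<And>x. a < Re x \<Longrightarrow> Re x < b \<Longrightarrow> x \<notin> closed_segment (of_real \<alpha>) (of_real \<beta>) \<Longrightarrow> (g x)^2 = (h x)^2 * ((x - of_real \<alpha>) * (x - of_real \<beta>))"
    and h: "\<And>x. a < Re x \<Longrightarrow> Re x < b \<Longrightarrow> h x \<noteq> 0"
    and p: "a < p" "p < \<alpha>" "g (of_real p) = of_real g0" "h (of_real p) = of_real h0" "g0 * h0 < 0"
    and x: "a < Re x" "Re x < b" "x \<notin> closed_segment (of_real \<alpha>) (of_real \<beta>)"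
  shows "g x = h x * cut_sqrt \<alpha> \<beta> x"
proof -
  define T where "T = {x. a < Re x \<and> Re x < b} - closed_segment (of_real \<alpha>) (of_real \<beta>)"
  have pS: "of_real p \<notin> closed_segment (complex_of_real \<alpha>) (of_real \<beta>)"
    using p(2) ab by (auto simp: closed_segment_of_real closed_segment_eq_real_ivl)
  show ?thesis
  proof (rule connected_same_square_imp_eq[of T g "\<lambda>x. h x * cut_sqrt \<alpha> \<beta> x" "of_real p"])
    show "connected T" unfolding T_def using ab by (intro connected_strip_minus_segment) auto
    show "continuous_on T g" using cont by (simp add: T_def)
    show "continuous_on T (\<lambda>x. h x * cut_sqrt \<alpha> \<beta> x)"
      using ab by (intro continuous_intros continuous_on_cut_sqrt continuous_on_subset[OF cont(2)]) (auto simp: T_def)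
    show "(g x)^2 = (h x * cut_sqrt \<alpha> \<beta> x)^2" if "x \<in> T" for x
      using that sq[of x] not_in_segment_cut_sqrt(1)[OF ab(2), of x] cut_sqrt_power2[OF ab(2), of x]
      by (simp add: T_def power_mult_distrib)
    show "h x * cut_sqrt \<alpha> \<beta> x \<noteq> 0" if "x \<in> T" for x
      using that h[of x] not_in_segment_cut_sqrt(3)[OF ab(2), of x] by (simp add: T_def)
    show "of_real p \<in> T" using p pS ab by (simp add: T_def)
    show "x \<in> T" using x by (simp add: T_def)
    define s where "s = sqrt ((\<alpha>-p)*(\<beta>-p))"
    have s: "s > 0" using p ab by (simp add: s_def)
    have s2: "s^2 = (\<alpha>-p)*(\<beta>-p)" using p ab by (simp add: s_def)
    have cs: "cut_sqrt \<alpha> \<beta> (of_real p) = - of_real s" using cut_sqrt_left[OF ab(2) p(2)] by (simp add: s_def)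
    have "complex_of_real (g0^2) = of_real (h0^2 * ((p - \<alpha>) * (p - \<beta>)))"
      using sq[of "of_real p"] p ab pS by simp
    then have "g0^2 = h0^2 * ((p - \<alpha>) * (p - \<beta>))" by (simp only: of_real_eq_iff)
    also have "(p - \<alpha>) * (p - \<beta>) = s^2" by (simp add: s2 algebra_simps)
    also have "h0^2 * s^2 = (h0 * s)^2" by (simp add: power_mult_distrib)
    finally have "g0 = h0 * s \<or> g0 = - (h0 * s)" by (simp only: power2_eq_iff)
    moreover have "g0 \<noteq> h0 * s"
    proof
      assume "g0 = h0 * s"
      then have "g0 * h0 = h0^2 * s" by (simp add: power2_eq_square)
      then show False using p(5) s by (metis less_le_not_le mult_nonneg_nonneg zero_le_power2)
    qed
    ultimately have "g0 = - (h0 * s)" by blast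
    then show "g (of_real p) = h (of_real p) * cut_sqrt \<alpha> \<beta> (of_real p)" using p(3,4) cs by simp
  qed
qed

lemma x_roots:
  assumes z: "0 < z" "z < 1/4"
  shows "0 < x1 z" "x1 z < x2 z" "x2 z < 1" "1 < x3 z" "x3 z < x4 z"
    "x1 z * x4 z = 1" "x2 z * x3 z = 1" "x1 z + x4 z = 1/z + 2" "x2 z + x3 z = 1/z - 2"
proof -
  define s u where "s = sqrt (1 + 4*z)" and "u = sqrt (1 - 4*z)"
  have s: "s > 0" "s^2 = 1 + 4*z" and u: "u > 0" "u^2 = 1 - 4*z" using z by (auto simp: s_def u_def)
  have X: "x1 z = (1 + 2*z - s) / (2*z)" "x2 z = (1 - 2*z - u) / (2*z)" "x3 z = (1 - 2*z + u) / (2*z)" "x4 z = (1 + 2*z + s) / (2*z)"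
    by (simp_all add: x1_def x2_def x3_def x4_def s_def u_def)
  have s1: "s < 1 + 2*z"
    by (rule power2_less_imp_less) (use s z in \<open>auto simp: power2_eq_square algebra_simps\<close>)
  have u1: "u < 1 - 2*z"
    by (rule power2_less_imp_less) (use u z in \<open>auto simp: power2_eq_square algebra_simps\<close>)
  \<comment> \<open>This is x1 < x2 with the common denominator 2z cleared.\<close>
  have su: "4*z + u < s"
  proof (rule power2_less_imp_less)
    have "z * u < z * (1 - 2*z)" using u1 z by (intro mult_strict_left_mono) auto
    then show "(4*z + u)^2 < s^2" unfolding s(2) using u(2) by (simp add: power2_eq_square algebra_simps)
  qed (use s in auto)
  show p1: "0 < x1 z" using s1 z by (simp add: X)
  show p2: "x1 z < x2 z" unfolding X using su z by (intro divide_strict_right_mono) auto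
  have p3: "x2 z < x3 z" unfolding X using u z by (intro divide_strict_right_mono) auto
  show m1: "x1 z * x4 z = 1"
  proof -
    have "(1 + 2*z - s) * (1 + 2*z + s) = (1+2*z)^2 - s^2" by (simp add: algebra_simps power2_eq_square)
    also have "\<dots> = (2*z) * (2*z)" unfolding s(2) by (simp add: algebra_simps power2_eq_square)
    finally show ?thesis unfolding X using z by simp
  qed
  show m2: "x2 z * x3 z = 1"
  proof -
    have "(1 - 2*z - u) * (1 - 2*z + u) = (1-2*z)^2 - u^2" by (simp add: algebra_simps power2_eq_square)
    also have "\<dots> = (2*z) * (2*z)" unfolding u(2) by (simp add: algebra_simps power2_eq_square)
    finally show ?thesis unfolding X using z by simp
  qed
  show "x1 z + x4 z = 1/z + 2" "x2 z + x3 z = 1/z - 2" unfolding X using z by (simp_all add: field_simps)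
  have p: "0 < x2 z" "0 < x3 z" using p1 p2 p3 by auto
  show x21: "x2 z < 1"
  proof (rule ccontr)
    assume "\<not> x2 z < 1"
    then have "1 * 1 < x2 z * x3 z" using p3 by (intro mult_le_less_imp_less) auto
    then show False using m2 by simp
  qed
  show "1 < x3 z"
  proof (rule ccontr)
    assume "\<not> 1 < x3 z"
    then have "x2 z * x3 z \<le> x2 z * 1" using p by (intro mult_left_mono) auto
    then show False using m2 x21 by simp
  qed
  show "x3 z < x4 z"
  proof -
    have "x1 z * x3 z < x2 z * x3 z" using p2 p by (intro mult_strict_right_mono) auto
    then have "x1 z * x3 z < x1 z * x4 z" using m1 m2 by simp
    then show ?thesis using p1 by simp
  qed
qed

text \<open>As 4ac = (2zx)^2, the discriminant is the product of b - 2zx and b + 2zx. Both are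
  self-reciprocal quadratics, with root pairs x1, x4 and x2, x3.\<close>

lemma gd_factor:
  fixes x :: "'a::real_field"
  assumes z: "0 < z" "z < 1/4"
  shows "gd z x = of_real z ^ 2 * ((x - of_real (x1 z)) * (x - of_real (x2 z)) * ((x - of_real (x3 z)) * (x - of_real (x4 z))))"
proof -
  note R = x_roots[OF z]
  define Z where "Z = (of_real z :: 'a)"
  have Z0: "Z \<noteq> 0" using z by (simp add: Z_def)
  have 1: "Z * ((x - of_real (x1 z)) * (x - of_real (x4 z))) = Z * x^2 - (1 + 2 * Z) * x + Z"
  proof -
    have "(x - of_real (x1 z)) * (x - of_real (x4 z)) = x^2 - of_real (x1 z + x4 z) * x + of_real (x1 z * x4 z)"
      by (simp add: algebra_simps power2_eq_square)
    also have "\<dots> = x^2 - (1/Z + 2) * x + 1" unfolding R by (simp add: Z_def)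
    finally show ?thesis using Z0 by (simp add: field_simps)
  qed
  have 2: "Z * ((x - of_real (x2 z)) * (x - of_real (x3 z))) = Z * x^2 - (1 - 2 * Z) * x + Z"
  proof -
    have "(x - of_real (x2 z)) * (x - of_real (x3 z)) = x^2 - of_real (x2 z + x3 z) * x + of_real (x2 z * x3 z)"
      by (simp add: algebra_simps power2_eq_square)
    also have "\<dots> = x^2 - (1/Z - 2) * x + 1" unfolding R by (simp add: Z_def)
    finally show ?thesis using Z0 by (simp add: field_simps)
  qed
  have "gd z x = (Z * x^2 - (1 + 2 * Z) * x + Z) * (Z * x^2 - (1 - 2 * Z) * x + Z)"
    by (simp add: gd_def ga_def gb_def gc_def Z_def algebra_simps power2_eq_square)
  also have "\<dots> = (Z * ((x - of_real (x1 z)) * (x - of_real (x4 z)))) * (Z * ((x - of_real (x2 z)) * (x - of_real (x3 z))))"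
    unfolding 1 2 ..
  finally show ?thesis by (simp add: Z_def power2_eq_square mult_ac)
qed

definition segX :: "real \<Rightarrow> complex set" where
  "segX z = closed_segment (of_real (x1 z)) (of_real (x2 z))"

lemma gd_real_le_0:
  assumes z: "0 < z" "z < 1/4" 
  shows "gd z (t::real) \<le> 0 \<longleftrightarrow> t \<in> {x1 z..x2 z} \<union> {x3 z..x4 z}"
proof -
  note R = x_roots[OF z]
  have f: "gd z t = z^2 * ((t - x1 z) * (t - x2 z) * ((t - x3 z) * (t - x4 z)))"
    using gd_factor[OF z, of t] by simp
  have "gd z t \<le> 0 \<longleftrightarrow> (t - x1 z) * (t - x2 z) * ((t - x3 z) * (t - x4 z)) \<le> 0"
    unfolding f using z by (simp add: mult_le_0_iff)
  also have "\<dots> \<longleftrightarrow> t \<in> {x1 z..x2 z} \<union> {x3 z..x4 z}"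
    using R(1-5) by (auto simp: mult_le_0_iff zero_le_mult_iff)
  finally show ?thesis .
qed

lemma gd_real_inverse_sum:
  assumes z: "0 < z" and t: "t \<noteq> 0"
  shows "gd z t \<le> 0 \<longleftrightarrow> \<bar>t + inverse t - 1/z\<bar> \<le> 2"
proof -
  have "gd z t = t^2 * ((z * (t + inverse t - 1/z))^2 - (2*z)^2)"
    using t z by (simp add: gd_def ga_def gb_def gc_def field_simps power2_eq_square)
  then have "gd z t \<le> 0 \<longleftrightarrow> (z * (t + inverse t - 1/z))^2 \<le> (2*z)^2"
    using t by (simp add: mult_le_0_iff)
  also have "\<dots> \<longleftrightarrow> \<bar>z * (t + inverse t - 1/z)\<bar> \<le> \<bar>2*z\<bar>" by (simp only: abs_le_square_iff)
  also have "\<dots> \<longleftrightarrow> z * \<bar>t + inverse t - 1/z\<bar> \<le> z * 2" using z by (simp add: abs_mult)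
  also have "\<dots> \<longleftrightarrow> \<bar>t + inverse t - 1/z\<bar> \<le> 2" using z by simp
  finally show ?thesis .
qed

lemma of_real_segment: "a \<le> b \<Longrightarrow> closed_segment (complex_of_real a) (of_real b) = of_real ` {a..b}"
  by (simp add: closed_segment_of_real closed_segment_eq_real_ivl)

lemma X_cuts_iff:
  assumes z: "0 < z" "z < 1/4"
  shows "x \<in> segX z \<union> cutX z \<longleftrightarrow> (\<exists>t. x = of_real t \<and> gd z t \<le> 0)"
proof -
  note R = x_roots[OF z]
  have "segX z = of_real ` {x1 z..x2 z}" "cutX z = of_real ` {x3 z..x4 z}"
    unfolding segX_def cutX_def using R by (intro of_real_segment; simp)+
  then show ?thesis unfolding gd_real_le_0[OF z] by auto
qed

text \<open>On real x, d has the sign of (x + 1/x - 1/z)^2 - 4. Hence both cuts together are the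
  preimage of one interval under x + 1/x; since 1/z - 2 > 2, this preimage is automatically real and
  positive.\<close>

lemma X_cuts_inverse_sum:
  assumes z: "0 < z" "z < 1/4" and x: "x \<noteq> 0"
  shows "x \<in> segX z \<union> cutX z \<longleftrightarrow> (\<exists>v. x + inverse x = of_real v \<and> \<bar>v - 1/z\<bar> \<le> 2)"
proof
  assume "x \<in> segX z \<union> cutX z"
  then obtain t where t: "x = of_real t" "gd z t \<le> 0" using X_cuts_iff[OF z] by blast
  have t0: "t \<noteq> 0" using x t by auto
  have "x + inverse x = of_real (t + inverse t)" by (simp add: t)
  then show "\<exists>v. x + inverse x = of_real v \<and> \<bar>v - 1/z\<bar> \<le> 2"
    using gd_real_inverse_sum[OF z(1) t0] t(2) by blast
next
  assume "\<exists>v. x + inverse x = of_real v \<and> \<bar>v - 1/z\<bar> \<le> 2"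
  then obtain v where v: "x + inverse x = of_real v" "\<bar>v - 1/z\<bar> \<le> 2" by blast
  have "4 < 1/z" using z by (simp add: field_simps)
  then have "v > 2" using v(2) by linarith
  then obtain t where t: "x = of_real t" "t > 0" "t + inverse t = v"
    using inverse_sum_gt_2_imp_positive[OF x v(1)] by blast
  then have "gd z t \<le> 0" using gd_real_inverse_sum[OF z(1), of t] v(2) by simp
  then show "x \<in> segX z \<union> cutX z" using X_cuts_iff[OF z] t by blast
qed

text \<open>Put u = z (x + 1/x) - 1. Then b = x u, and the argument of the root is 1 - 4z^2/u^2. If
  b = 0 or this argument is in the forbidden half-line, u is real with |u| \<le> 2z, which means
  that x is on a cut.\<close>

lemma X_off_cuts:
  assumes z: "0 < z" "z < 1/4" and x: "x \<notin> segX z" "x \<notin> cutX z"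
  shows "gb z x \<noteq> 0" "1 - 4 * ga z x * gc z x / (gb z x)^2 \<notin> \<real>\<^sub>\<le>\<^sub>0"
proof -
  have *: "gb z x \<noteq> 0 \<and> 1 - 4 * ga z x * gc z x / (gb z x)^2 \<notin> \<real>\<^sub>\<le>\<^sub>0"
  proof (cases "x = 0")
    case True
    then show ?thesis using z by (simp add: ga_def gb_def)
  next
    case x0: False
    define u where "u = of_real z * (x + inverse x) - 1"
    have b: "gb z x = x * u" using x0 by (simp add: u_def gb_def field_simps power2_eq_square)
    have nk: False if k: "u^2 = of_real k" "0 \<le> k" "k \<le> 4 * z^2" for k
    proof -
      have "u^2 = (of_real (sqrt k))^2" using k by (simp flip: of_real_power)
      then have "u = of_real (sqrt k) \<or> u = - of_real (sqrt k)" by (simp only: power2_eq_iff)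
      then obtain s where s: "u = of_real s" "\<bar>s\<bar> = sqrt k" using k(2) by (metis abs_of_nonneg abs_minus_cancel of_real_minus real_sqrt_ge_zero)
      have "sqrt k \<le> 2*z" using k z by (intro real_le_lsqrt) (auto simp: power_mult_distrib)
      then have sz: "\<bar>s\<bar> \<le> 2*z" using s z by simp
      have "x + inverse x = of_real ((s + 1) / z)" using s(1) z by (simp add: u_def field_simps)
      moreover have "\<bar>(s+1)/z - 1/z\<bar> \<le> 2"
        using sz z by (simp add: diff_divide_distrib[symmetric] divide_le_eq)
      ultimately show False using X_cuts_inverse_sum[OF z x0] x by blast
    qed
    have u0: "u \<noteq> 0" using nk[of 0] z by auto
    have w: "1 - 4 * ga z x * gc z x / (gb z x)^2 = 1 - of_real (4 * z^2) / u^2"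
      using x0 unfolding b by (simp add: ga_def gc_def power_mult_distrib power2_eq_square)
    have "1 - of_real (4 * z^2) / u^2 \<notin> \<real>\<^sub>\<le>\<^sub>0"
    proof
      assume "1 - of_real (4 * z^2) / u^2 \<in> \<real>\<^sub>\<le>\<^sub>0"
      then obtain r where r: "1 - of_real (4 * z^2) / u^2 = of_real r" "r \<le> 0" by (auto elim: nonpos_Reals_cases)
      then have "of_real (4 * z^2) / u^2 = of_real (1 - r)" by (simp add: algebra_simps)
      then have "of_real (4 * z^2) = of_real (1 - r) * u^2" using u0 by (simp add: field_simps del: of_real_diff)
      then have "u^2 = of_real (4 * z^2 / (1 - r))" using r(2) by (simp add: field_simps)
      moreover have "4 * z^2 / (1 - r) \<le> 4 * z^2" using r(2) by (simp add: divide_le_eq algebra_simps mult_nonpos_nonneg)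
      ultimately show False using nk[of "4 * z^2 / (1 - r)"] r(2) by simp
    qed
    then show ?thesis using b u0 x0 w by simp
  qed
  then show "gb z x \<noteq> 0" "1 - 4 * ga z x * gc z x / (gb z x)^2 \<notin> \<real>\<^sub>\<le>\<^sub>0" by auto
qed

text \<open>In the variable p = xy the kernel reads p + 1/p = 1/z - (x + 1/x): it is symmetric in x
  and p, and its two solutions are reciprocal. The product, rather than \<open>Y0\<close>, is
  therefore the coordinate used throughout the x-plane.\<close>

definition xY0 :: "real \<Rightarrow> complex \<Rightarrow> complex" where
  "xY0 z x = x * small_root (ga z x) (gb z x) (gc z x)"

lemma xY0_eq:
  assumes z: "0 < z" "z < 1/4" and x: "x \<notin> segX z" "x \<notin> cutX z"
  shows "x * Y0 z x = xY0 z x"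
proof (cases "x = 0")
  case False
  then have "ga z x \<noteq> 0" using z by (simp add: ga_def)
  from smaller_root_select[OF this X_off_cuts[OF z x]]
  show ?thesis by (simp add: xY0_def Y0_def gd_def)
qed (simp add: xY0_def)

lemma xY0_inverse_sum:
  assumes z: "0 < z" "z < 1/4" and x: "x \<notin> segX z" "x \<notin> cutX z" "x \<noteq> 0"
  shows "xY0 z x \<noteq> 0" "norm (xY0 z x) < 1" "xY0 z x + inverse (xY0 z x) = of_real (1/z) - (x + inverse x)"
proof -
  note o = X_off_cuts[OF z x(1,2)]
  define y where "y = small_root (ga z x) (gb z x) (gc z x)"
  have c0: "gc z x \<noteq> 0" using z by (simp add: gc_def)
  have e: "ga z x * y^2 + gb z x * y + gc z x = 0" unfolding y_def by (rule small_root_eq[OF o(1)])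
  have y0: "y \<noteq> 0" using e c0 by auto
  have P: "xY0 z x = x * y" by (simp add: xY0_def y_def)
  show P0: "xY0 z x \<noteq> 0" using P y0 x by simp
  have "norm (ga z x * y^2) < norm (gc z x)" unfolding y_def by (rule small_root_norm[OF o(1) c0 o(2)])
  moreover have "norm (ga z x * y^2) = z * (norm (xY0 z x))^2" using z by (simp add: ga_def P norm_mult norm_power power_mult_distrib)
  ultimately have "(norm (xY0 z x))^2 < 1" using z by (simp add: gc_def)
  then show "norm (xY0 z x) < 1" by (metis abs_norm_cancel abs_square_less_1)
  have "of_real z * (x * y * (x * y + inverse (x * y) - (of_real (1/z) - (x + inverse x)))) = ga z x * y^2 + gb z x * y + gc z x"
    using x y0 z by (simp add: ga_def gb_def gc_def field_simps power2_eq_square)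
  then have "x * y + inverse (x * y) - (of_real (1/z) - (x + inverse x)) = 0" using e x y0 z by simp
  then show "xY0 z x + inverse (xY0 z x) = of_real (1/z) - (x + inverse x)" unfolding P by simp
qed

lemma xY0_unique:
  assumes z: "0 < z" "z < 1/4" and x: "x \<notin> segX z" "x \<notin> cutX z" "x \<noteq> 0"
    and p: "p \<noteq> 0" "norm p < 1" "p + inverse p = of_real (1/z) - (x + inverse x)"
  shows "xY0 z x = p"
proof -
  note P = xY0_inverse_sum[OF z x]
  have "xY0 z x = p \<or> xY0 z x = inverse p" using inverse_sum_eq_iff[OF P(1) p(1)] P(3) p(3) by simp
  moreover have "xY0 z x \<noteq> inverse p"
  proof
    assume "xY0 z x = inverse p"
    then have "norm (xY0 z x) * norm p = 1" using p(1) by (simp add: norm_inverse)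
    moreover have "norm (xY0 z x) * norm p < 1 * 1" using P(2) p by (intro mult_strict_mono) auto
    ultimately show False by simp
  qed
  ultimately show ?thesis by blast
qed

lemma xY0_holomorphic:
  assumes z: "0 < z" "z < 1/4"
  shows "xY0 z holomorphic_on - cutX z - segX z"
proof -
  have "gb z x * (1 + csqrt (1 - 4 * ga z x * gc z x / (gb z x)^2)) \<noteq> 0" "(gb z x)^2 \<noteq> 0"
    "1 - 4 * ga z x * gc z x / (gb z x)^2 \<notin> \<real>\<^sub>\<le>\<^sub>0" if "x \<in> - cutX z - segX z" for x
    using X_off_cuts[OF z, of x] that csqrt_not_minus_one by auto
  moreover have "ga z holomorphic_on A" "gb z holomorphic_on A" "gc z holomorphic_on A" for A
    unfolding ga_def[abs_def] gb_def[abs_def] gc_def[abs_def] by (intro holomorphic_intros)+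
  ultimately show ?thesis
    unfolding xY0_def[abs_def] small_root_def by (intro holomorphic_intros) auto
qed

text \<open>In the strip, sqrt d is \<open>cut_sqrt\<close> for x1, x2 times principal roots of x3 -
  x and x4 - x, up to sign. The sign is read off at x1/2, where b and d are positive and
  \<open>cut_sqrt\<close> is negative.\<close>

lemma xY0_slit:
  assumes z: "0 < z" "z < 1/4" and x: "0 < Re x" "Re x < x3 z" "x \<notin> segX z"
  shows "xY0 z x = - gb z x / (2 * of_real z * x) -
     cut_sqrt (x1 z) (x2 z) x * (csqrt (of_real (x3 z) - x) * csqrt (of_real (x4 z) - x) / (2 * x))"
proof -
  note R = x_roots[OF z]
  define g where "g = (\<lambda>x. gb z x * csqrt (1 - 4 * ga z x * gc z x / (gb z x)^2))"
  define h where "h = (\<lambda>x. - (of_real z * (csqrt (of_real (x3 z) - x) * csqrt (of_real (x4 z) - x))))"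
  have off: "x \<notin> cutX z" if "Re x < x3 z" for x
    using that R of_real_segment[of "x3 z" "x4 z"] by (auto simp: cutX_def)
  have pos: "of_real (x3 z) - x \<notin> \<real>\<^sub>\<le>\<^sub>0" "of_real (x4 z) - x \<notin> \<real>\<^sub>\<le>\<^sub>0" if "Re x < x3 z" for x
    using that R by (auto simp: complex_nonpos_Reals_iff)
  define p where "p = x1 z / 2"
  have p: "0 < p" "p < x1 z" using R by (auto simp: p_def)
  have gg: "gb z p > 0"
  proof -
    \<comment> \<open>This gives b(x1) = 2 z x1 > 0, and going left from x1 to p increases
      b.\<close>
    have "x1 z + inverse (x1 z) = 1/z + 2" using R(6,8) R(1) by (metis inverse_unique)
    then have "z * (x1 z)^2 - x1 z + z = 2 * z * x1 z" using R(1) z by (simp add: field_simps power2_eq_square)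
    moreover have "gb z p - (z * (x1 z)^2 - x1 z + z) = (x1 z - p) * (1 - z * (x1 z + p))"
      by (simp add: gb_def algebra_simps power2_eq_square)
    moreover have "z * (x1 z + p) < 1 * 1"
    proof -
      have "z * (x1 z + p) \<le> z * 2" using z R p by (intro mult_left_mono) auto
      also have "z * 2 < 1 * 1" using z by simp
      finally show ?thesis .
    qed
    then have "(x1 z - p) * (1 - z * (x1 z + p)) > 0" using p by simp
    moreover have "2 * z * x1 z > 0" using z R by simp
    ultimately show ?thesis by linarith
  qed
  have "g x = h x * cut_sqrt (x1 z) (x2 z) x"
  proof (rule slit_sqrt_factor[of 0 "x1 z" "x2 z" "x3 z" g h p])
    show "continuous_on ({x. 0 < Re x \<and> Re x < x3 z} - closed_segment (of_real (x1 z)) (of_real (x2 z))) g"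
    proof -
      have "(gb z x)^2 \<noteq> 0" "1 - 4 * ga z x * gc z x / (gb z x)^2 \<notin> \<real>\<^sub>\<le>\<^sub>0"
        if "x \<in> {x. 0 < Re x \<and> Re x < x3 z} - closed_segment (of_real (x1 z)) (of_real (x2 z))" for x
        using X_off_cuts[OF z, of x] off[of x] that by (auto simp: segX_def)
      moreover have "ga z holomorphic_on A" "gb z holomorphic_on A" "gc z holomorphic_on A" for A
        unfolding ga_def[abs_def] gb_def[abs_def] gc_def[abs_def] by (intro holomorphic_intros)+
      ultimately show ?thesis unfolding g_def
        by (intro holomorphic_on_imp_continuous_on holomorphic_intros) auto
    qed
    show "continuous_on {x. 0 < Re x \<and> Re x < x3 z} h"
      unfolding h_def using pos
      by (intro holomorphic_on_imp_continuous_on holomorphic_intros) auto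
    show "(g x)^2 = (h x)^2 * ((x - of_real (x1 z)) * (x - of_real (x2 z)))"
      if xx: "0 < Re x" "Re x < x3 z" "x \<notin> closed_segment (of_real (x1 z)) (of_real (x2 z))" for x
    proof -
      have "gb z x \<noteq> 0" using X_off_cuts(1)[OF z, of x] off[OF xx(2)] xx(3) by (simp add: segX_def)
      then have gd2: "(g x)^2 = gd z x" by (simp add: g_def gd_def power_mult_distrib algebra_simps)
      show ?thesis unfolding gd2 gd_factor[OF z] h_def by (simp add: power_mult_distrib algebra_simps)
    qed
    show "h x \<noteq> 0" if "0 < Re x" "Re x < x3 z" for x using pos[OF that(2)] z by (auto simp: h_def)
    show "0 < x1 z" "x1 z < x2 z" "x2 z < x3 z" "0 < p" "p < x1 z" using R p by auto
    show "0 < Re x" "Re x < x3 z" "x \<notin> closed_segment (of_real (x1 z)) (of_real (x2 z))" using x by (auto simp: segX_def)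
    have w: "1 - 4 * ga z p * gc z p / (gb z p)^2 > 0"
    proof -
      have "gd z p > 0" using gd_real_le_0[OF z, of p] p R by auto
      then have "4 * ga z p * gc z p < (gb z p)^2" by (simp add: gd_def)
      then show ?thesis using gg by (simp add: divide_less_eq)
    qed
    have cr: "ga z (complex_of_real p) = of_real (ga z p)" "gb z (complex_of_real p) = of_real (gb z p)" "gc z (complex_of_real p) = of_real (gc z p)"
      by (simp_all add: ga_def gb_def gc_def)
    have "1 - 4 * ga z (complex_of_real p) * gc z (of_real p) / (gb z (of_real p))^2 = of_real (1 - 4 * ga z p * gc z p / (gb z p)^2)"
      unfolding cr by simp
    then show "g (of_real p) = of_real (gb z p * sqrt (1 - 4 * ga z p * gc z p / (gb z p)^2))"
      unfolding g_def using w by (simp add: csqrt_of_real cr)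
    have "of_real (x3 z) - complex_of_real p = of_real (x3 z - p)" "of_real (x4 z) - complex_of_real p = of_real (x4 z - p)" by auto
    then show "h (of_real p) = of_real (- (z * (sqrt (x3 z - p) * sqrt (x4 z - p))))"
      unfolding h_def using R p by (simp add: csqrt_of_real del: of_real_diff)
    have "sqrt (x3 z - p) * sqrt (x4 z - p) > 0" using R p by simp
    then show "(gb z p * sqrt (1 - 4 * ga z p * gc z p / (gb z p)^2)) * (- (z * (sqrt (x3 z - p) * sqrt (x4 z - p)))) < 0"
      using gg w z by (simp add: mult_pos_pos)
  qed
  moreover have x0: "x \<noteq> 0" using x by auto
  then have "ga z x \<noteq> 0" using z by (simp add: ga_def)
  from small_root_alt[OF this X_off_cuts(1)[OF z x(3) off[OF x(2)]]]
  have "xY0 z x = x * ((- gb z x + g x) / (2 * ga z x))" by (simp add: xY0_def g_def)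
  ultimately have "xY0 z x = x * ((- gb z x + h x * cut_sqrt (x1 z) (x2 z) x) / (2 * (of_real z * x^2)))" by (simp add: ga_def)
  also have "\<dots> = (- gb z x + h x * cut_sqrt (x1 z) (x2 z) x) / (2 * of_real z * x)" using x0 by (simp add: power2_eq_square)
  also have "\<dots> = - gb z x / (2 * of_real z * x) + h x * cut_sqrt (x1 z) (x2 z) x / (2 * of_real z * x)"
    by (rule add_divide_distrib)
  also have "h x * cut_sqrt (x1 z) (x2 z) x / (2 * of_real z * x) =
     - (cut_sqrt (x1 z) (x2 z) x * (csqrt (of_real (x3 z) - x) * csqrt (of_real (x4 z) - x) / (2 * x)))"
    using z x0 by (simp add: h_def)
  finally show ?thesis by simp
qed

section \<open>The branch points in the y-plane\<close>

lemma y_roots: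
  assumes z: "0 < z" "z < 1/4"
  shows "0 < y2 z" "y2 z < 1" "1 < y3 z" "y2 z * y3 z = 1" "y2 z + y3 z = 1/(4*z^2) - 2"
proof -
  have "(4*z)^2 < 1^2" using z by (intro power_strict_mono) auto
  then have z2: "16*z^2 < 1" by (simp add: power_mult_distrib)
  define s where "s = sqrt (1 - 16*z^2)"
  have s: "s > 0" "s^2 = 1 - 16*z^2" using z2 by (auto simp: s_def)
  have Y: "y2 z = (1 - 8*z^2 - s) / (8*z^2)" "y3 z = (1 - 8*z^2 + s) / (8*z^2)"
    by (simp_all add: y2_def y3_def s_def)
  have zp: "0 < z^2" using z by simp
  have s1: "s < 1 - 8*z^2"
  proof (rule power2_less_imp_less)
    have "(1 - 8*z^2)^2 = s^2 + 64 * (z^2)^2" unfolding s(2) by (simp add: power2_eq_square algebra_simps)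
    then show "s^2 < (1 - 8*z^2)^2" using zp by simp
  qed (use z2 in simp)
  show p: "0 < y2 z" using s1 zp by (simp add: Y)
  show m: "y2 z * y3 z = 1"
  proof -
    have "(1 - 8*z^2 - s) * (1 - 8*z^2 + s) = (1-8*z^2)^2 - s^2" by (simp add: algebra_simps power2_eq_square)
    also have "\<dots> = (8*z^2) * (8*z^2)" unfolding s(2) by (simp add: algebra_simps power2_eq_square)
    finally show ?thesis unfolding Y using z by simp
  qed
  show "y2 z + y3 z = 1/(4*z^2) - 2" unfolding Y using zp by (simp add: field_simps)
  have l: "y2 z < y3 z" unfolding Y using s zp by (intro divide_strict_right_mono) auto
  show y21: "y2 z < 1"
  proof (rule ccontr)
    assume "\<not> y2 z < 1"
    then have "1 * 1 < y2 z * y3 z" using l by (intro mult_le_less_imp_less) auto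
    then show False using m by simp
  qed
  show "1 < y3 z"
  proof (rule ccontr)
    assume "\<not> 1 < y3 z"
    then have "y2 z * y3 z \<le> y2 z * 1" using p by (intro mult_left_mono) auto
    then show False using m y21 by simp
  qed
qed

lemma td_factor:
  fixes y :: "'a::real_field"
  assumes z: "0 < z" "z < 1/4"
  shows "td z y = - (4 * of_real z ^ 2 * y * ((y - of_real (y2 z)) * (y - of_real (y3 z))))"
proof -
  define Z where "Z = (of_real z :: 'a)"
  have Z0: "Z \<noteq> 0" using z by (simp add: Z_def)
  have "(y - of_real (y2 z)) * (y - of_real (y3 z)) = y^2 - of_real (y2 z + y3 z) * y + of_real (y2 z * y3 z)"
    by (simp add: algebra_simps power2_eq_square)
  also have "\<dots> = y^2 - (1/(4*Z^2) - 2) * y + 1" unfolding y_roots(4,5)[OF z] by (simp add: Z_def)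
  finally have "4 * Z^2 * ((y - of_real (y2 z)) * (y - of_real (y3 z))) = 4 * Z^2 * (y + 1)^2 - y"
    using Z0 by (simp add: field_simps power2_eq_square)
  moreover have "td z y = - (y * (4 * Z^2 * (y + 1)^2 - y))"
    by (simp add: td_def ta_def tb_def tc_def Z_def algebra_simps power2_eq_square)
  ultimately have "td z y = - (y * (4 * Z^2 * ((y - of_real (y2 z)) * (y - of_real (y3 z)))))" by simp
  then show ?thesis by (simp add: Z_def mult_ac)
qed

lemma td_real_le_0:
  assumes z: "0 < z" "z < 1/4"
  shows "td z (t::real) \<le> 0 \<longleftrightarrow> 0 \<le> t \<and> (t \<le> y2 z \<or> y3 z \<le> t)"
proof -
  note R = y_roots[OF z]
  have "td z t = - (4 * z^2 * (t * ((t - y2 z) * (t - y3 z))))" using td_factor[OF z, of t] by simp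
  then have "td z t \<le> 0 \<longleftrightarrow> 0 \<le> t * ((t - y2 z) * (t - y3 z))" using z by (simp add: zero_le_mult_iff)
  also have "\<dots> \<longleftrightarrow> 0 \<le> t \<and> (t \<le> y2 z \<or> y3 z \<le> t)"
    using R(1-3) by (auto simp: zero_le_mult_iff mult_le_0_iff)
  finally show ?thesis .
qed

lemma td_real_alt: "td z (t::real) = t^2 - 4 * z^2 * t * (t+1)^2"
  by (simp add: td_def ta_def tb_def tc_def algebra_simps power2_eq_square)

section \<open>The curve and the domain of the x-plane\<close>

text \<open>For x \<noteq> 0 this is 2 z |x|^2 (Re (x + 1/x) - 1/(2z)), multiplied out so as to be
  continuous at 0. It results from eliminating y from |x|^2 = 1/y and Re x = 1/(2z(y + 1)), the
  modulus and real part of the conjugate roots over y.\<close>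

definition psiX :: "real \<Rightarrow> complex \<Rightarrow> real" where
  "psiX z x = 2 * z * Re x * ((norm x)^2 + 1) - (norm x)^2"

lemma psiX_alt:
  assumes "x \<noteq> 0" "z > 0"
  shows "psiX z x = 2 * z * (norm x)^2 * (Re (x + inverse x) - 1/(2*z))"
proof -
  have n: "(norm x)^2 \<noteq> 0" using assms by simp
  have i: "Re (inverse x) = Re x / (norm x)^2" by (simp add: cmod_power2)
  show ?thesis unfolding plus_complex.sel i psiX_def using n assms by (simp add: field_simps)
qed

lemma psiX_sign:
  assumes "x \<noteq> 0" "z > 0"
  shows "psiX z x < 0 \<longleftrightarrow> Re (x + inverse x) < 1/(2*z)" "psiX z x = 0 \<longleftrightarrow> Re (x + inverse x) = 1/(2*z)"
    "0 < psiX z x \<longleftrightarrow> 1/(2*z) < Re (x + inverse x)"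
proof -
  have k: "0 < 2 * z * (norm x)^2" using assms by simp
  have "(k * (r - s) < 0 \<longleftrightarrow> r < s) \<and> (k * (r - s) = 0 \<longleftrightarrow> r = s) \<and> (0 < k * (r - s) \<longleftrightarrow> s < r)" if "0 < k" for k r s :: real
    using that by (auto simp: mult_less_0_iff zero_less_mult_iff)
  from this[OF k] show "psiX z x < 0 \<longleftrightarrow> Re (x + inverse x) < 1/(2*z)" "psiX z x = 0 \<longleftrightarrow> Re (x + inverse x) = 1/(2*z)"
    "0 < psiX z x \<longleftrightarrow> 1/(2*z) < Re (x + inverse x)"
    unfolding psiX_alt[OF assms] by blast+
qed

text \<open>The parameter is recovered as y = 1/|x|^2. For |x| > 1 it is below 1, and |Re x| \<le>
  |x| becomes \<open>td z y \<le> 0\<close>, which then means y \<le> y2.\<close>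

lemma Xcurve_eq:
  assumes z: "0 < z" "z < 1/4"
  shows "Xcurve z = {x. 1 < norm x \<and> psiX z x = 0}"
proof -
  note R = y_roots[OF z]
  have 1: "p = (of_real (- tb z y) - \<i> * of_real (sqrt (- td z y))) / of_real (2 * ta z y) \<or>
        p = (of_real (- tb z y) + \<i> * of_real (sqrt (- td z y))) / of_real (2 * ta z y)
     \<longleftrightarrow> (norm p)^2 = 1/y \<and> Re p = 1 / (2*z*(y+1))" if y: "0 < y" "y \<le> y2 z" for y p
  proof -
    have a: "ta z y > 0" using y z by (simp add: ta_def)
    have d: "tb z y ^ 2 - 4 * ta z y * tc z y \<le> 0" using td_real_le_0[OF z, of y] y by (simp add: td_def)
    have "ta z y * (norm p)^2 = tc z y \<longleftrightarrow> (norm p)^2 = 1/y"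
    proof -
      have "z * (y + 1) \<noteq> 0" using y z by auto
      moreover have "ta z y * (norm p)^2 = tc z y \<longleftrightarrow> z * (y + 1) * (y * (norm p)^2) = z * (y + 1) * 1"
        by (simp add: ta_def tc_def mult_ac)
      ultimately have "ta z y * (norm p)^2 = tc z y \<longleftrightarrow> y * (norm p)^2 = 1" using mult_left_cancel by blast
      then show ?thesis using y by (auto simp: field_simps)
    qed
    moreover have "2 * ta z y * Re p = - tb z y \<longleftrightarrow> Re p = 1 / (2*z*(y+1))"
    proof -
      have "2*z*(y+1) > 0" using y z by simp
      moreover have "2 * ta z y * Re p = - tb z y \<longleftrightarrow> y * (2*z*(y+1) * Re p) = y * 1" by (simp add: ta_def tb_def mult_ac)
      ultimately show ?thesis using y z by (simp add: eq_divide_eq mult_ac)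
    qed
    ultimately show ?thesis using conjugate_roots_iff[OF a d, of p] by (simp add: td_def)
  qed
  have "Xcurve z = {p. \<exists>y. 0 < y \<and> y \<le> y2 z \<and> ((norm p)^2 = 1/y \<and> Re p = 1 / (2*z*(y+1)))}"
    unfolding Xcurve_def y1_def using 1 by blast
  also have "\<dots> = {x. 1 < norm x \<and> psiX z x = 0}"
  proof (intro set_eqI iffI; clarify)
    fix p y assume y: "0 < y" "y \<le> y2 z" and p: "(norm p)^2 = 1/y" "Re p = 1 / (2*z*(y+1))"
    have "1 < (norm p)^2" using y R p by simp
    then have "1 < norm p" by (metis one_power2 power2_less_imp_less norm_ge_zero)
    moreover have "psiX z p = 0" unfolding psiX_def p using y z by (simp add: divide_simps)
    ultimately show "1 < norm p \<and> psiX z p = 0" ..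
  next
    fix p assume p: "1 < norm p" "psiX z p = 0"
    define y where "y = 1 / (norm p)^2"
    have n: "1 < (norm p)^2" using p by (metis one_less_power pos2)
    have y: "0 < y" "y < 1" and np: "(norm p)^2 = 1/y" using n by (auto simp: y_def divide_less_eq)
    have "2 * z * Re p * (1/y + 1) = 1/y" using p(2) by (simp add: psiX_def np)
    then have "2 * z * Re p * (y + 1) = 1" using y by (simp add: field_simps)
    then have "Re p * (2*z*(y+1)) = 1" by (simp only: mult_ac)
    moreover have "2*z*(y+1) \<noteq> 0" using y z by auto
    ultimately have re: "Re p = 1 / (2*z*(y+1))" using nonzero_eq_divide_eq by blast
    have "(Re p)^2 \<le> (norm p)^2" by (simp add: cmod_power2)
    then have "1 / (2*z*(y+1))^2 \<le> 1/y" unfolding np re by (simp add: power_divide)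
    then have "y \<le> (2*z*(y+1))^2" using y z by (simp add: divide_simps split: if_splits)
    then have "y * y \<le> y * (2*z*(y+1))^2" using y by (intro mult_left_mono) auto
    then have "td z y \<le> 0" unfolding td_real_alt by (simp add: power2_eq_square algebra_simps)
    then have "y \<le> y2 z" using td_real_le_0[OF z, of y] y R by linarith
    then show "\<exists>y. 0 < y \<and> y \<le> y2 z \<and> ((norm p)^2 = 1/y \<and> Re p = 1 / (2*z*(y+1)))" using y np re by blast
  qed
  finally show ?thesis .
qed

lemma GX_region:
  assumes z: "0 < z" "z < 1/4"
  shows "GX z = {x. norm x \<le> 1 \<or> psiX z x < 0}" "open (GX z)" "closure (GX z) = GX z \<union> Xcurve z"
    "frontier (GX z) = Xcurve z" "\<And>t. t \<in> Xcurve z \<Longrightarrow> t islimpt Xcurve z"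
proof -
  note R = x_roots[OF z]
  have c: "continuous_on UNIV (psiX z)" unfolding psiX_def by (intro continuous_intros)
  have n: "psiX z x < 0" if "norm x = 1" for x
  proof -
    have "4 * (z * Re x) \<le> 4 * (z * 1)" using z that complex_Re_le_cmod[of x] by (intro mult_left_mono) auto
    then have "4 * (z * Re x) < 1" using z by linarith
    then show ?thesis using that by (simp add: psiX_def)
  qed
  have m: "psiX z (of_real s * x) < 0" if s: "1 < s * norm x" "0 < s" "s < 1" "psiX z x \<le> 0" for x s
  proof -
    define r where "r = norm x"
    have r: "1 < s * r" using s by (simp add: r_def)
    have "s * r \<le> 1 * r" using s by (intro mult_right_mono) (auto simp: r_def)
    then have r1: "1 < r" using r by simp
    have r2: "r^2 + 1 > 0" by (simp add: add_nonneg_pos)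
    have "1 * 1 < (s * r) * r" using r r1 by (intro mult_strict_mono) auto
    then have sr: "1 < s * r^2" by (simp add: power2_eq_square mult_ac)
    define A where "A = 2 * z * Re x"
    have A: "A * (r^2 + 1) \<le> r^2" using s(4) by (simp add: psiX_def A_def r_def)
    \<comment> \<open>The factor r^2 + 1 allows the hypothesis A (r^2 + 1) \<le> r^2 to be inserted;
      what is left is s r^2 (1 - s)(1 - s r^2), negative because s r^2 > 1.\<close>
    have "(r^2 + 1) * psiX z (of_real s * x) = s * (A * (r^2 + 1)) * (s^2 * r^2 + 1) - s^2 * r^2 * (r^2 + 1)"
      using s by (simp add: psiX_def norm_mult r_def A_def power_mult_distrib algebra_simps)
    also have "\<dots> \<le> s * r^2 * (s^2 * r^2 + 1) - s^2 * r^2 * (r^2 + 1)"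
      using s A by (intro diff_right_mono mult_right_mono mult_left_mono) auto
    also have "\<dots> = s * r^2 * ((1 - s) * (1 - s * r^2))" by (simp add: algebra_simps power2_eq_square)
    also have "\<dots> < 0" using s r1 sr by (simp add: mult_less_0_iff zero_less_mult_iff)
    finally show ?thesis using r2 by (simp add: mult_less_0_iff)
  qed
  have p: "complex_of_real (x1 z) \<in> ball 0 1" using R by simp
  note S = starlike_component[OF c n m p, folded Xcurve_eq[OF z]]
  have GX: "GX z = {x. norm x \<le> 1 \<or> psiX z x < 0}" unfolding GX_def using S(1) by simp
  then show "GX z = {x. norm x \<le> 1 \<or> psiX z x < 0}" .
  show "open (GX z)" "closure (GX z) = GX z \<union> Xcurve z"
    "frontier (GX z) = Xcurve z" "\<And>t. t \<in> Xcurve z \<Longrightarrow> t islimpt Xcurve z"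
    unfolding GX using S(2-5) by auto
qed

lemma X_cuts_real:
  assumes z: "0 < z" "z < 1/4"
  shows "segX z = of_real ` {x1 z..x2 z}" "cutX z = of_real ` {x3 z..x4 z}"
  unfolding segX_def cutX_def using x_roots[OF z] by (intro of_real_segment; simp)+

text \<open>The involution x \<mapsto> 1/(x Y0(x)) sends x + 1/x to 1/z - (x + 1/x). It leaves the
  closed disc since |x Y0(x)| < 1, and it avoids the cuts because otherwise x + 1/x would lie in
  [-2, 2] and |x| would be 1. Symmetry of the relation makes it an involution.\<close>

lemma X_exterior:
  assumes z: "0 < z" "z < 1/4" and x: "x \<in> - cutX z - cball 0 1"
  shows "x \<notin> segX z" "x \<notin> cutX z" "x \<noteq> 0" "1 < norm x" "inverse (xY0 z x) \<in> - cutX z - cball 0 1"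
    "xY0 z (inverse (xY0 z x)) = inverse x"
    "inverse (xY0 z x) + inverse (inverse (xY0 z x)) = of_real (1/z) - (x + inverse x)"
proof -
  show n: "1 < norm x" and c: "x \<notin> cutX z" using x by auto
  show s: "x \<notin> segX z" using n x_roots[OF z] by (auto simp: X_cuts_real[OF z])
  show x0: "x \<noteq> 0" using n by auto
  note P = xY0_inverse_sum[OF z s c x0]
  show sum: "inverse (xY0 z x) + inverse (inverse (xY0 z x)) = of_real (1/z) - (x + inverse x)"
    using P(3) by (simp add: add.commute)
  have i: "1 < norm (inverse (xY0 z x))" using P(1,2) by (simp add: norm_inverse one_less_inverse_iff)
  have i0: "inverse (xY0 z x) \<noteq> 0" using P(1) by simp
  have nc: "inverse (xY0 z x) \<notin> segX z \<union> cutX z"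
  proof
    assume "inverse (xY0 z x) \<in> segX z \<union> cutX z"
    then obtain v where v: "inverse (xY0 z x) + inverse (inverse (xY0 z x)) = of_real v" "\<bar>v - 1/z\<bar> \<le> 2"
      using X_cuts_inverse_sum[OF z i0] by blast
    have "x + inverse x = of_real (1/z - v)" using v(1) sum by (simp add: algebra_simps)
    then have "norm x = 1" by (rule inverse_sum_segment_imp_unit[OF x0]) (use v in simp)
    then show False using n by simp
  qed
  then show "inverse (xY0 z x) \<in> - cutX z - cball 0 1" using i by auto
  show "xY0 z (inverse (xY0 z x)) = inverse x"
  proof (rule xY0_unique[OF z])
    show "norm (inverse x) < 1" using n by (simp add: norm_inverse inverse_less_1_iff)
    show "inverse x + inverse (inverse x) = of_real (1/z) - (inverse (xY0 z x) + inverse (inverse (xY0 z x)))"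
      unfolding sum by (simp add: add.commute)
  qed (use nc i0 x0 in auto)
qed

lemma connected_exterior_X:
  assumes z: "0 < z" "z < 1/4"
  shows "connected (- cutX z - cball 0 1)"
  by (rule connected_exterior_minus_positive_reals) (use x_roots[OF z] in \<open>auto simp: X_cuts_real[OF z]\<close>)

text \<open>The series identity holds where both |x| < 1 and |Y0(x)| < 1. The open set W where
  |Y0(x)| < 1 contains the whole exterior domain, because |x Y0(x)| < 1 there, and analytic
  continuation inside W carries the identity over.\<close>

lemma F_exterior:
  assumes z: "0 < z" "z < 1/4"
    and F: "F holomorphic_on (- cutX z)" "\<forall>x\<in>ball 0 1. F x = Q x 0 z"
    and G: "G holomorphic_on (- cutY z)" "\<forall>y\<in>ball 0 1. G y = (y + 1) * Q 0 y z"
    and x: "x \<in> - cutX z - cball 0 1"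
  shows "of_real z * F x - xY0 z x = of_real z * Q 0 0 z - of_real z * G (xY0 z x / x)"
proof -
  note R = x_roots[OF z]
  define A where "A = - cutX z - segX z - {0}"
  have closed: "closed (cutX z)" "closed (segX z)" by (auto simp: cutX_def segX_def)
  have opA: "open A" unfolding A_def using closed by (intro open_Diff) auto
  have hy: "(\<lambda>x. xY0 z x / x) holomorphic_on A"
    using holomorphic_on_subset[OF xY0_holomorphic[OF z], of A] by (intro holomorphic_intros) (auto simp: A_def)
  define W where "W = A \<inter> (\<lambda>x. xY0 z x / x) -` ball 0 1"
  have opW: "open W" unfolding W_def
    by (rule continuous_open_preimage[OF holomorphic_on_imp_continuous_on[OF hy] opA]) auto
  have WA: "W \<subseteq> A" by (auto simp: W_def)
  define \<Phi> where "\<Phi> = (\<lambda>x. of_real z * F x - xY0 z x - (of_real z * Q 0 0 z - of_real z * G (xY0 z x / x)))"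
  have outY: "y \<notin> cutY z" if "norm y < 1" for y using that y_roots[OF z] by (auto simp: cutY_def)
  have "\<Phi> x = 0"
  proof (rule identity_on_exterior[of W \<Phi> "- cutX z - cball 0 1"])
    have "(\<lambda>x. G (xY0 z x / x)) holomorphic_on W"
      by (rule holomorphic_on_compose_gen[OF holomorphic_on_subset[OF hy WA] G(1), unfolded o_def])
         (use outY in \<open>auto simp: W_def\<close>)
    moreover have "xY0 z holomorphic_on W" "F holomorphic_on W"
      using WA by (auto simp: A_def intro: holomorphic_on_subset[OF xY0_holomorphic[OF z]] holomorphic_on_subset[OF F(1)])
    ultimately show "\<Phi> holomorphic_on W" unfolding \<Phi>_def by (intro holomorphic_intros)
    have m1: "-1 \<notin> segX z" "-1 \<notin> cutX z"
      using R unfolding X_cuts_real[OF z] by (auto simp: complex_eq_iff)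
    \<comment> \<open>At x = -1 the moduli of Y0(x) and x Y0(x) agree, so W connects the disc to the
      exterior at this point.\<close>
    show "-1 \<in> W" using m1 xY0_inverse_sum(2)[OF z m1] by (simp add: W_def A_def)
    show "- cutX z - cball 0 1 \<subseteq> W"
    proof
      fix x assume x: "x \<in> - cutX z - cball 0 1"
      note E = X_exterior[OF z x]
      have "norm (xY0 z x) < 1 * norm x" using xY0_inverse_sum(2)[OF z E(1-3)] E(4) by simp
      then have "norm (xY0 z x / x) < 1" unfolding norm_divide using E(3) by (simp add: divide_less_eq)
      then show "x \<in> W" using E(1-3) by (simp add: W_def A_def)
    qed
    show "W - cball 0 1 \<subseteq> - cutX z - cball 0 1" using WA by (auto simp: A_def)
    show "open (- cutX z - cball 0 1)" using closed by auto
    show "connected (- cutX z - cball 0 1)" by (rule connected_exterior_X[OF z])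
    show "\<Phi> x = 0" if x: "x \<in> W" "norm x < 1" for x
    proof -
      have xA: "x \<notin> segX z" "x \<notin> cutX z" "x \<noteq> 0" using x WA by (auto simp: A_def)
      define y where "y = xY0 z x / x"
      have ysr: "y = small_root (ga z x) (gb z x) (gc z x)" using xA(3) by (simp add: y_def xY0_def)
      have y1: "norm y < 1" using x by (simp add: W_def y_def)
      have "ga z x * y^2 + gb z x * y + gc z x = 0"
        unfolding ysr by (rule small_root_eq[OF X_off_cuts(1)[OF z xA(1,2)]])
      then have "of_real z * (y + 1) * (1 + x^2 * y) = x * y"
        by (simp add: ga_def gb_def gc_def algebra_simps power2_eq_square)
      then have "of_real z * Q x 0 z + of_real z * (y + 1) * Q 0 y z - of_real z * Q 0 0 z = x * y"
        using x y1 by (intro kernel_functional_equation[OF z]) auto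
      moreover have "F x = Q x 0 z" "G y = (y + 1) * Q 0 y z" using F(2) G(2) x y1 by auto
      moreover have "x * y = xY0 z x" using xA(3) by (simp add: y_def)
      ultimately show ?thesis unfolding \<Phi>_def y_def[symmetric] by (simp add: algebra_simps)
    qed
  qed (use opW x in auto)
  then show ?thesis by (simp add: \<Phi>_def)
qed

text \<open>The involution keeps Y0(x), as x Y0(x) becomes 1/x while x becomes 1/(x Y0(x)); by
  \<open>F_exterior\<close> f depends on Y0(x) only outside the disc. The domain is unbounded here,
  so f also has to be bounded near infinity.\<close>

theorem X_formula:
  assumes z: "0 < z" "z < 1/4"
    and w: "mero_on (- cutX z) w" "CGF (GX z) w"
    and F: "F holomorphic_on (- cutX z)" "\<forall>x\<in>ball 0 1. F x = Q x 0 z"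
    and G: "G holomorphic_on (- cutY z)" "\<forall>y\<in>ball 0 1. G y = (y + 1) * Q 0 y z"
    and x: "x \<notin> cutX z" "x \<notin> segX z"
  shows "of_real z * (F x - Q 0 0 z) =
          x * Y0 z x + of_real (1/pi) *
            integral {x1 z..x2 z} (\<lambda>t. of_real (t * sqrt (- gd z t) / (2 * ga z t)) *
               (kern w x (of_real t) - kern w 0 (of_real t)))"
proof -
  note R = x_roots[OF z] and GXr = GX_region[OF z]
  define D where "D = - cutX z"
  have bcut: "bounded (cutX z)" unfolding cutX_def by (intro compact_imp_bounded compact_segment)
  define f where "f = (\<lambda>x. of_real z * F x - xY0 z x)"
  define B where "B = (\<lambda>x. of_real z * F x + gb z x / (2 * of_real z * x))"
  define \<rho> where "\<rho> = (\<lambda>x. csqrt (of_real (x3 z) - x) * csqrt (of_real (x4 z) - x) / (2 * x))"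
  define U where "U = {x. 0 < Re x \<and> Re x < x3 z}"
  define \<iota> where "\<iota> = (\<lambda>x. inverse (xY0 z x))"
  \<comment> \<open>On the outer cut x + 1/x is at least 1/z - 2, which exceeds 1/(2z) because z <
    1/4.\<close>
  have cut_out: "x \<notin> closure (GX z)" if "x \<in> cutX z" for x
  proof -
    obtain t where tt: "x = of_real t" "t \<in> {x3 z..x4 z}" using \<open>x \<in> cutX z\<close> X_cuts_real(2)[OF z] by blast
    then have t: "x = of_real t" "gd z t \<le> 0" "x3 z \<le> t" "t \<le> x4 z" using gd_real_le_0[OF z, of t] by auto
    have t1: "1 < t" using R t by simp
    have "\<bar>t + inverse t - 1/z\<bar> \<le> 2" using gd_real_inverse_sum[OF z(1), of t] t t1 by simp
    moreover have "2 < 1/(2*z)" "1/z = 1/(2*z) + 1/(2*z)" using z by (auto simp: field_simps)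
    ultimately have "t + inverse t > 1/(2*z)" by linarith
    moreover have "x + inverse x = of_real (t + inverse t)" by (simp add: t(1))
    then have re: "Re (x + inverse x) = t + inverse t" by (metis Re_complex_of_real)
    moreover have x0: "x \<noteq> 0" using t(1) t1 by simp
    ultimately have "psiX z x > 0" unfolding psiX_sign[OF x0 z(1)] re by simp
    moreover have "\<not> norm x \<le> 1" using t t1 by simp
    ultimately have "x \<notin> GX z" "x \<notin> Xcurve z" by (simp_all add: GXr(1) Xcurve_eq[OF z])
    then show ?thesis using GXr(3) by blast
  qed
  have \<Omega>D: "D - cball 0 1 = - cutX z - cball 0 1" by (simp add: D_def)
  have fext: "f x = of_real z * Q 0 0 z - of_real z * G (xY0 z x / x)" if "x \<in> D - cball 0 1" for x
    using F_exterior[OF z F G] that by (simp add: D_def f_def)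
  have x: "x \<in> D - closed_segment (of_real (x1 z)) (of_real (x2 z))" using x by (simp add: D_def segX_def)
  have main: "f x - (if 0 \<in> closed_segment (complex_of_real (x1 z)) (of_real (x2 z)) then B 0 else f 0) = of_real (1/pi) *
     integral {x1 z..x2 z} (\<lambda>t. of_real (sqrt ((t - x1 z)*(x2 z - t))) * \<rho> (of_real t) * (kern w x (of_real t) - kern w 0 (of_real t)))"
  proof -
    have ne: "frontier (GX z) \<noteq> {}"
      using w(2) unfolding frontier_eq_empty CGF_def by blast
    then obtain t0 where t0: "t0 \<in> frontier (GX z)" by blast
    show ?thesis
    proof (rule gluing_CGF[where D = D and C = "GX z" and \<iota> = \<iota> and U = U and ?t0.0 = t0])
      have "convex (cutX z)" by (simp add: cutX_def)
      then show "connected D" unfolding D_def using bcut by (intro connected_complement_bounded_convex) auto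
      show "x1 z < x2 z" by (rule R)
      show "mero_on D w" using w by (simp add: D_def)
      show "CGF (GX z) w" by (rule w)
      show "ball 0 1 \<subseteq> GX z" unfolding GXr(1) by auto
      show "closed_segment (of_real (x1 z)) (of_real (x2 z)) \<subseteq> ball (0::complex) 1"
        using R X_cuts_real(1)[OF z] by (auto simp: segX_def)
      show "closure (GX z) \<subseteq> D" using cut_out by (auto simp: D_def)
      show "connected (D - cball 0 1)" unfolding \<Omega>D by (rule connected_exterior_X[OF z])
      show "frontier (GX z) \<inter> cball 0 1 = {}" unfolding GXr(4) Xcurve_eq[OF z] by auto
      show "\<iota> holomorphic_on D - cball 0 1"
        unfolding \<iota>_def \<Omega>D
        by (intro holomorphic_intros holomorphic_on_subset[OF xY0_holomorphic[OF z]])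
           (use X_exterior(1-3)[OF z] xY0_inverse_sum(1)[OF z] in blast)+
      show "\<iota> x \<in> D - cball 0 1" if "x \<in> D - cball 0 1" for x
        using X_exterior(5)[OF z] that unfolding \<Omega>D \<iota>_def .
      show "\<iota> (\<iota> x) = x" if "x \<in> D - cball 0 1" for x
        using X_exterior(6)[OF z] that unfolding \<Omega>D \<iota>_def by simp
      show "\<iota> x = cnj x" if xf: "x \<in> frontier (GX z)" for x
      proof -
        have xc: "1 < norm x" "psiX z x = 0" using xf unfolding GXr(4) Xcurve_eq[OF z] by auto
        have "x \<in> closure (GX z)" using xf by (simp add: frontier_def)
        then have xe: "x \<in> - cutX z - cball 0 1" using cut_out xc by auto
        note E = X_exterior[OF z xe]
        \<comment> \<open>On the curve, 1/z - u is the conjugate of u = x + 1/x, so the partner of x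
          is its conjugate.\<close>
        have "Re (x + inverse x) = 1/(2*z)" using psiX_sign[OF E(3) z(1)] xc(2) by blast
        moreover have "cnj u = of_real (1/z) - u" if "Re u = 1/(2*z)" for u
          using that by (simp add: complex_eq_iff)
        ultimately have "cnj (x + inverse x) = of_real (1/z) - (x + inverse x)" by blast
        then have "inverse (cnj x) + inverse (inverse (cnj x)) = of_real (1/z) - (x + inverse x)" by (simp add: add.commute)
        moreover have "norm (inverse (cnj x)) < 1" using E(4) by (simp add: norm_inverse inverse_less_1_iff)
        ultimately have "xY0 z x = inverse (cnj x)" using E(3) by (intro xY0_unique[OF z E(1-3)]) auto
        then show ?thesis by (simp add: \<iota>_def)
      qed
      show "\<iota> x \<in> GX z" if xo: "x \<in> D - closure (GX z)" for x
      proof -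
        have "x \<notin> GX z" "x \<notin> Xcurve z" using xo unfolding GXr(3) by auto
        then have xg: "\<not> norm x \<le> 1" "\<not> psiX z x < 0" "\<not> (1 < norm x \<and> psiX z x = 0)"
          by (auto simp: GXr(1) Xcurve_eq[OF z])
        then have xe: "x \<in> - cutX z - cball 0 1" and ps: "psiX z x > 0" using xo by (auto simp: D_def)
        note E = X_exterior[OF z xe]
        \<comment> \<open>The relation u + u' = 1/z reflects one side of Re u = 1/(2z) into the
          other.\<close>
        have "Re (x + inverse x) > 1/(2*z)" 
          using ps psiX_sign[OF E(3) z(1)] by blast
        moreover have "Re (\<iota> x + inverse (\<iota> x)) = 1/z - Re (x + inverse x)"
          unfolding \<iota>_def E(7) by (simp del: inverse_complex.sel plus_complex.sel)
        moreover have "1/z = 1/(2*z) + 1/(2*z)" using z by simp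
        ultimately have "Re (\<iota> x + inverse (\<iota> x)) < 1/(2*z)" by linarith
        moreover have "\<iota> x \<noteq> 0" using E(5) by (auto simp: \<iota>_def)
        ultimately have "psiX z (\<iota> x) < 0" using psiX_sign(1)[of "\<iota> x" z] z(1) by blast
        then show ?thesis by (simp add: GXr(1))
      qed
      show "t0 \<in> frontier (GX z)" by (rule t0)
      show "t0 islimpt frontier (GX z)" using t0 GXr(5) unfolding GXr(4) by blast
      show "f holomorphic_on D - closed_segment (of_real (x1 z)) (of_real (x2 z))"
        unfolding f_def D_def using xY0_holomorphic[OF z] F(1)
        by (auto simp: segX_def intro!: holomorphic_intros intro: holomorphic_on_subset)
      show "f (\<iota> x) = f x" if xx: "x \<in> D - cball 0 1" for x
      proof -
        have xe: "x \<in> - cutX z - cball 0 1" using xx by (simp add: D_def)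
        note E = X_exterior[OF z xe]
        have "\<iota> x \<in> D - cball 0 1" using E(5) by (simp add: \<iota>_def D_def)
        moreover have "xY0 z (\<iota> x) / \<iota> x = xY0 z x / x" using E(6) by (simp add: \<iota>_def divide_inverse)
        ultimately show ?thesis using fext[OF xx] fext[of "\<iota> x"] by simp
      qed
      show "open U" unfolding U_def by (intro open_Collect_conj open_Collect_less continuous_intros)
      show "closed_segment (of_real (x1 z)) (of_real (x2 z)) \<subseteq> U"
        using R X_cuts_real(1)[OF z] by (auto simp: segX_def U_def)
      have UD: "U \<subseteq> D" using R by (auto simp: U_def D_def X_cuts_real[OF z])
      have U0: "x \<noteq> 0" if "x \<in> U" for x using that by (auto simp: U_def)
      have gbh: "gb z holomorphic_on U" unfolding gb_def[abs_def] by (intro holomorphic_intros)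
      show "B holomorphic_on U"
        unfolding B_def using U0 UD z by (intro holomorphic_intros gbh holomorphic_on_subset[OF F(1)]) (auto simp: D_def)
      have pos: "of_real (x3 z) - x \<notin> \<real>\<^sub>\<le>\<^sub>0" "of_real (x4 z) - x \<notin> \<real>\<^sub>\<le>\<^sub>0" if "x \<in> U" for x
        using that R by (auto simp: complex_nonpos_Reals_iff U_def)
      show "\<rho> holomorphic_on U" unfolding \<rho>_def using pos U0 by (intro holomorphic_intros) auto
      show "f x = B x + cut_sqrt (x1 z) (x2 z) x * \<rho> x" if "x \<in> U - closed_segment (of_real (x1 z)) (of_real (x2 z))" for x
        using xY0_slit[OF z, of x] that by (simp add: U_def segX_def f_def B_def \<rho>_def)
      show "bounded (GX z) \<or> bounded (- D) \<and> (\<exists>K R. \<forall>x\<in>GX z. norm x > R \<longrightarrow> norm (f x) \<le> K)"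
      proof (rule disjI2, intro conjI)
        show "bounded (- D)" using bcut by (simp add: D_def)
        \<comment> \<open>For |x| > 2, |Y0(x)| = |x Y0(x)|/|x| is at most 1/2, so f is bounded
          through G on a compact disc.\<close>
        have "cball 0 (1/2) \<subseteq> - cutY z" using y_roots[OF z] by (auto simp: cutY_def)
        then have "continuous_on (cball 0 (1/2)) G" using G(1) holomorphic_on_imp_continuous_on holomorphic_on_subset by blast
        then have "bounded (G ` cball 0 (1/2))" by (intro compact_imp_bounded compact_continuous_image) auto
        then obtain K where K: "\<And>y. y \<in> cball 0 (1/2) \<Longrightarrow> norm (G y) \<le> K" unfolding bounded_iff by fastforce
        have "norm (f x) \<le> norm (of_real z * Q 0 0 z) + z * K" if xg: "x \<in> GX z" "norm x > 2" for x
        proof -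
          have "x \<in> closure (GX z)" using xg closure_subset by blast
          then have xe: "x \<in> - cutX z - cball 0 1" using cut_out xg by auto
          note E = X_exterior[OF z xe]
          have "norm (xY0 z x / x) \<le> 1 / 2"
            unfolding norm_divide using xY0_inverse_sum(2)[OF z E(1-3)] xg by (intro frac_le) auto
          then have "norm (G (xY0 z x / x)) \<le> K" by (intro K) auto
          then have "norm (of_real z * G (xY0 z x / x)) \<le> z * K" using z by (simp add: norm_mult)
          then show ?thesis using fext[of x] xe norm_triangle_ineq4[of "of_real z * Q 0 0 z" "of_real z * G (xY0 z x / x)"]
            by (simp add: D_def)
        qed
        then show "\<exists>K R. \<forall>x\<in>GX z. norm x > R \<longrightarrow> norm (f x) \<le> K" by blast
      qed
      show "0 \<in> ball 0 1 - closed_segment (complex_of_real (x1 z)) (of_real (x2 z)) \<union> {of_real (x1 z)}"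
        using R X_cuts_real(1)[OF z] by (auto simp: segX_def)
      show "x \<in> D - closed_segment (of_real (x1 z)) (of_real (x2 z))" by (rule x)
    qed
  qed
  have "0 \<notin> closed_segment (complex_of_real (x1 z)) (of_real (x2 z))"
    using R X_cuts_real(1)[OF z] by (auto simp: segX_def)
  moreover have "f 0 = of_real z * Q 0 0 z" using F(2) by (simp add: f_def xY0_def)
  moreover have "integral {x1 z..x2 z} (\<lambda>t. of_real (sqrt ((t - x1 z)*(x2 z - t))) * \<rho> (of_real t) * (kern w x (of_real t) - kern w 0 (of_real t)))
     = integral {x1 z..x2 z} (\<lambda>t. of_real (t * sqrt (- gd z t) / (2 * ga z t)) * (kern w x (of_real t) - kern w 0 (of_real t)))"
  proof (rule Henstock_Kurzweil_Integration.integral_cong)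
    fix t assume t: "t \<in> {x1 z..x2 z}"
    have t0: "t > 0" and t34: "t < x3 z" "t < x4 z" using t R by auto
    have s34: "of_real (x3 z) - complex_of_real t = of_real (x3 z - t)" "of_real (x4 z) - complex_of_real t = of_real (x4 z - t)" by auto
    have rho: "\<rho> (of_real t) = of_real (sqrt (x3 z - t) * sqrt (x4 z - t) / (2 * t))"
      unfolding \<rho>_def s34 using t34 by (simp add: csqrt_of_real del: of_real_diff)
    have "- gd z t = z^2 * (((t - x1 z) * (x2 z - t)) * ((x3 z - t) * (x4 z - t)))"
      using gd_factor[OF z, of t] by (simp add: algebra_simps)
    then have "sqrt (- gd z t) = z * (sqrt ((t - x1 z) * (x2 z - t)) * (sqrt (x3 z - t) * sqrt (x4 z - t)))"
      using z by (simp add: real_sqrt_mult)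
    then have "t * sqrt (- gd z t) / (2 * ga z t) = sqrt ((t - x1 z) * (x2 z - t)) * (sqrt (x3 z - t) * sqrt (x4 z - t) / (2 * t))"
      using z t0 by (simp add: ga_def power2_eq_square)
    then have "of_real (sqrt ((t - x1 z)*(x2 z - t))) * \<rho> (of_real t) = complex_of_real (t * sqrt (- gd z t) / (2 * ga z t))"
      unfolding rho by (simp only: of_real_mult)
    then show "of_real (sqrt ((t - x1 z)*(x2 z - t))) * \<rho> (of_real t) * (kern w x (of_real t) - kern w 0 (of_real t)) =
       of_real (t * sqrt (- gd z t) / (2 * ga z t)) * (kern w x (of_real t) - kern w 0 (of_real t))" by simp
  qed
  moreover have "x * Y0 z x = xY0 z x" using x by (intro xY0_eq[OF z]) (auto simp: D_def segX_def)
  ultimately show ?thesis using main by (simp add: f_def algebra_simps)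
qed

section \<open>The y-plane\<close>

definition segY :: "real \<Rightarrow> complex set" where
  "segY z = closed_segment (of_real 0) (of_real (y2 z))"

lemma Y_cuts_real:
  assumes z: "0 < z" "z < 1/4"
  shows "segY z = of_real ` {0..y2 z}" "cutY z = of_real ` {y3 z..}"
  unfolding segY_def cutY_def using y_roots[OF z] of_real_segment[of 0 "y2 z"] by auto

lemma Y_cuts_iff:
  assumes z: "0 < z" "z < 1/4"
  shows "y \<in> segY z \<union> cutY z \<longleftrightarrow> (\<exists>t. y = of_real t \<and> td z t \<le> 0)"
  unfolding td_real_le_0[OF z] Y_cuts_real[OF z] using y_roots[OF z] by auto

lemma td_real_inverse_sum:
  assumes z: "0 < z" and t: "0 < t"
  shows "td z t \<le> 0 \<longleftrightarrow> 1/(4*z^2) \<le> t + inverse t + 2"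
proof -
  have zp: "0 < 4 * z^2" using z by simp
  have "td z t = t^2 * (1 - 4 * z^2 * (t + inverse t + 2))"
    unfolding td_real_alt using t by (simp add: field_simps power2_eq_square)
  then have "td z t \<le> 0 \<longleftrightarrow> 1 \<le> 4 * z^2 * (t + inverse t + 2)" using t by (simp add: mult_le_0_iff)
  also have "\<dots> \<longleftrightarrow> 1/(4*z^2) \<le> t + inverse t + 2" using pos_divide_le_eq[OF zp, of 1 "t + inverse t + 2"] by (simp add: mult_ac)
  finally show ?thesis .
qed

text \<open>For y > 0, \<open>td z y\<close> is y^2 (1 - 4z^2 (y + 1/y + 2)). Away from 0 both cuts
  are thus the preimage of one ray, which starts above 2 because 1/(4z^2) > 4.\<close>

lemma Y_cuts_inverse_sum:
  assumes z: "0 < z" "z < 1/4" and y: "y \<noteq> 0"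
  shows "y \<in> segY z \<union> cutY z \<longleftrightarrow> (\<exists>v. y + inverse y = of_real v \<and> 1/(4*z^2) \<le> v + 2)"
proof
  assume "y \<in> segY z \<union> cutY z"
  then obtain t where t: "y = of_real t" "td z t \<le> 0" using Y_cuts_iff[OF z] by blast
  then have t0: "0 < t" using td_real_le_0[OF z, of t] y by (cases "t = 0") auto
  have "y + inverse y = of_real (t + inverse t)" by (simp add: t)
  then show "\<exists>v. y + inverse y = of_real v \<and> 1/(4*z^2) \<le> v + 2"
    using td_real_inverse_sum[OF z(1) t0] t(2) by blast
next
  assume "\<exists>v. y + inverse y = of_real v \<and> 1/(4*z^2) \<le> v + 2"
  then obtain v where v: "y + inverse y = of_real v" "1/(4*z^2) \<le> v + 2" by blast
  have "(4*z)^2 < 1^2" using z by (intro power_strict_mono) auto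
  then have "4 < 1/(4*z^2)" using z by (simp add: field_simps power_mult_distrib)
  then have "v > 2" using v(2) by linarith
  then obtain t where t: "y = of_real t" "t > 0" "t + inverse t = v"
    using inverse_sum_gt_2_imp_positive[OF y v(1)] by blast
  then have "td z t \<le> 0" using td_real_inverse_sum[OF z(1), of t] v(2) by simp
  then show "y \<in> segY z \<union> cutY z" using Y_cuts_iff[OF z] t by blast
qed

lemma Y_off_cuts:
  assumes z: "0 < z" "z < 1/4" and y: "y \<notin> segY z" "y \<notin> cutY z"
  shows "y \<noteq> 0" "tb z y \<noteq> 0" "1 - 4 * ta z y * tc z y / (tb z y)^2 \<notin> \<real>\<^sub>\<le>\<^sub>0"
proof -
  show y0: "y \<noteq> 0" using y by (auto simp: segY_def)
  then show "tb z y \<noteq> 0" by (simp add: tb_def)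
  \<comment> \<open>The quotient 4ac/b^2 depends on y + 1/y alone, so the forbidden half-line for
    the root corresponds to the ray that describes the cuts.\<close>
  define u where "u = y + inverse y"
  have w: "4 * ta z y * tc z y / (tb z y)^2 = of_real (4 * z^2) * (u + 2)"
    using y0 by (simp add: u_def ta_def tb_def tc_def field_simps power2_eq_square)
  show "1 - 4 * ta z y * tc z y / (tb z y)^2 \<notin> \<real>\<^sub>\<le>\<^sub>0"
    unfolding w
  proof
    assume "1 - of_real (4 * z^2) * (u + 2) \<in> \<real>\<^sub>\<le>\<^sub>0"
    then obtain r where r: "1 - of_real (4 * z^2) * (u + 2) = of_real r" "r \<le> 0" by (auto elim: nonpos_Reals_cases)
    then have "of_real (4 * z^2) * (u + 2) = of_real (1 - r)" by (simp add: algebra_simps)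
    moreover have "complex_of_real (4 * z^2) \<noteq> 0" using z by simp
    ultimately have "u + 2 = of_real (1 - r) / of_real (4 * z^2)" by (metis nonzero_mult_div_cancel_left)
    then have "u = of_real ((1 - r) / (4 * z^2) - 2)" by (simp add: algebra_simps)
    moreover have "1/(4*z^2) \<le> ((1 - r) / (4 * z^2) - 2) + 2" using r(2) by (simp add: divide_right_mono)
    ultimately show False using Y_cuts_inverse_sum[OF z y0] y unfolding u_def by blast
  qed
qed

definition sX0 :: "real \<Rightarrow> complex \<Rightarrow> complex" where
  "sX0 z y = small_root (ta z y) (tb z y) (tc z y)"

lemma sX0_minus_one: "sX0 z (-1) = 0"
  by (simp add: sX0_def small_root_def tc_def)

lemma sX0_eq:
  assumes z: "0 < z" "z < 1/4" and y: "y \<notin> segY z" "y \<notin> cutY z"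
  shows "X0 z y = sX0 z y"
proof (cases "y = -1")
  case True
  \<comment> \<open>At y = -1 both candidates in \<open>X0\<close> are divisions by zero, hence 0;
    \<open>sX0\<close> vanishes there because \<open>tc\<close> does.\<close>
  then show ?thesis by (simp add: sX0_minus_one X0_def ta_def)
next
  case False
  then have "ta z y \<noteq> 0" using z Y_off_cuts(1)[OF z y] by (simp add: ta_def add_eq_0_iff2)
  from smaller_root_select[OF this Y_off_cuts(2,3)[OF z y]]
  show ?thesis by (simp add: sX0_def X0_def td_def)
qed

text \<open>Since \<open>ta z y\<close> is y times \<open>tc z y\<close>, the condition selecting
  the smaller root becomes |y X0^2| < 1 once \<open>tc\<close> is divided out.\<close>

lemma sX0_root:
  assumes z: "0 < z" "z < 1/4" and y: "y \<notin> segY z" "y \<notin> cutY z"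
  shows "of_real z * (y + 1) * (1 + (sX0 z y)^2 * y) = sX0 z y * y" "norm (y * (sX0 z y)^2) < 1"
    "y \<noteq> -1 \<Longrightarrow> sX0 z y \<noteq> 0"
proof -
  note o = Y_off_cuts[OF z y]
  have e: "ta z y * (sX0 z y)^2 + tb z y * sX0 z y + tc z y = 0" unfolding sX0_def by (rule small_root_eq[OF o(2)])
  then show "of_real z * (y + 1) * (1 + (sX0 z y)^2 * y) = sX0 z y * y"
    by (simp add: ta_def tb_def tc_def algebra_simps)
  have c: "tc z y \<noteq> 0" if "y \<noteq> -1" using z that by (simp add: tc_def add_eq_0_iff2)
  show "norm (y * (sX0 z y)^2) < 1"
  proof (cases "y = -1")
    case False
    have "norm (ta z y * (sX0 z y)^2) < norm (tc z y)" unfolding sX0_def by (rule small_root_norm[OF o(2) c[OF False] o(3)])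
    moreover have "ta z y * (sX0 z y)^2 = tc z y * (y * (sX0 z y)^2)" by (simp add: ta_def tc_def)
    ultimately have "norm (tc z y) * norm (y * (sX0 z y)^2) < norm (tc z y) * 1" by (simp only: norm_mult mult_1_right)
    then show ?thesis
      using mult_less_cancel_left_pos[of "norm (tc z y)" "norm (y * (sX0 z y)^2)" 1] c[OF False] zero_less_norm_iff by blast
  qed (simp add: sX0_minus_one)
  show "sX0 z y \<noteq> 0" if "y \<noteq> -1" using e c[OF that] by auto
qed

lemma sX0_unique:
  assumes z: "0 < z" "z < 1/4" and y: "y \<notin> segY z" "y \<notin> cutY z" "y \<noteq> -1"
    and r: "of_real z * (y + 1) * (1 + r^2 * y) = r * y" "norm (y * r^2) < 1"
  shows "sX0 z y = r"
proof -
  note o = Y_off_cuts[OF z y(1,2)]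
  have c: "tc z y \<noteq> 0" using z y(3) by (simp add: tc_def add_eq_0_iff2)
  have a: "ta z y = tc z y * y" by (simp add: ta_def tc_def)
  have "r = small_root (ta z y) (tb z y) (tc z y)"
  proof (rule small_root_unique[OF _ o(2) c o(3)])
    show "ta z y \<noteq> 0" using a c o(1) by simp
    show "ta z y * r^2 + tb z y * r + tc z y = 0" using r(1) by (simp add: ta_def tb_def tc_def algebra_simps)
    have "norm (ta z y * r^2) = norm (tc z y) * norm (y * r^2)" unfolding a by (simp add: norm_mult)
    also have "\<dots> < norm (tc z y) * 1" using r(2) c by (intro mult_strict_left_mono) auto
    finally show "norm (ta z y * r^2) < norm (tc z y)" by simp
  qed
  then show ?thesis by (simp add: sX0_def)
qed

lemma sX0_holomorphic:
  assumes z: "0 < z" "z < 1/4"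
  shows "sX0 z holomorphic_on - cutY z - segY z"
proof -
  have "tb z y * (1 + csqrt (1 - 4 * ta z y * tc z y / (tb z y)^2)) \<noteq> 0" "(tb z y)^2 \<noteq> 0"
    "1 - 4 * ta z y * tc z y / (tb z y)^2 \<notin> \<real>\<^sub>\<le>\<^sub>0" if "y \<in> - cutY z - segY z" for y
    using Y_off_cuts[OF z, of y] that csqrt_not_minus_one by auto
  moreover have "ta z holomorphic_on A" "tb z holomorphic_on A" "tc z holomorphic_on A" for A
    unfolding ta_def[abs_def] tb_def[abs_def] tc_def[abs_def] by (intro holomorphic_intros)+
  ultimately show ?thesis
    unfolding sX0_def[abs_def] small_root_def by (intro holomorphic_intros) auto
qed

text \<open>The slit factor of sqrt (td) is \<open>cut_sqrt\<close> for 0 and y2, the remaining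
  factor a principal root of y3 - y. The strip starts at -1 to keep y + 1 away from 0, and the sign
  is tested at -1/2.\<close>

lemma sX0_slit:
  assumes z: "0 < z" "z < 1/4" and y: "-1 < Re y" "Re y < y3 z" "y \<notin> segY z"
  shows "y * sX0 z y = y / (2 * of_real z * (1 + y)) -
     cut_sqrt 0 (y2 z) y * (csqrt (of_real (y3 z) - y) / (1 + y))"
proof -
  note R = y_roots[OF z]
  define g where "g = (\<lambda>y. y * csqrt (1 - 4 * ta z y * tc z y / (tb z y)^2))"
  define h where "h = (\<lambda>y. 2 * of_real z * csqrt (of_real (y3 z) - y))"
  have off: "y \<notin> cutY z" if "Re y < y3 z" for y using that by (auto simp: cutY_def)
  have pos: "of_real (y3 z) - y \<notin> \<real>\<^sub>\<le>\<^sub>0" if "Re y < y3 z" for y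
    using that by (auto simp: complex_nonpos_Reals_iff)
  define p where "p = - (1/2::real)"
  have "g y = h y * cut_sqrt 0 (y2 z) y"
  proof (rule slit_sqrt_factor[of "-1" 0 "y2 z" "y3 z" g h p])
    show "continuous_on ({x. -1 < Re x \<and> Re x < y3 z} - closed_segment (of_real 0) (of_real (y2 z))) g"
    proof -
      have "(tb z x)^2 \<noteq> 0" "1 - 4 * ta z x * tc z x / (tb z x)^2 \<notin> \<real>\<^sub>\<le>\<^sub>0"
        if "x \<in> {x. -1 < Re x \<and> Re x < y3 z} - closed_segment (of_real 0) (of_real (y2 z))" for x
        using Y_off_cuts[OF z, of x] off[of x] that by (auto simp: segY_def)
      moreover have "ta z holomorphic_on A" "tb z holomorphic_on A" "tc z holomorphic_on A" for A
        unfolding ta_def[abs_def] tb_def[abs_def] tc_def[abs_def] by (intro holomorphic_intros)+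
      ultimately show ?thesis unfolding g_def
        by (intro holomorphic_on_imp_continuous_on holomorphic_intros) auto
    qed
    show "continuous_on {x. -1 < Re x \<and> Re x < y3 z} h"
      unfolding h_def using pos by (intro holomorphic_on_imp_continuous_on holomorphic_intros) auto
    show "(g x)^2 = (h x)^2 * ((x - of_real 0) * (x - of_real (y2 z)))"
      if xx: "-1 < Re x" "Re x < y3 z" "x \<notin> closed_segment (of_real 0) (of_real (y2 z))" for x
    proof -
      have x0: "x \<noteq> 0" using Y_off_cuts(1)[OF z, of x] off[OF xx(2)] xx(3) by (simp add: segY_def)
      have "(g x)^2 = x^2 - 4 * ta z x * tc z x" using x0 by (simp add: g_def power_mult_distrib tb_def algebra_simps)
      also have "\<dots> = td z x" by (simp add: td_def tb_def)
      finally show ?thesis unfolding td_factor[OF z] h_def by (simp add: power_mult_distrib algebra_simps)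
    qed
    show "h x \<noteq> 0" if "-1 < Re x" "Re x < y3 z" for x using pos[OF that(2)] z by (auto simp: h_def)
    show "(-1::real) < 0" "0 < y2 z" "y2 z < y3 z" "-1 < p" "p < 0" using R by (auto simp: p_def)
    show "-1 < Re y" "Re y < y3 z" "y \<notin> closed_segment (of_real 0) (of_real (y2 z))" using y by (auto simp: segY_def)
    have w: "1 - 4 * ta z p * tc z p / (tb z p)^2 > 0" using z by (simp add: ta_def tb_def tc_def p_def add_pos_pos)
    have cr: "ta z (complex_of_real p) = of_real (ta z p)" "tb z (complex_of_real p) = of_real (tb z p)" "tc z (complex_of_real p) = of_real (tc z p)"
      by (simp_all add: ta_def tb_def tc_def)
    have "1 - 4 * ta z (complex_of_real p) * tc z (of_real p) / (tb z (of_real p))^2 = of_real (1 - 4 * ta z p * tc z p / (tb z p)^2)"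
      unfolding cr by simp
    then show "g (of_real p) = of_real (p * sqrt (1 - 4 * ta z p * tc z p / (tb z p)^2))"
      unfolding g_def using w by (simp add: csqrt_of_real cr)
    have "of_real (y3 z) - complex_of_real p = of_real (y3 z - p)" by auto
    then show "h (of_real p) = of_real (2 * z * sqrt (y3 z - p))"
      unfolding h_def using R by (simp add: csqrt_of_real p_def del: of_real_diff)
    have "sqrt (y3 z - p) > 0" using R by (simp add: p_def)
    then show "(p * sqrt (1 - 4 * ta z p * tc z p / (tb z p)^2)) * (2 * z * sqrt (y3 z - p)) < 0"
      using w z by (simp add: p_def mult_pos_pos)
  qed
  moreover have y1: "y + 1 \<noteq> 0" using y(1) by (auto simp: complex_eq_iff)
  have y0: "y \<noteq> 0" by (rule Y_off_cuts(1)[OF z y(3) off[OF y(2)]])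
  have "ta z y \<noteq> 0" using z y0 y1 by (simp add: ta_def)
  from small_root_alt[OF this Y_off_cuts(2)[OF z y(3) off[OF y(2)]]]
  have "sX0 z y = (y - g y) / (2 * ta z y)" by (simp add: sX0_def g_def tb_def)
  ultimately have "y * sX0 z y = y * ((y - h y * cut_sqrt 0 (y2 z) y) / (2 * (of_real z * y * (y + 1))))" by (simp add: ta_def)
  also have "\<dots> = (y - h y * cut_sqrt 0 (y2 z) y) / (2 * of_real z * (1 + y))" using y0 by (simp add: add.commute)
  also have "\<dots> = y / (2 * of_real z * (1 + y)) - h y * cut_sqrt 0 (y2 z) y / (2 * of_real z * (1 + y))"
    by (rule diff_divide_distrib)
  also have "h y * cut_sqrt 0 (y2 z) y / (2 * of_real z * (1 + y)) = cut_sqrt 0 (y2 z) y * (csqrt (of_real (y3 z) - y) / (1 + y))"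
    using z by (simp add: h_def)
  finally show ?thesis .
qed

section \<open>The curve and the domain of the y-plane\<close>

text \<open>For y \<noteq> 0 this is z |y| (|y + 1/y + 2| - 1/z), because y + 1/y + 2 = (y +
  1)^2/y.\<close>

definition psiY :: "real \<Rightarrow> complex \<Rightarrow> real" where
  "psiY z y = z * (norm (y + 1))^2 - norm y"

lemma psiY_expand: "psiY z y = z * ((norm y)^2 + 2 * Re y + 1) - norm y"
  unfolding psiY_def cmod_power2 by (simp add: power2_eq_square algebra_simps)

lemma psiY_sign:
  assumes "y \<noteq> 0" "z > 0"
  shows "psiY z y < 0 \<longleftrightarrow> norm (y + inverse y + 2) < 1/z" "0 < psiY z y \<longleftrightarrow> 1/z < norm (y + inverse y + 2)"
proof -
  have "y + inverse y + 2 = (y + 1)^2 / y" using assms by (simp add: field_simps power2_eq_square)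
  then have n: "norm (y + inverse y + 2) = (norm (y + 1))^2 / norm y" by (simp add: norm_divide norm_power)
  show "psiY z y < 0 \<longleftrightarrow> norm (y + inverse y + 2) < 1/z" "0 < psiY z y \<longleftrightarrow> 1/z < norm (y + inverse y + 2)"
    unfolding n psiY_def using assms by (simp_all add: divide_less_eq less_divide_eq mult_ac)
qed

text \<open>The parameter is x = 1/|y|, as the conjugate roots over x have product 1/x^2. For |y| >
  1 it is below 1, and |Re y| \<le> |y| becomes \<open>gd z x \<le> 0\<close>, which leaves only the
  interval from x1 to x2.\<close>

lemma Ycurve_eq:
  assumes z: "0 < z" "z < 1/4"
  shows "Ycurve z = {y. 1 < norm y \<and> psiY z y = 0}"
proof -
  note R = x_roots[OF z]
  have 1: "p = (of_real (- gb z x) - \<i> * of_real (sqrt (- gd z x))) / of_real (2 * ga z x) \<or>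
        p = (of_real (- gb z x) + \<i> * of_real (sqrt (- gd z x))) / of_real (2 * ga z x)
     \<longleftrightarrow> ga z x * (norm p)^2 = gc z x \<and> 2 * ga z x * Re p = - gb z x" if x: "x1 z \<le> x" "x \<le> x2 z" for x p
  proof -
    have a: "ga z x > 0" using x R z by (simp add: ga_def)
    have d: "gb z x ^ 2 - 4 * ga z x * gc z x \<le> 0" using gd_real_le_0[OF z, of x] x by (simp add: gd_def)
    show ?thesis using conjugate_roots_iff[OF a d, of p] by (simp add: gd_def)
  qed
  have "Ycurve z = {p. \<exists>x. x1 z \<le> x \<and> x \<le> x2 z \<and> (ga z x * (norm p)^2 = gc z x \<and> 2 * ga z x * Re p = - gb z x)}"
    unfolding Ycurve_def using 1 by blast
  also have "\<dots> = {y. 1 < norm y \<and> psiY z y = 0}"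
  proof (intro set_eqI iffI; clarify)
    fix p x assume x: "x1 z \<le> x" "x \<le> x2 z" and p: "ga z x * (norm p)^2 = gc z x" "2 * ga z x * Re p = - gb z x"
    have x0: "0 < x" "x < 1" using x R by auto
    have "(x * norm p)^2 = 1" using p(1) z by (simp add: ga_def gc_def power_mult_distrib)
    then have xn: "x * norm p = 1" using x0 by (simp add: power2_eq_1_iff) (smt (verit) mult_nonneg_nonneg norm_ge_zero)
    then have n: "norm p = 1/x" using x0 by (simp add: field_simps)
    have "1 < norm p" unfolding n using x0 by simp
    moreover have "psiY z p = 0"
    proof -
      have "x^2 * psiY z p = z * (x * norm p)^2 + 2 * (z * x^2) * Re p + z * x^2 - x * (x * norm p)"
        by (simp add: psiY_expand power_mult_distrib algebra_simps power2_eq_square)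
      also have "\<dots> = z + 2 * (z * x^2) * Re p + z * x^2 - x" unfolding xn by simp
      also have "\<dots> = 0" using p(2) by (simp add: ga_def gb_def)
      finally show ?thesis using x0 by simp
    qed
    ultimately show "1 < norm p \<and> psiY z p = 0" ..
  next
    fix p assume p: "1 < norm p" "psiY z p = 0"
    define x where "x = 1 / norm p"
    have x0: "0 < x" "x < 1" and xn: "x * norm p = 1" using p by (auto simp: x_def divide_less_eq)
    have e1: "ga z x * (norm p)^2 = gc z x"
    proof -
      have "ga z x * (norm p)^2 = z * (x * norm p)^2" by (simp add: ga_def power_mult_distrib)
      then show ?thesis unfolding xn by (simp add: gc_def)
    qed
    have e2: "2 * ga z x * Re p = - gb z x"
    proof -
      have "x^2 * psiY z p = z * (x * norm p)^2 + 2 * (z * x^2) * Re p + z * x^2 - x * (x * norm p)"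
        by (simp add: psiY_expand power_mult_distrib algebra_simps power2_eq_square)
      then show ?thesis unfolding xn p(2) by (simp add: ga_def gb_def)
    qed
    have "(Re p)^2 \<le> (norm p)^2" by (simp add: cmod_power2)
    then have "(2 * ga z x)^2 * (Re p)^2 \<le> (2 * ga z x)^2 * (norm p)^2" by (intro mult_left_mono) auto
    also have "\<dots> = 4 * ga z x * (ga z x * (norm p)^2)" by (simp add: power2_eq_square)
    finally have "(2 * ga z x * Re p)^2 \<le> 4 * ga z x * gc z x" unfolding e1 by (simp add: power_mult_distrib)
    then have "gd z x \<le> 0" unfolding e2 by (simp add: gd_def)
    then have "x1 z \<le> x" "x \<le> x2 z" using gd_real_le_0[OF z, of x] x0 R by auto
    then show "\<exists>x. x1 z \<le> x \<and> x \<le> x2 z \<and> (ga z x * (norm p)^2 = gc z x \<and> 2 * ga z x * Re p = - gb z x)"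
      using e1 e2 by blast
  qed
  finally show ?thesis .
qed

lemma GY_region:
  assumes z: "0 < z" "z < 1/4"
  shows "GY z = {y. norm y \<le> 1 \<or> psiY z y < 0}" "open (GY z)" "closure (GY z) = GY z \<union> Ycurve z"
    "frontier (GY z) = Ycurve z" "\<And>t. t \<in> Ycurve z \<Longrightarrow> t islimpt Ycurve z" "bounded (GY z)"
proof -
  have c: "continuous_on UNIV (psiY z)" unfolding psiY_def by (intro continuous_intros)
  have n: "psiY z y < 0" if "norm y = 1" for y
  proof -
    have "z * Re y \<le> z * 1" using z that complex_Re_le_cmod[of y] by (intro mult_left_mono) auto
    then have "z * 2 + 2 * (z * Re y) < 1" using z by linarith
    then show ?thesis using that by (simp add: psiY_expand algebra_simps)
  qed
  have m: "psiY z (of_real s * y) < 0" if s: "1 < s * norm y" "0 < s" "s < 1" "psiY z y \<le> 0" for y s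
  proof -
    define r where "r = norm y"
    have r: "1 < s * r" using s by (simp add: r_def)
    have "s * r \<le> 1 * r" using s by (intro mult_right_mono) (auto simp: r_def)
    then have r1: "1 < r" using r by simp
    have "1 * 1 < (s * r) * r" using r r1 by (intro mult_strict_mono) auto
    then have sr: "1 < s * r^2" by (simp add: power2_eq_square mult_ac)
    have A: "z * (2 * Re y) \<le> r - z * (r^2 + 1)" using s(4) by (simp add: psiY_expand r_def algebra_simps)
    have "psiY z (of_real s * y) = z * (s^2 * r^2 + 1) + s * (z * (2 * Re y)) - s * r"
      using s by (simp add: psiY_expand norm_mult r_def power_mult_distrib algebra_simps)
    also have "\<dots> \<le> z * (s^2 * r^2 + 1) + s * (r - z * (r^2 + 1)) - s * r"
      using s A by (intro diff_right_mono add_left_mono mult_left_mono) auto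
    also have "\<dots> = z * ((1 - s) * (1 - s * r^2))" by (simp add: algebra_simps power2_eq_square)
    also have "\<dots> < 0" using s z sr by (simp add: mult_less_0_iff zero_less_mult_iff)
    finally show ?thesis .
  qed
  have p: "complex_of_real y1 \<in> ball 0 1" by (simp add: y1_def)
  note S = starlike_component[OF c n m p, folded Ycurve_eq[OF z]]
  have GY: "GY z = {y. norm y \<le> 1 \<or> psiY z y < 0}" unfolding GY_def using S(1) by simp
  then show "GY z = {y. norm y \<le> 1 \<or> psiY z y < 0}" .
  show "open (GY z)" "closure (GY z) = GY z \<union> Ycurve z"
    "frontier (GY z) = Ycurve z" "\<And>t. t \<in> Ycurve z \<Longrightarrow> t islimpt Ycurve z"
    unfolding GY using S(2-5) by auto
  \<comment> \<open>Outside the disc \<psi> < 0 forces z (r - 1)^2 < r for r = |y|, whereas r > 2 +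
    1/z gives z r (r - 2) > r.\<close>
  have "norm y \<le> 2 + 1/z" if "y \<in> GY z" for y
  proof (rule ccontr)
    define r where "r = norm y"
    assume "\<not> norm y \<le> 2 + 1/z"
    then have r: "2 + 1/z < r" by (simp add: r_def)
    have "1/z > 0" using z by simp
    then have r1: "r > 1" using r by linarith
    then have ps: "psiY z y < 0" using that by (auto simp: GY r_def)
    have "r - 1 \<le> norm (y + 1)" using norm_triangle_ineq2[of y "-1"] by (simp add: r_def)
    then have "(r - 1)^2 \<le> (norm (y+1))^2" using r1 by (intro power_mono) auto
    then have "z * (r - 1)^2 \<le> z * (norm (y+1))^2" using z by (intro mult_left_mono) auto
    then have a: "z * (r - 1)^2 < r" using ps by (simp add: psiY_def r_def)
    have "1 < z * (r - 2)" using r z by (simp add: field_simps)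
    then have "1 * r < z * (r - 2) * r" using r1 by (intro mult_strict_right_mono) auto
    also have "z * (r - 2) * r = z * (r - 1)^2 - z" by (simp add: power2_eq_square algebra_simps)
    finally show False using a z by simp
  qed
  then show "bounded (GY z)" unfolding bounded_iff by blast
qed

text \<open>For fixed X the kernel is quadratic in y with product of roots 1/X^2, so \<eta> is the
  second y over X = X0(y). Combining z (y + 1)(\<eta> + 1) = X y \<eta> with y \<eta> X^2 = 1 gives
  the product relation.\<close>

lemma Y_exterior:
  assumes z: "0 < z" "z < 1/4" and y: "y \<in> - cutY z - cball 0 1"
  defines "\<eta> \<equiv> inverse (y * (sX0 z y)^2)"
  shows "y \<notin> segY z" "y \<notin> cutY z" "y \<noteq> 0" "1 < norm y" "y * (sX0 z y)^2 \<noteq> 0" "\<eta> \<in> - cutY z - cball 0 1"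
    "sX0 z \<eta> = sX0 z y" "inverse (\<eta> * (sX0 z \<eta>)^2) = y"
    "of_real (z^2) * (y + inverse y + 2) * (\<eta> + inverse \<eta> + 2) = 1"
proof -
  show n: "1 < norm y" and c: "y \<notin> cutY z" using y by auto
  show s: "y \<notin> segY z" using n y_roots[OF z] by (auto simp: Y_cuts_real[OF z])
  show y0: "y \<noteq> 0" using n by auto
  have y1: "y \<noteq> -1" using n by auto
  define X where "X = sX0 z y"
  note r = sX0_root[OF z s c, folded X_def]
  have X0: "X \<noteq> 0" using r(3) y1 by simp
  then show yX: "y * (sX0 z y)^2 \<noteq> 0" using y0 by (simp add: X_def)
  have \<eta>: "\<eta> = inverse (y * X^2)" by (simp add: \<eta>_def X_def)
  have \<eta>0: "\<eta> \<noteq> 0" using X0 y0 by (simp add: \<eta>)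
  have "1 < inverse (norm (y * X^2))" using r(2) yX by (intro one_less_inverse) (auto simp: X_def)
  then have n\<eta>: "1 < norm \<eta>" by (simp only: \<eta> norm_inverse)
  then have \<eta>1: "\<eta> \<noteq> -1" by auto
  have yXe: "y * X^2 * \<eta> = 1" unfolding \<eta> using X0 y0 by (intro right_inverse) simp
  have k: "of_real z * (y + 1) * (\<eta> + 1) = X * y * \<eta>"
  proof -
    have "X * y * \<eta> = of_real z * (y + 1) * (\<eta> + y * X^2 * \<eta>)"
      unfolding r(1)[symmetric] by (simp add: algebra_simps)
    then show ?thesis unfolding yXe by simp
  qed
  have "(of_real z * (y + 1) * (\<eta> + 1))^2 = y * \<eta> * (y * X^2 * \<eta>)"
    unfolding k by (simp add: power2_eq_square)
  then have k2: "(of_real z * (y + 1) * (\<eta> + 1))^2 = y * \<eta>" unfolding yXe by simp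
  have "of_real (z^2) * (y + inverse y + 2) * (\<eta> + inverse \<eta> + 2) * (y * \<eta>) = (of_real z * (y + 1) * (\<eta> + 1))^2"
  proof -
    have "(y + inverse y + 2) * y = (y + 1)^2" "(\<eta> + inverse \<eta> + 2) * \<eta> = (\<eta> + 1)^2"
      using y0 \<eta>0 by (simp_all add: algebra_simps power2_eq_square)
    then have "of_real (z^2) * ((y + inverse y + 2) * y) * ((\<eta> + inverse \<eta> + 2) * \<eta>) = (of_real z * (y + 1) * (\<eta> + 1))^2"
      by (simp add: power_mult_distrib)
    then show ?thesis by (simp only: mult_ac)
  qed
  then have "of_real (z^2) * (y + inverse y + 2) * (\<eta> + inverse \<eta> + 2) * (y * \<eta>) = 1 * (y * \<eta>)" unfolding k2 by simp
  then show prod: "of_real (z^2) * (y + inverse y + 2) * (\<eta> + inverse \<eta> + 2) = 1"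
    using y0 \<eta>0 by (metis mult_eq_0_iff mult_right_cancel)
  have nc: "\<eta> \<notin> segY z \<union> cutY z"
  proof
    assume "\<eta> \<in> segY z \<union> cutY z"
    then obtain v where v: "\<eta> + inverse \<eta> = of_real v" "1/(4*z^2) \<le> v + 2" using Y_cuts_inverse_sum[OF z \<eta>0] by blast
    have zp: "0 < z^2" using z by simp
    have v2: "1 \<le> 4 * (z^2 * (v + 2))" using v(2) zp by (simp add: divide_le_eq mult_ac)
    then have vp: "0 < z^2 * (v + 2)" by linarith
    \<comment> \<open>If \<eta> were on a cut, y + 1/y + 2 would equal this t in (0, 4], and y would
      lie on the unit circle.\<close>
    define t where "t = 1 / (z^2 * (v + 2))"
    have t: "0 < t" "t \<le> 4" using v2 vp by (auto simp: t_def divide_le_eq)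
    have "(y + inverse y + 2) * of_real (z^2 * (v + 2)) = 1" using prod unfolding v(1) by (simp add: mult_ac)
    then have "y + inverse y + 2 = 1 / of_real (z^2 * (v + 2))"
      using vp by (metis less_irrefl nonzero_eq_divide_eq of_real_eq_0_iff)
    then have "y + inverse y + 2 = of_real t" by (simp add: t_def)
    then have "y + inverse y = of_real (t - 2)" by (simp add: algebra_simps)
    then have "norm y = 1" by (rule inverse_sum_segment_imp_unit[OF y0]) (use t in auto)
    then show False using n by simp
  qed
  then show "\<eta> \<in> - cutY z - cball 0 1" using n\<eta> by auto
  show sX: "sX0 z \<eta> = sX0 z y"
    unfolding X_def[symmetric]
  proof (rule sX0_unique[OF z _ _ \<eta>1])
    have "y * (of_real z * (\<eta> + 1) * (1 + X^2 * \<eta>)) = of_real z * (\<eta> + 1) * (y + y * X^2 * \<eta>)"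
      by (simp add: algebra_simps)
    also have "\<dots> = of_real z * (y + 1) * (\<eta> + 1)" unfolding yXe by (simp add: mult_ac)
    also have "\<dots> = y * (X * \<eta>)" unfolding k by (simp add: mult_ac)
    finally show "of_real z * (\<eta> + 1) * (1 + X^2 * \<eta>) = X * \<eta>" using y0 by simp
    have "\<eta> * X^2 = inverse y" using yXe y0 by (simp add: field_simps)
    then show "norm (\<eta> * X^2) < 1" using n by (simp add: norm_inverse inverse_less_1_iff)
  qed (use nc in auto)
  have "\<eta> * X^2 = inverse y" using yXe y0 by (simp add: field_simps)
  then show "inverse (\<eta> * (sX0 z \<eta>)^2) = y" unfolding sX X_def[symmetric] by simp
qed

lemma closed_cutY: "closed (cutY z)"
proof -
  have "cutY z = {y. Im y = 0 \<and> y3 z \<le> Re y}"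
    by (auto simp: cutY_def complex_eq_iff)
  then show ?thesis by (simp add: closed_Collect_conj closed_Collect_eq closed_Collect_le continuous_intros)
qed

lemma connected_exterior_Y:
  assumes z: "0 < z" "z < 1/4"
  shows "connected (- cutY z - cball 0 1)"
  by (rule connected_exterior_minus_positive_reals) (use y_roots[OF z] in \<open>auto simp: Y_cuts_real[OF z]\<close>)

text \<open>The continuation runs through -1 again, where X0 = 0. That point is kept in the
  conclusion since the third formula is read off there. In the exterior |X0|^2 \<le> |y X0^2| <
  1.\<close>

lemma G_exterior:
  assumes z: "0 < z" "z < 1/4"
    and F: "F holomorphic_on (- cutX z)" "\<forall>x\<in>ball 0 1. F x = Q x 0 z"
    and G: "G holomorphic_on (- cutY z)" "\<forall>y\<in>ball 0 1. G y = (y + 1) * Q 0 y z"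
    and y: "y \<in> (- cutY z - cball 0 1) \<union> {-1}"
  shows "of_real z * G y - y * sX0 z y = of_real z * Q 0 0 z - of_real z * F (sX0 z y)"
proof -
  note R = y_roots[OF z]
  define A where "A = - cutY z - segY z"
  have closed: "closed (cutY z)" "closed (segY z)" using closed_cutY by (auto simp: segY_def)
  have opA: "open A" unfolding A_def using closed by (intro open_Diff) auto
  have hy: "sX0 z holomorphic_on A" using sX0_holomorphic[OF z] by (simp add: A_def)
  define W where "W = A \<inter> sX0 z -` ball 0 1"
  have opW: "open W" unfolding W_def
    by (rule continuous_open_preimage[OF holomorphic_on_imp_continuous_on[OF hy] opA]) auto
  have WA: "W \<subseteq> A" by (auto simp: W_def)
  define \<Phi> where "\<Phi> = (\<lambda>y. of_real z * G y - y * sX0 z y - (of_real z * Q 0 0 z - of_real z * F (sX0 z y)))"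
  have outX: "x \<notin> cutX z" if "norm x < 1" for x using that x_roots[OF z] by (auto simp: X_cuts_real[OF z])
  have "\<Phi> y = 0"
  proof (rule identity_on_exterior[of W \<Phi> "- cutY z - cball 0 1"])
    have "(\<lambda>y. F (sX0 z y)) holomorphic_on W"
      by (rule holomorphic_on_compose_gen[OF holomorphic_on_subset[OF hy WA] F(1), unfolded o_def])
         (use outX in \<open>auto simp: W_def\<close>)
    moreover have "sX0 z holomorphic_on W" "G holomorphic_on W"
      using WA by (auto simp: A_def intro: holomorphic_on_subset[OF sX0_holomorphic[OF z]] holomorphic_on_subset[OF G(1)])
    ultimately show "\<Phi> holomorphic_on W" unfolding \<Phi>_def by (intro holomorphic_intros)
    have m1: "-1 \<notin> segY z" "-1 \<notin> cutY z"
      using R unfolding Y_cuts_real[OF z] by (auto simp: complex_eq_iff)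
    then show "-1 \<in> W" by (simp add: W_def A_def sX0_minus_one)
    show "- cutY z - cball 0 1 \<subseteq> W"
    proof
      fix y assume y: "y \<in> - cutY z - cball 0 1"
      note E = Y_exterior[OF z y]
      have "1 * (norm (sX0 z y))^2 \<le> norm y * (norm (sX0 z y))^2" using E(4) by (intro mult_right_mono) auto
      also have "\<dots> < 1" using sX0_root(2)[OF z E(1,2)] by (simp add: norm_mult norm_power)
      finally have "norm (sX0 z y) < 1" using abs_square_less_1[of "norm (sX0 z y)"] by simp
      then show "y \<in> W" using E(1,2) by (simp add: W_def A_def)
    qed
    show "W - cball 0 1 \<subseteq> - cutY z - cball 0 1" using WA by (auto simp: A_def)
    show "open (- cutY z - cball 0 1)" using closed by auto
    show "connected (- cutY z - cball 0 1)" by (rule connected_exterior_Y[OF z])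
    show "\<Phi> y = 0" if y: "y \<in> W" "norm y < 1" for y
    proof -
      have yA: "y \<notin> segY z" "y \<notin> cutY z" using y WA by (auto simp: A_def)
      define x where "x = sX0 z y"
      have x1: "norm x < 1" using y by (simp add: W_def x_def)
      have "of_real z * Q x 0 z + of_real z * (y + 1) * Q 0 y z - of_real z * Q 0 0 z = x * y"
        using x1 y sX0_root(1)[OF z yA] by (intro kernel_functional_equation[OF z]) (auto simp: x_def)
      moreover have "F x = Q x 0 z" "G y = (y + 1) * Q 0 y z" using F(2) G(2) x1 y by auto
      ultimately show ?thesis unfolding \<Phi>_def x_def[symmetric] by (simp add: algebra_simps)
    qed
  qed (use opW y in auto)
  then show ?thesis by (simp add: \<Phi>_def)
qed

text \<open>Here the domain is bounded, so infinity needs no care; but the base point 0 is the end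
  \<alpha> of the slit, where the contribution is the regular part B(0).\<close>

theorem Y_formula:
  assumes z: "0 < z" "z < 1/4"
    and w: "mero_on (- cutY z) w" "CGF (GY z) w"
    and F: "F holomorphic_on (- cutX z)" "\<forall>x\<in>ball 0 1. F x = Q x 0 z"
    and G: "G holomorphic_on (- cutY z)" "\<forall>y\<in>ball 0 1. G y = (y + 1) * Q 0 y z"
    and y: "y \<notin> cutY z" "y \<notin> segY z"
  shows "of_real z * (G y - Q 0 0 z) =
          X0 z y * y + of_real (1/pi) *
            integral {0..y2 z} (\<lambda>t. of_real (t * sqrt (- td z t) / (2 * ta z t)) *
               (kern w y (of_real t) - kern w 0 (of_real t)))"
proof -
  note R = y_roots[OF z] and GYr = GY_region[OF z]
  define D where "D = - cutY z"
  define f where "f = (\<lambda>y. of_real z * G y - y * sX0 z y)"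
  define B where "B = (\<lambda>y. of_real z * G y - y / (2 * of_real z * (1 + y)))"
  define \<rho> where "\<rho> = (\<lambda>y. csqrt (of_real (y3 z) - y) / (1 + y))"
  define U where "U = {y. -1 < Re y \<and> Re y < y3 z}"
  define \<iota> where "\<iota> = (\<lambda>y. inverse (y * (sX0 z y)^2))"
  \<comment> \<open>On the outer cut \<open>td z t \<le> 0\<close> gives t \<le> 4 z^2 (t + 1)^2,
    which is less than z (t + 1)^2 since 4z < 1.\<close>
  have cut_out: "y \<notin> closure (GY z)" if yc: "y \<in> cutY z" for y
  proof -
    obtain t where tt: "y = of_real t" "y3 z \<le> t" using yc by (auto simp: cutY_def)
    have t1: "1 < t" using R tt by simp
    have "td z t \<le> 0" using td_real_le_0[OF z, of t] tt t1 by simp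
    then have "t * t \<le> t * (4 * z^2 * (t+1)^2)" unfolding td_real_alt by (simp add: power2_eq_square algebra_simps)
    then have "t \<le> 4 * z^2 * (t+1)^2" using t1 by simp
    also have "\<dots> = (4 * z) * (z * (t+1)^2)" by (simp add: power2_eq_square)
    also have "\<dots> < 1 * (z * (t+1)^2)" using z t1 by (intro mult_strict_right_mono) auto
    finally have "t < z * (t+1)^2" by simp
    moreover have "norm (y + 1) = t + 1" "norm y = t"
    proof -
      have "y + 1 = of_real (t + 1)" by (simp add: tt)
      then show "norm (y + 1) = t + 1" using t1 by (simp only: norm_of_real)
      show "norm y = t" using t1 by (simp add: tt)
    qed
    ultimately have "y \<notin> GY z" "y \<notin> Ycurve z" using t1 by (simp_all add: GYr(1) Ycurve_eq[OF z] psiY_def)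
    then show ?thesis using GYr(3) by blast
  qed
  have \<Omega>D: "D - cball 0 1 = - cutY z - cball 0 1" by (simp add: D_def)
  have fext: "f y = of_real z * Q 0 0 z - of_real z * F (sX0 z y)" if "y \<in> D - cball 0 1" for y
    using G_exterior[OF z F G] that by (simp add: D_def f_def)
  have y: "y \<in> D - closed_segment (of_real 0) (of_real (y2 z))" using y by (simp add: D_def segY_def)
  have main: "f y - (if 0 \<in> closed_segment (complex_of_real 0) (of_real (y2 z)) then B 0 else f 0) = of_real (1/pi) *
     integral {0..y2 z} (\<lambda>t. of_real (sqrt ((t - 0)*(y2 z - t))) * \<rho> (of_real t) * (kern w y (of_real t) - kern w 0 (of_real t)))"
  proof -
    have ne: "frontier (GY z) \<noteq> {}"
      using w(2) unfolding frontier_eq_empty CGF_def by blast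
    then obtain t0 where t0: "t0 \<in> frontier (GY z)" by blast
    show ?thesis
    proof (rule gluing_CGF[where D = D and C = "GY z" and \<iota> = \<iota> and U = U and ?t0.0 = t0])
      \<comment> \<open>The cut is a ray pointing away from 0, so the segment from 0 to a point off
        the cut never meets it.\<close>
      have "starlike D"
        unfolding starlike_def
      proof (intro bexI[of _ 0] ballI subsetI)
        fix x y assume x: "x \<in> D" and "y \<in> closed_segment 0 x"
        then obtain u where u: "0 \<le> u" "u \<le> 1" "y = of_real u * x" by (auto simp: in_segment scaleR_conv_of_real)
        show "y \<in> D"
        proof (rule ccontr)
          assume "y \<notin> D"
          then obtain r where r: "of_real u * x = of_real r" "y3 z \<le> r" using u by (auto simp: D_def cutY_def)
          then have u0: "u \<noteq> 0" using R by auto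
          then have "x = of_real (r / u)" using r(1) by (simp add: field_simps)
          moreover have "y3 z \<le> r / u"
          proof -
            have "y3 z * u \<le> y3 z * 1" using u R by (intro mult_left_mono) auto
            then show ?thesis using u u0 r(2) by (simp add: le_divide_eq)
          qed
          ultimately show False using x by (auto simp: D_def cutY_def)
        qed
      qed (use R in \<open>auto simp: D_def cutY_def\<close>)
      then show "connected D" by (rule starlike_imp_connected)
      show "0 < y2 z" by (rule R)
      show "mero_on D w" using w by (simp add: D_def)
      show "CGF (GY z) w" by (rule w)
      show "ball 0 1 \<subseteq> GY z" unfolding GYr(1) by auto
      show "closed_segment (of_real 0) (of_real (y2 z)) \<subseteq> ball (0::complex) 1"
        using R Y_cuts_real(1)[OF z] by (auto simp: segY_def)
      show "closure (GY z) \<subseteq> D" using cut_out by (auto simp: D_def)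
      show "connected (D - cball 0 1)" unfolding \<Omega>D by (rule connected_exterior_Y[OF z])
      show "frontier (GY z) \<inter> cball 0 1 = {}" unfolding GYr(4) Ycurve_eq[OF z] by auto
      show "\<iota> holomorphic_on D - cball 0 1"
      proof -
        have "sX0 z holomorphic_on - cutY z - cball 0 1"
          by (rule holomorphic_on_subset[OF sX0_holomorphic[OF z]]) (use Y_exterior(1)[OF z] in blast)
        then show ?thesis unfolding \<iota>_def \<Omega>D using Y_exterior(5)[OF z] by (intro holomorphic_intros) blast+
      qed
      show "\<iota> x \<in> D - cball 0 1" if "x \<in> D - cball 0 1" for x
        using Y_exterior(6)[OF z] that unfolding \<Omega>D \<iota>_def .
      show "\<iota> (\<iota> x) = x" if "x \<in> D - cball 0 1" for x
        using Y_exterior(8)[OF z] that unfolding \<Omega>D \<iota>_def .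
      show "\<iota> x = cnj x" if xf: "x \<in> frontier (GY z)" for x
      proof -
        have xc: "1 < norm x" "psiY z x = 0" using xf unfolding GYr(4) Ycurve_eq[OF z] by auto
        have "x \<in> closure (GY z)" using xf by (simp add: frontier_def)
        then have xe: "x \<in> - cutY z - cball 0 1" using cut_out xc by auto
        note E = Y_exterior[OF z xe]
        \<comment> \<open>On the curve X0 takes the positive real value 1/|y|, hence 1/(y X0^2) is
          the conjugate of y.\<close>
        define r where "r = complex_of_real (inverse (norm x))"
        have r2: "r^2 * (x * cnj x) = 1"
          unfolding r_def complex_norm_square[symmetric] using E(3) by (simp add: field_simps)
        have x1: "x \<noteq> -1" using xc by auto
        have "sX0 z x = r"
        proof (rule sX0_unique[OF z E(1,2) x1])
          have "of_real z * ((x + 1) * cnj (x + 1)) = of_real (norm x)"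
            unfolding complex_norm_square[symmetric] using xc(2) unfolding psiY_def by (simp flip: of_real_mult of_real_power)
          then have "of_real z * (x + 1) * (cnj x + 1) = of_real (norm x)" by (simp add: mult_ac)
          moreover have "r * of_real (norm x) = 1" using E(3) by (simp add: r_def)
          moreover have "cnj x * (1 + r^2 * x) = cnj x + 1" using r2 by (simp add: algebra_simps)
          moreover have "cnj x * (of_real z * (x + 1) * (1 + r^2 * x)) * r = of_real z * (x + 1) * (cnj x * (1 + r^2 * x)) * r"
            by (simp only: mult_ac)
          ultimately have "cnj x * (of_real z * (x + 1) * (1 + r^2 * x)) * r = 1" by (simp only: mult.commute)
          then have "cnj x * (of_real z * (x + 1) * (1 + r^2 * x)) * r = cnj x * (r * x) * r" using r2 by (simp add: power2_eq_square mult_ac)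
          then show "of_real z * (x + 1) * (1 + r^2 * x) = r * x" using E(3) by (simp add: r_def)
          have "norm r = inverse (norm x)" unfolding r_def norm_of_real by simp
          then have "norm (x * r^2) = inverse (norm x)" using E(3) by (simp add: norm_mult norm_power power2_eq_square)
          then show "norm (x * r^2) < 1" using xc(1) by (simp add: inverse_less_1_iff)
        qed
        then have "\<iota> x = inverse (x * r^2)" by (simp add: \<iota>_def)
        moreover have "(x * r^2) * cnj x = 1" using r2 by (simp only: mult_ac)
        ultimately show ?thesis by (simp only: inverse_unique)
      qed
      show "\<iota> x \<in> GY z" if xo: "x \<in> D - closure (GY z)" for x
      proof -
        have "x \<notin> GY z" "x \<notin> Ycurve z" using xo unfolding GYr(3) by auto
        then have xg: "\<not> norm x \<le> 1" "\<not> psiY z x < 0" "\<not> (1 < norm x \<and> psiY z x = 0)"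
          by (auto simp: GYr(1) Ycurve_eq[OF z])
        then have xe: "x \<in> - cutY z - cball 0 1" and ps: "psiY z x > 0" using xo by (auto simp: D_def)
        note E = Y_exterior[OF z xe, folded \<iota>_def]
        have "\<iota> x \<noteq> 0" using E(5) by (simp add: \<iota>_def)
        \<comment> \<open>The product relation says a b = 1/z^2, so a > 1/z outside the curve forces
          b < 1/z for the partner.\<close>
        define a b where "a = norm (x + inverse x + 2)" and "b = norm (\<iota> x + inverse (\<iota> x) + 2)"
        have a: "1/z < a" using psiY_sign(2)[OF E(3) z(1)] ps by (simp add: a_def)
        have "norm (complex_of_real (z^2) * (x + inverse x + 2) * (\<iota> x + inverse (\<iota> x) + 2)) = 1"
          using Y_exterior(9)[OF z xe] by (simp add: \<iota>_def)
        then have ab: "z^2 * a * b = 1" by (simp only: norm_mult norm_of_real a_def b_def abs_power2 power2_abs)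
        have "1 < z * a" using a z by (simp add: field_simps)
        have bp: "b > 0"
        proof (rule ccontr)
          assume "\<not> b > 0"
          then have "b = 0" by (simp add: b_def)
          then show False using ab by simp
        qed
        have "1 * (z * b) < (z * a) * (z * b)" using \<open>1 < z * a\<close> bp z by (intro mult_strict_right_mono) auto
        also have "\<dots> = 1" using ab by (simp add: power2_eq_square mult_ac)
        finally have "b < 1/z" using z by (simp add: field_simps)
        then have "psiY z (\<iota> x) < 0" using psiY_sign(1)[OF \<open>\<iota> x \<noteq> 0\<close> z(1)] by (simp add: b_def)
        then show ?thesis by (simp add: GYr(1))
      qed
      show "t0 \<in> frontier (GY z)" by (rule t0)
      show "t0 islimpt frontier (GY z)" using t0 GYr(5) unfolding GYr(4) by blast
      show "f holomorphic_on D - closed_segment (of_real 0) (of_real (y2 z))"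
        unfolding f_def D_def segY_def[symmetric] using sX0_holomorphic[OF z] G(1)
        by (auto intro!: holomorphic_intros intro: holomorphic_on_subset)
      show "f (\<iota> x) = f x" if xx: "x \<in> D - cball 0 1" for x
      proof -
        have xe: "x \<in> - cutY z - cball 0 1" using xx by (simp add: D_def)
        have "\<iota> x \<in> D - cball 0 1" using Y_exterior(6)[OF z xe] by (simp add: \<iota>_def D_def)
        moreover have "sX0 z (\<iota> x) = sX0 z x" using Y_exterior(7)[OF z xe] by (simp add: \<iota>_def)
        ultimately show ?thesis using fext[OF xx] fext[of "\<iota> x"] by simp
      qed
      show "open U" unfolding U_def by (intro open_Collect_conj open_Collect_less continuous_intros)
      show "closed_segment (of_real 0) (of_real (y2 z)) \<subseteq> U"
        using R Y_cuts_real(1)[OF z] by (auto simp: segY_def U_def)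
      have UD: "U \<subseteq> D" by (auto simp: U_def D_def cutY_def)
      have U0: "1 + y \<noteq> 0" if "y \<in> U" for y using that by (auto simp: U_def complex_eq_iff)
      show "B holomorphic_on U"
        unfolding B_def using U0 UD z by (intro holomorphic_intros holomorphic_on_subset[OF G(1)]) (auto simp: D_def)
      have pos: "of_real (y3 z) - y \<notin> \<real>\<^sub>\<le>\<^sub>0" if "y \<in> U" for y
        using that by (auto simp: complex_nonpos_Reals_iff U_def)
      show "\<rho> holomorphic_on U" unfolding \<rho>_def using pos U0 by (intro holomorphic_intros) auto
      show "f x = B x + cut_sqrt 0 (y2 z) x * \<rho> x" if "x \<in> U - closed_segment (of_real 0) (of_real (y2 z))" for x
        using sX0_slit[OF z, of x] that by (simp add: U_def segY_def f_def B_def \<rho>_def)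
      show "bounded (GY z) \<or> bounded (- D) \<and> (\<exists>K R. \<forall>x\<in>GY z. norm x > R \<longrightarrow> norm (f x) \<le> K)"
        using GYr(6) by blast
      show "0 \<in> ball 0 1 - closed_segment (complex_of_real 0) (of_real (y2 z)) \<union> {of_real 0}" by simp
      show "y \<in> D - closed_segment (of_real 0) (of_real (y2 z))" by (rule y)
    qed
  qed
  have "0 \<in> closed_segment (complex_of_real 0) (of_real (y2 z))" by simp
  moreover have "B 0 = of_real z * Q 0 0 z" using G(2) by (simp add: B_def)
  ultimately have base: "(if 0 \<in> closed_segment (complex_of_real 0) (of_real (y2 z)) then B 0 else f 0) = of_real z * Q 0 0 z"
    by (simp only: if_True)
  have J: "integral {0..y2 z} (\<lambda>t. of_real (sqrt ((t - 0)*(y2 z - t))) * \<rho> (of_real t) * (kern w y (of_real t) - kern w 0 (of_real t)))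
     = integral {0..y2 z} (\<lambda>t. of_real (t * sqrt (- td z t) / (2 * ta z t)) * (kern w y (of_real t) - kern w 0 (of_real t)))"
  proof (rule Henstock_Kurzweil_Integration.integral_cong)
    fix t assume t: "t \<in> {0..y2 z}"
    have t3: "t < y3 z" using t R by auto
    have s3: "of_real (y3 z) - complex_of_real t = of_real (y3 z - t)" by simp
    have rho: "\<rho> (of_real t) = of_real (sqrt (y3 z - t) / (1 + t))"
      unfolding \<rho>_def s3 using t3 by (simp add: csqrt_of_real del: of_real_diff)
    have "t * sqrt (- td z t) / (2 * ta z t) = sqrt ((t - 0) * (y2 z - t)) * (sqrt (y3 z - t) / (1 + t))"
    \<comment> \<open>At t = 0 \<open>ta z t\<close> vanishes as well; both sides are then
      0.\<close>
    proof (cases "t = 0")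
      case False
      then have t0: "t > 0" using t by simp
      have "- td z t = (2 * z)^2 * (((t - 0) * (y2 z - t)) * (y3 z - t))"
        using td_factor[OF z, of t] by (simp add: power2_eq_square algebra_simps)
      then have "sqrt (- td z t) = 2 * z * (sqrt ((t - 0) * (y2 z - t)) * sqrt (y3 z - t))"
        using z by (simp add: real_sqrt_mult)
      then show ?thesis using z t0 by (simp add: ta_def add.commute)
    qed simp
    then have "of_real (sqrt ((t - 0)*(y2 z - t))) * \<rho> (of_real t) = complex_of_real (t * sqrt (- td z t) / (2 * ta z t))"
      unfolding rho by (simp only: of_real_mult)
    then show "of_real (sqrt ((t - 0)*(y2 z - t))) * \<rho> (of_real t) * (kern w y (of_real t) - kern w 0 (of_real t)) =
       of_real (t * sqrt (- td z t) / (2 * ta z t)) * (kern w y (of_real t) - kern w 0 (of_real t))" by simp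
  qed
  have "X0 z y = sX0 z y" using y by (intro sX0_eq[OF z]) (auto simp: D_def segY_def)
  then have "of_real z * (G y - Q 0 0 z) = X0 z y * y + (f y - of_real z * Q 0 0 z)"
    by (simp add: f_def right_diff_distrib mult.commute)
  then show ?thesis unfolding main[unfolded base J] .
qed

theorem theorem6:
  fixes z :: real and w wt F G :: "complex \<Rightarrow> complex"
  assumes z: "0 < z" "z < 1/4"
    and w_mero: "mero_on (- cutX z) w" and w_cgf: "CGF (GX z) w"
    and wt_mero: "mero_on (- cutY z) wt" and wt_cgf: "CGF (GY z) wt"
    and F_hol: "F holomorphic_on (- cutX z)" and F_eq: "\<forall>x\<in>ball 0 1. F x = Q x 0 z"
    and G_hol: "G holomorphic_on (- cutY z)" and G_eq: "\<forall>y\<in>ball 0 1. G y = (y + 1) * Q 0 y z"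
  shows
    "(\<forall>x. x \<notin> cutX z \<and> x \<notin> closed_segment (of_real (x1 z)) (of_real (x2 z)) \<longrightarrow>
        of_real z * (F x - Q 0 0 z) =
          x * Y0 z x + of_real (1/pi) *
            integral {x1 z..x2 z} (\<lambda>t. of_real (t * sqrt (- gd z t) / (2 * ga z t)) *
               (kern w x (of_real t) - kern w 0 (of_real t)))) \<and>
     (\<forall>y. y \<notin> cutY z \<and> y \<notin> closed_segment (of_real y1) (of_real (y2 z)) \<longrightarrow>
        of_real z * (G y - Q 0 0 z) =
          X0 z y * y + of_real (1/pi) *
            integral {y1..y2 z} (\<lambda>t. of_real (t * sqrt (- td z t) / (2 * ta z t)) *
               (kern wt y (of_real t) - kern wt 0 (of_real t)))) \<and>
     of_real z * Q 0 0 z =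
       - of_real (1/pi) *
          integral {y1..y2 z} (\<lambda>t. of_real (t * sqrt (- td z t) / (2 * ta z t)) *
             (kern wt (-1) (of_real t) - kern wt 0 (of_real t)))"
proof (intro conjI allI impI)
  fix x assume "x \<notin> cutX z \<and> x \<notin> closed_segment (of_real (x1 z)) (of_real (x2 z))"
  then show "of_real z * (F x - Q 0 0 z) =
          x * Y0 z x + of_real (1/pi) *
            integral {x1 z..x2 z} (\<lambda>t. of_real (t * sqrt (- gd z t) / (2 * ga z t)) *
               (kern w x (of_real t) - kern w 0 (of_real t)))"
    unfolding segX_def[symmetric] by (elim conjE) (rule X_formula[OF z w_mero w_cgf F_hol F_eq G_hol G_eq])
next
  fix y assume "y \<notin> cutY z \<and> y \<notin> closed_segment (of_real y1) (of_real (y2 z))"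
  then show "of_real z * (G y - Q 0 0 z) =
          X0 z y * y + of_real (1/pi) *
            integral {y1..y2 z} (\<lambda>t. of_real (t * sqrt (- td z t) / (2 * ta z t)) *
               (kern wt y (of_real t) - kern wt 0 (of_real t)))"
    unfolding y1_def segY_def[symmetric] by (elim conjE) (rule Y_formula[OF z wt_mero wt_cgf F_hol F_eq G_hol G_eq])
next
  note R = y_roots[OF z]
  have m1: "-1 \<notin> segY z" "-1 \<notin> cutY z"
    using R unfolding Y_cuts_real[OF z] by (auto simp: complex_eq_iff)
  \<comment> \<open>The point -1 is on the boundary of the disc, where the series formula for G is
    not given. The value comes from the continued functional equation: X0(-1) = 0 and F(0) =
    Q(0,0,z).\<close>
  have "of_real z * G (-1) = 0"
    using G_exterior[OF z F_hol F_eq G_hol G_eq, of "-1"] F_eq by (simp add: sX0_minus_one)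
  moreover have "X0 z (-1) = 0" using sX0_eq[OF z m1] by (simp add: sX0_minus_one)
  moreover have "of_real z * (G (-1) - Q 0 0 z) = X0 z (-1) * -1 + of_real (1/pi) *
          integral {y1..y2 z} (\<lambda>t. of_real (t * sqrt (- td z t) / (2 * ta z t)) *
             (kern wt (-1) (of_real t) - kern wt 0 (of_real t)))"
    unfolding y1_def by (rule Y_formula[OF z wt_mero wt_cgf F_hol F_eq G_hol G_eq m1(2,1)])
  ultimately have a: "- (of_real z * Q 0 0 z) = of_real (1/pi) *
          integral {y1..y2 z} (\<lambda>t. of_real (t * sqrt (- td z t) / (2 * ta z t)) *
             (kern wt (-1) (of_real t) - kern wt 0 (of_real t)))"
    by (simp only: right_diff_distrib mult_zero_left add_0 diff_0)
  show "of_real z * Q 0 0 z =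
       - of_real (1/pi) *
          integral {y1..y2 z} (\<lambda>t. of_real (t * sqrt (- td z t) / (2 * ta z t)) *
             (kern wt (-1) (of_real t) - kern wt 0 (of_real t)))"
    by (simp only: mult_minus_left a[symmetric] minus_minus)
qed

end
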